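(* For every $D>\frac72$ there is a constant $c>0$ such that the following holds. Let $(x_n)_{n\in\mathbb Z}$ and $(y_n)_{n\in\mathbb Z}$ be two non-decreasing sequences of real numbers with $|x_n|,|y_n|\to\infty$ as $|n|\to\infty$, each of which is even (symmetric about the origin, i.e. $\{x_n:n\in\mathbb Z\}=\{-x_n:n\in\mathbb Z\}$ and $\{y_n:n\in\mathbb Z\}=\{-y_n:n\in\mathbb Z\}$), satisfying $$\max\Big(\limsup_{n\to\infty}|x_{n+1}|^{D}|x_{n+1}-x_n|,\ \limsup_{n\to\infty}|y_{n+1}|^{D}|y_{n+1}-y_n|\Big)\le c .$$ Then there exist functions $h_n,g_n\in\mathcal S(\mathbb R)$, $n\in\mathbb Z$, such that for every $f\in\mathcal S(\mathbb R)$ $$f(x)=\sum_{n\in\mathbb Z} f(x_n)\,h_n(x)+\sum_{n\in\mathbb Z}\widehat f(y_n)\,g_n(x),$$ and the sum converges in the topology of $\mathcal S(\mathbb R)$.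
   Context: $\mathcal S(\mathbb R)$ is the Schwartz space with its usual Fréchet topology. The Fourier transform is $\widehat f(\xi)=\int_{\mathbb R}f(x)e^{-2\pi i x\xi}\,dx$. *)

theory Defs
  imports "HOL-Analysis.Analysis"
begin

definition iter_deriv :: "nat \<Rightarrow> (real \<Rightarrow> complex) \<Rightarrow> real \<Rightarrow> complex" where
  "iter_deriv l f = ((\<lambda>u t. vector_derivative u (at t)) ^^ l) f"

definition schwartz_space :: "(real \<Rightarrow> complex) set" where
  "schwartz_space = {f.
     (\<forall>l t. iter_deriv l f differentiable (at t)) \<and>
     (\<forall>k l. bdd_above (range (\<lambda>t. \<bar>t\<bar> ^ k * norm (iter_deriv l f t))))}"

definition schwartz_seminorm :: "nat \<Rightarrow> nat \<Rightarrow> (real \<Rightarrow> complex) \<Rightarrow> real" where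
  "schwartz_seminorm k l f = (SUP t. \<bar>t\<bar> ^ k * norm (iter_deriv l f t))"

text \<open>The locally convex topology defined by the seminorms above: the open seminorm balls form
  a subbase. Its underlying set is the Schwartz space, see \<open>topspace_schwartz\<close> below.\<close>

definition schwartz_topology :: "(real \<Rightarrow> complex) topology" where
  "schwartz_topology = topology_generated_by
     {{u \<in> schwartz_space. schwartz_seminorm k l (\<lambda>t. u t - f t) < e} | k l f e.
        f \<in> schwartz_space \<and> e > 0}"

definition fourier :: "(real \<Rightarrow> complex) \<Rightarrow> real \<Rightarrow> complex" where
  "fourier f \<xi> = (LINT t|lborel. f t * exp (- 2 * complex_of_real pi * \<i> * of_real t * of_real \<xi>))"

text \<open>A sum over the integers with no prescribed order of summation: the net of all finite
  partial sums converges in the Schwartz space to the function \<open>s\<close>.\<close>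

definition schwartz_has_sum :: "(int \<Rightarrow> real \<Rightarrow> complex) \<Rightarrow> (real \<Rightarrow> complex) \<Rightarrow> bool" where
  "schwartz_has_sum a s \<longleftrightarrow>
     limitin schwartz_topology (\<lambda>F t. \<Sum>n\<in>F. a n t) s (finite_subsets_at_top UNIV)"

lemma iter_deriv_0 [simp]: "iter_deriv 0 f = f"
  by (simp add: iter_deriv_def)

lemma iter_deriv_Suc: "iter_deriv (Suc l) f = (\<lambda>t. vector_derivative (iter_deriv l f) (at t))"
  by (simp add: iter_deriv_def)

lemma iter_deriv_diff:
  assumes "f \<in> schwartz_space" "g \<in> schwartz_space"
  shows "iter_deriv l (\<lambda>t. f t - g t) = (\<lambda>t. iter_deriv l f t - iter_deriv l g t)"
proof (induction l)
  case (Suc l)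
  have "iter_deriv l f differentiable (at t)" "iter_deriv l g differentiable (at t)" for t
    using assms by (auto simp: schwartz_space_def)
  then show ?case
    by (simp add: iter_deriv_Suc Suc.IH)
qed simp

lemma schwartz_seminorm_upper:
  assumes "f \<in> schwartz_space"
  shows "\<bar>t\<bar> ^ k * norm (iter_deriv l f t) \<le> schwartz_seminorm k l f"
  unfolding schwartz_seminorm_def
  using assms by (intro cSUP_upper) (auto simp: schwartz_space_def)

lemma schwartz_space_diff:
  assumes "f \<in> schwartz_space" "g \<in> schwartz_space"
  shows "(\<lambda>t. f t - g t) \<in> schwartz_space"
proof -
  have "bdd_above (range (\<lambda>t. \<bar>t\<bar> ^ k * norm (iter_deriv l f t - iter_deriv l g t)))" for k l
  proof -
    let ?A = "schwartz_seminorm k l f" and ?B = "schwartz_seminorm k l g"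
    have "\<bar>t\<bar> ^ k * norm (iter_deriv l f t - iter_deriv l g t) \<le> ?A + ?B" for t
    proof -
      have "\<bar>t\<bar> ^ k * norm (iter_deriv l f t - iter_deriv l g t)
          \<le> \<bar>t\<bar> ^ k * (norm (iter_deriv l f t) + norm (iter_deriv l g t))"
        by (intro mult_left_mono norm_triangle_ineq4) auto
      then show ?thesis
        using schwartz_seminorm_upper[OF assms(1), of t k l]
          schwartz_seminorm_upper[OF assms(2), of t k l]
        unfolding distrib_left by linarith
    qed
    then show ?thesis by (auto simp: bdd_above_def)
  qed
  with assms show ?thesis
    by (auto simp: schwartz_space_def iter_deriv_diff[OF assms] intro!: differentiable_diff)
qed

lemma schwartz_seminorm_nonneg:
  assumes "f \<in> schwartz_space"
  shows "0 \<le> schwartz_seminorm k l f"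
  by (rule order_trans[OF _ schwartz_seminorm_upper[OF assms, of 0]]) simp

lemma schwartz_seminorm_triangle:
  assumes "f \<in> schwartz_space" "g \<in> schwartz_space" "h \<in> schwartz_space"
  shows "schwartz_seminorm k l (\<lambda>t. f t - h t)
       \<le> schwartz_seminorm k l (\<lambda>t. f t - g t) + schwartz_seminorm k l (\<lambda>t. g t - h t)"
proof -
  have "\<bar>t\<bar> ^ k * norm (iter_deriv l f t - iter_deriv l h t)
      \<le> schwartz_seminorm k l (\<lambda>t. f t - g t) + schwartz_seminorm k l (\<lambda>t. g t - h t)" for t
  proof -
    have "norm (iter_deriv l f t - iter_deriv l h t)
        \<le> norm (iter_deriv l f t - iter_deriv l g t) + norm (iter_deriv l g t - iter_deriv l h t)"
      using norm_triangle_ineq[of "iter_deriv l f t - iter_deriv l g t"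
          "iter_deriv l g t - iter_deriv l h t"] by simp
    then have "\<bar>t\<bar> ^ k * norm (iter_deriv l f t - iter_deriv l h t)
        \<le> \<bar>t\<bar> ^ k * norm (iter_deriv l f t - iter_deriv l g t)
          + \<bar>t\<bar> ^ k * norm (iter_deriv l g t - iter_deriv l h t)"
      unfolding distrib_left[symmetric] by (intro mult_left_mono) auto
    then show ?thesis
      using schwartz_seminorm_upper[OF schwartz_space_diff[OF assms(1,2)], of t k l]
        schwartz_seminorm_upper[OF schwartz_space_diff[OF assms(2,3)], of t k l]
      unfolding iter_deriv_diff[OF assms(1,2)] iter_deriv_diff[OF assms(2,3)] by linarith
  qed
  then show ?thesis
    unfolding schwartz_seminorm_def[of k l "\<lambda>t. f t - h t"]
    unfolding iter_deriv_diff[OF assms(1,3)] by (intro cSUP_least) auto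
qed

lemma schwartz_seminorm_diff_self:
  assumes "f \<in> schwartz_space"
  shows "schwartz_seminorm k l (\<lambda>t. f t - f t) = 0"
  unfolding schwartz_seminorm_def iter_deriv_diff[OF assms assms] by simp

lemma openin_schwartz_ball:
  assumes "f \<in> schwartz_space" "e > 0"
  shows "openin schwartz_topology {u \<in> schwartz_space. schwartz_seminorm k l (\<lambda>t. u t - f t) < e}"
  unfolding schwartz_topology_def by (intro topology_generated_by_Basis) (use assms in auto)

lemma topspace_schwartz: "topspace schwartz_topology = schwartz_space"
proof
  show "topspace schwartz_topology \<subseteq> schwartz_space"
    unfolding schwartz_topology_def topology_generated_by_topspace by auto
  show "schwartz_space \<subseteq> topspace schwartz_topology"
  proof
    fix f assume f: "f \<in> schwartz_space"
    have "f \<in> {u \<in> schwartz_space. schwartz_seminorm 0 0 (\<lambda>t. u t - f t) < 1}"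
      using f by (simp only: mem_Collect_eq schwartz_seminorm_diff_self[OF f]) simp
    then show "f \<in> topspace schwartz_topology"
      using openin_subset[OF openin_schwartz_ball[OF f, of 1 0 0]] by auto
  qed
qed

lemma limitin_schwartz_iff:
  "limitin schwartz_topology u s \<F> \<longleftrightarrow>
     s \<in> schwartz_space \<and> (\<forall>\<^sub>F i in \<F>. u i \<in> schwartz_space) \<and>
     (\<forall>k l. ((\<lambda>i. schwartz_seminorm k l (\<lambda>t. u i t - s t)) \<longlongrightarrow> 0) \<F>)"
    (is "?L \<longleftrightarrow> ?R")
proof
  assume L: ?L
  then have s: "s \<in> schwartz_space"
    by (metis limitin_topspace topspace_schwartz)
  have ev: "\<forall>\<^sub>F i in \<F>. u i \<in> schwartz_space \<and> schwartz_seminorm k l (\<lambda>t. u i t - s t) < e"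
    if "e > 0" for k l e
  proof -
    let ?B = "{v \<in> schwartz_space. schwartz_seminorm k l (\<lambda>t. v t - s t) < e}"
    have "s \<in> ?B"
      using s that by (simp only: mem_Collect_eq schwartz_seminorm_diff_self[OF s])
    with L openin_schwartz_ball[OF s that, of k l] have "\<forall>\<^sub>F i in \<F>. u i \<in> ?B"
      unfolding limitin_def by blast
    then show ?thesis by simp
  qed
  have "((\<lambda>i. schwartz_seminorm k l (\<lambda>t. u i t - s t)) \<longlongrightarrow> 0) \<F>" for k l
  proof (rule tendstoI)
    fix e :: real assume "e > 0"
    from ev[OF this, of k l]
    show "\<forall>\<^sub>F i in \<F>. dist (schwartz_seminorm k l (\<lambda>t. u i t - s t)) 0 < e"
      by eventually_elim
        (use s in \<open>auto simp: abs_of_nonneg schwartz_seminorm_nonneg schwartz_space_diff\<close>)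
  qed
  moreover have "\<forall>\<^sub>F i in \<F>. u i \<in> schwartz_space"
    using ev[of 1 0 0] by (auto elim: eventually_mono)
  ultimately show ?R using s by blast
next
  assume R: ?R
  have "\<forall>\<^sub>F i in \<F>. u i \<in> U" if "generate_topology_on
     {{u \<in> schwartz_space. schwartz_seminorm k l (\<lambda>t. u t - f t) < e} | k l f e.
        f \<in> schwartz_space \<and> e > 0} U" "s \<in> U" for U
    using that
  proof (induction rule: generate_topology_on.induct)
    case (Int a b)
    then show ?case by (auto intro: eventually_conj)
  next
    case (UN K)
    then obtain k where "k \<in> K" "\<forall>\<^sub>F i in \<F>. u i \<in> k" by auto
    then show ?case by (auto elim: eventually_mono)
  next
    case (Basis B)
    then obtain k l f e where B: "B = {u \<in> schwartz_space. schwartz_seminorm k l (\<lambda>t. u t - f t) < e}"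
      and f: "f \<in> schwartz_space" by blast
    have lt: "e - schwartz_seminorm k l (\<lambda>t. s t - f t) > 0" using Basis B by auto
    have "\<forall>\<^sub>F i in \<F>. schwartz_seminorm k l (\<lambda>t. u i t - s t)
            < e - schwartz_seminorm k l (\<lambda>t. s t - f t)"
      using R lt order_tendstoD(2) by blast
    moreover have "\<forall>\<^sub>F i in \<F>. u i \<in> schwartz_space" using R by blast
    ultimately show ?case
    proof eventually_elim
      case (elim i)
      then show ?case
        using schwartz_seminorm_triangle[of "u i" s f k l] R f by (auto simp: B)
    qed
  qed simp
  then show ?L
    using R unfolding limitin_def topspace_schwartz
    by (auto simp: schwartz_topology_def openin_topology_generated_by_iff)
qed

end

theory Submission
  imports Defs "HOL-Probability.Sinc_Integral" "HOL-Probability.Characteristic_Functions"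
begin

text \<open>Let \<open>V f\<close> be the short-time Fourier transform of \<open>f\<close> with a Gaussian window, a function of
  \<open>(x, \<xi>)\<close>. Where \<open>\<bar>\<xi>\<bar> < \<bar>x\<bar>\<close> it is an integral of \<open>f\<close> against a Gaussian atom, elsewhere (up to a phase)
  an integral of the Fourier transform of \<open>f\<close>. Replacing these integrals by Riemann sums over the points
  \<open>x\<^sub>n\<close> and \<open>y\<^sub>n\<close>, whose gaps are at most of order \<open>\<bar>t\<bar>\<^sup>-\<^sup>3\<close>, gives \<open>V f = (samples) + E (V f)\<close> with an
  integral operator \<open>E\<close> that gains one power of decay. Up to an operator of finite rank \<open>E\<close> is a
  contraction; the Neumann series inverts the rest, and the gain of decay makes the inverse preserve
  rapid decay. Hence \<open>f\<close> is the sum of a series in its samples and of an element of a fixed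
  finite-dimensional space of Schwartz functions.

  That element is recovered from finitely many samples, because the samples determine a Schwartz function: if
  they all vanish, the error formula of Lagrange interpolation at \<open>k\<close> zeros close to \<open>t\<close> bounds \<open>\<bar>f t\<bar>\<close> by
  \<open>(K / \<bar>t\<bar>\<^sup>3)\<^sup>k\<close> times the \<open>k\<close>-th moment of the Fourier transform, and conversely. So the moments of both
  functions grow at most geometrically, \<open>f\<close> has compact support and derivatives of geometric growth, and
  therefore vanishes.\<close>

section \<open>Weights and integrals\<close>

text \<open>Near a point \<open>t\<close> the nodes are spaced like the power -3 of
  \<open>\<bar>t\<bar>\<close>, while an atom at \<open>(x, \<xi>)\<close> oscillates at speed
  \<open>\<xi>\<close>. This dictates the cut of the phase plane: on either side the samples used
  belong to the larger variable, where the mesh is fine compared with the oscillation. The three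
  powers are spent as follows: one pays for the derivative of the atoms, one for the integration of
  the error kernel over frequency, along which it does not decay, and the last one is the gain.
  Smallness of the error comes from this gain and not from the size of the gaps, which is why the
  constant c can be 1. Its coefficients are integrals of the transform and not samples of
  \<open>f\<close>. Expressing them by samples is the obstacle that calls for uniqueness, and as
  only finitely many functions are involved, a qualitative uniqueness statement suffices.\<close>

text \<open>The weights of the line and of the phase plane; all decay is measured in powers of them.\<close>

definition br :: "real \<Rightarrow> real" where "br u = 1 + \<bar>u\<bar>"

definition om :: "real \<times> real \<Rightarrow> real" where "om z = 1 + \<bar>fst z\<bar> + \<bar>snd z\<bar>"

lemma br_ge1: "1 \<le> br u" and br_pos: "0 < br u" and br_neg [simp]: "br (- u) = br u"
  by (auto simp: br_def)

text \<open>Submultiplicativity moves weights between points: a power of \<open>br\<close> at one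
  point is bounded by the same power at another point and a power of the distance, which a Gaussian
  absorbs.\<close>

lemma br_add: "br (u + v) \<le> br u * br v"
proof -
  have "0 \<le> \<bar>u\<bar> * \<bar>v\<bar>" by simp
  then show ?thesis unfolding br_def distrib_right distrib_left
    by (smt (verit) abs_triangle_ineq mult_1 mult_1_right)
qed

lemma br_diff: "br (u - v) \<le> br u * br v"
  using br_add[of u "- v"] by simp

lemma br_power_pos [simp]: "0 < br u ^ n" and br_power_ge1: "1 \<le> br u ^ n"
  by (auto simp: br_pos one_le_power br_ge1)

lemma om_ge1: "1 \<le> om z" and om_pos: "0 < om z"
  by (auto simp: om_def)

lemma om_nz [simp]: "om z \<noteq> 0" and br_nz [simp]: "br u \<noteq> 0"
  using om_pos[of z] br_pos[of u] by auto

lemma om_power_pos [simp]: "0 < om z ^ n"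
  by (simp add: om_pos)

lemma br_fst_le_om: "br (fst z) \<le> om z" and br_snd_le_om: "br (snd z) \<le> om z"
  by (auto simp: om_def br_def)

lemma borel_measurable_br [measurable]: "br \<in> borel_measurable borel"
  unfolding br_def[abs_def] by measurable

lemma borel_measurable_om [measurable]: "om \<in> borel_measurable borel"
  unfolding om_def[abs_def] borel_prod[symmetric] by measurable

text \<open>Since \<open>br u \<le> exp \<bar>u\<bar>\<close>, it suffices to bound the exponent
  \<open>N * \<bar>u\<bar> - pi * u\<^sup>2\<close>; completing the square and \<open>pi > 1\<close>
  give \<open>N\<^sup>2\<close>.\<close>

lemma gauss_decay: "\<exists>C\<ge>0. \<forall>u. exp (- pi * u\<^sup>2) \<le> C / br u ^ N"
proof (intro exI[of _ "exp (real N ^ 2)"] conjI allI)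
  fix u :: real
  have "br u \<le> exp \<bar>u\<bar>" unfolding br_def by (rule exp_ge_add_one_self)
  then have "br u ^ N \<le> exp \<bar>u\<bar> ^ N" by (intro power_mono) (auto simp: br_def)
  also have "\<dots> = exp (real N * \<bar>u\<bar>)" by (simp add: exp_of_nat_mult)
  finally have "exp (- pi * u\<^sup>2) * br u ^ N \<le> exp (- pi * u\<^sup>2) * exp (real N * \<bar>u\<bar>)"
    by (intro mult_left_mono) auto
  also have "\<dots> = exp (real N * \<bar>u\<bar> - pi * u\<^sup>2)" by (simp add: exp_add[symmetric])
  also have "\<dots> \<le> exp (real N ^ 2)"
  proof (subst exp_le_cancel_iff)
    have "0 \<le> (real N - \<bar>u\<bar>)\<^sup>2" "0 \<le> (real N)\<^sup>2" "1 * u\<^sup>2 \<le> pi * u\<^sup>2"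
      using pi_gt3 by (simp, simp, intro mult_right_mono, auto)
    moreover have "(real N - \<bar>u\<bar>)\<^sup>2 = (real N)\<^sup>2 + u\<^sup>2 - 2 * (real N * \<bar>u\<bar>)"
      by (simp add: power2_eq_square algebra_simps)
    moreover have "0 \<le> real N * \<bar>u\<bar>" by simp
    ultimately show "real N * \<bar>u\<bar> - pi * u\<^sup>2 \<le> (real N)\<^sup>2" by linarith
  qed
  finally show "exp (- pi * u\<^sup>2) \<le> exp (real N ^ 2) / br u ^ N" by (simp add: pos_le_divide_eq)
qed simp

lemma integrable_br2: "integrable lborel (\<lambda>u. 1 / br u ^ 2)"
proof (rule Bochner_Integration.integrable_bound)
  show "integrable lborel (\<lambda>u. inverse (1 + u\<^sup>2) :: real)"
    using integrable_inverse_1_plus_square unfolding set_integrable_def by simp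
  have "inverse ((br u)\<^sup>2) \<le> inverse (1 + u\<^sup>2)" for u
    by (rule le_imp_inverse_le) (auto simp: br_def power2_eq_square algebra_simps add_pos_nonneg)
  then show "AE u in lborel. norm (1 / br u ^ 2) \<le> norm (inverse (1 + u\<^sup>2))"
    by (intro AE_I2) (auto simp: br_pos divide_inverse less_imp_le add_nonneg_nonneg)
qed measurable

definition brint :: real where "brint = (LINT u|lborel. 1 / br u ^ 2)"

lemma brint_nonneg: "0 \<le> brint"
  unfolding brint_def by (intro integral_nonneg_AE AE_I2) (auto simp: br_pos less_imp_le)

lemma integral_shift:
  fixes f :: "real \<Rightarrow> 'a::{banach, second_countable_topology}"
  shows "(LINT t|lborel. f (t - a)) = (LINT t|lborel. f t)"
  using lborel_integral_real_affine[of 1 f "- a"] by simp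

lemma integrable_shift:
  fixes f :: "real \<Rightarrow> 'a::{banach, second_countable_topology}"
  shows "integrable lborel f \<Longrightarrow> integrable lborel (\<lambda>t. f (t - a))"
  using lborel_integrable_real_affine[of f 1 "- a"] by simp

lemma integrable_br2_shift: "integrable lborel (\<lambda>u. 1 / br (u - a) ^ 2)"
  and integral_br2_shift: "(LINT u|lborel. 1 / br (u - a) ^ 2) = brint"
  using integrable_shift[OF integrable_br2, of a] integral_shift[of "\<lambda>u. 1 / br u ^ 2" a]
  by (auto simp: brint_def)

text \<open>The substitution \<open>A * v\<close> for \<open>v\<close>. With \<open>A = br x\<close>
  this is the frequency integral in \<open>errk_weight\<close>: two powers of the weight are given
  up and one comes back.\<close>

lemma scaled_br2:
  assumes "A > 0"
  shows "integrable lborel (\<lambda>v. 1 / (A + \<bar>v\<bar>) ^ 2)"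
    and "(LINT v|lborel. 1 / (A + \<bar>v\<bar>) ^ 2) = brint / A"
proof -
  have eq: "1 / (A + \<bar>0 + A * v\<bar>) ^ 2 = (1 / A ^ 2) * (1 / br v ^ 2)" for v
  proof -
    have "A + \<bar>A * v\<bar> = A * br v" using assms by (simp add: br_def abs_mult algebra_simps)
    then show ?thesis by (simp add: power_mult_distrib)
  qed
  show "integrable lborel (\<lambda>v. 1 / (A + \<bar>v\<bar>) ^ 2)"
    using lborel_integrable_real_affine_iff[of A "\<lambda>v. 1 / (A + \<bar>v\<bar>) ^ 2" 0] assms
      integrable_mult_right[OF integrable_br2, of "1 / A ^ 2"]
    by (simp only: eq)
  show "(LINT v|lborel. 1 / (A + \<bar>v\<bar>) ^ 2) = brint / A"
    using lborel_integral_real_affine[of A "\<lambda>v. 1 / (A + \<bar>v\<bar>) ^ 2" 0] assms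
    unfolding eq integral_mult_right_zero brint_def[symmetric]
    by (simp add: power2_eq_square field_simps)
qed

lemma integrable_product:
  fixes f g :: "real \<Rightarrow> real"
  assumes f: "integrable lborel f" and g: "integrable lborel g"
  shows "integrable lborel (\<lambda>z. f (fst z) * g (snd z))"
    and "(LINT z|lborel. f (fst z) * g (snd z)) = (LINT u|lborel. f u) * (LINT u|lborel. g u)"
proof -
  have [measurable]: "f \<in> borel_measurable borel" "g \<in> borel_measurable borel"
    using f g borel_measurable_integrable by auto
  have *: "integrable (lborel \<Otimes>\<^sub>M lborel) (\<lambda>(x, y). f x * g y)"
    by (rule lborel_pair.Fubini_integrable)
       (use f g in \<open>auto simp: abs_mult intro!: integrable_mult_left\<close>)
  then show "integrable lborel (\<lambda>z. f (fst z) * g (snd z))"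
    by (simp add: lborel_prod[symmetric] case_prod_beta')
  show "(LINT z|lborel. f (fst z) * g (snd z)) = (LINT u|lborel. f u) * (LINT u|lborel. g u)"
    using lborel_pair.integral_fst[OF *] by (simp add: lborel_prod[symmetric] case_prod_beta')
qed

text \<open>The plane needs one integrable square per coordinate, hence the exponent 4 that recurs
  below as the reserve for integrability.\<close>

lemma om4_le: "1 / om z ^ 4 \<le> (1 / br (fst z) ^ 2) * (1 / br (snd z) ^ 2)"
proof -
  have "br (fst z) ^ 2 * br (snd z) ^ 2 \<le> om z ^ 2 * om z ^ 2"
    by (intro mult_mono power_mono br_fst_le_om br_snd_le_om) (auto simp: br_pos less_imp_le)
  then have "br (fst z) ^ 2 * br (snd z) ^ 2 \<le> om z ^ 4" by (simp flip: power_add)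
  then have "1 / om z ^ 4 \<le> 1 / (br (fst z) ^ 2 * br (snd z) ^ 2)"
    by (intro divide_left_mono mult_pos_pos om_power_pos br_power_pos) auto
  then show ?thesis by simp
qed

lemma integrable_om4: "integrable lborel (\<lambda>z. 1 / om z ^ 4)"
proof (rule Bochner_Integration.integrable_bound[OF integrable_product(1)[OF integrable_br2 integrable_br2]])
  show "AE z in lborel. norm (1 / om z ^ 4) \<le> norm (1 / (br (fst z))\<^sup>2 * (1 / (br (snd z))\<^sup>2))"
    by (intro AE_I2) (use om4_le in \<open>auto simp: om_pos br_pos less_imp_le\<close>)
qed measurable

lemma integrable_om:
  assumes "n \<ge> 4" shows "integrable lborel (\<lambda>z. 1 / om z ^ n)"
proof (rule Bochner_Integration.integrable_bound[OF integrable_om4])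
  show "AE z in lborel. norm (1 / om z ^ n) \<le> norm (1 / om z ^ 4)"
    by (intro AE_I2) (auto simp: om_pos less_imp_le intro!: divide_left_mono power_increasing[OF assms om_ge1] mult_pos_pos)
qed measurable

text \<open>Dominated convergence for the remainder of the difference quotient, which the mean value
  bound \<open>lip\<close> keeps below \<open>2 * B\<close>. The measure is left general: Lebesgue
  measure on the plane serves to differentiate \<open>synth\<close>, counting measure to
  differentiate series termwise.\<close>

lemma leibniz:
  fixes g g' :: "real \<Rightarrow> 'a \<Rightarrow> complex"
  assumes g: "\<And>t. integrable M (g t)" and g': "\<And>t. g' t \<in> borel_measurable M"
    and der: "\<And>t z. z \<in> space M \<Longrightarrow> ((\<lambda>t. g t z) has_vector_derivative g' t z) (at t)"
    and bd: "\<And>t z. z \<in> space M \<Longrightarrow> norm (g' t z) \<le> B z" and B: "integrable M B"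
  shows "((\<lambda>t. LINT z|M. g t z) has_vector_derivative (LINT z|M. g' t z)) (at t)"
proof -
  have ig': "integrable M (g' t)" for t
    by (rule Bochner_Integration.integrable_bound[OF B g'])
       (intro AE_I2, use bd in \<open>metis abs_ge_self order_trans real_norm_def\<close>)
  let ?e = "\<lambda>y z. (1 / norm (y - t)) *\<^sub>R (g y z - (g t z + (y - t) *\<^sub>R g' t z))"
  have lip: "norm (g y z - g t z) \<le> B z * norm (y - t)" if "z \<in> space M" for y z
  proof (rule differentiable_bound[of UNIV "\<lambda>t. g t z" "\<lambda>t h. h *\<^sub>R g' t z"])
    show "((\<lambda>t. g t z) has_derivative (\<lambda>h. h *\<^sub>R g' s z)) (at s)" for s
      using der[OF that, of s] by (simp add: has_vector_derivative_def)
    show "onorm (\<lambda>h. h *\<^sub>R g' s z) \<le> B z" for s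
      by (rule onorm_le) (use bd[OF that, of s] in \<open>simp add: mult.commute[of "B z"] mult_left_mono\<close>)
  qed auto
  have lim: "((\<lambda>y. LINT z|M. ?e y z) \<longlongrightarrow> 0) (at t)"
  proof (subst tendsto_at_iff_sequentially, intro allI impI)
    fix X assume X: "\<forall>i. X i \<in> UNIV - {t}" "X \<longlonglongrightarrow> t"
    have "(\<lambda>i. LINT z|M. ?e (X i) z) \<longlonglongrightarrow> (LINT z|M. 0)"
    proof (rule integral_dominated_convergence)
      show "integrable M (\<lambda>z. 2 * B z)" using B by simp
      show "(\<lambda>z. ?e (X i) z) \<in> borel_measurable M" for i
        using g g' borel_measurable_integrable by measurable
      show "AE z in M. (\<lambda>i. ?e (X i) z) \<longlonglongrightarrow> 0"
      proof (intro AE_I2)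
        fix z assume "z \<in> space M"
        from der[OF this, of t] have "((\<lambda>y. ?e y z) \<longlongrightarrow> 0) (at t)"
          unfolding has_vector_derivative_def has_derivative_within by simp
        then show "(\<lambda>i. ?e (X i) z) \<longlonglongrightarrow> 0"
          using X by (auto simp: tendsto_at_iff_sequentially o_def)
      qed
      show "AE z in M. norm (?e (X i) z) \<le> 2 * B z" for i
      proof (intro AE_I2)
        fix z assume z: "z \<in> space M"
        have n: "norm (X i - t) > 0" using X by auto
        have "norm (g (X i) z - (g t z + (X i - t) *\<^sub>R g' t z))
           \<le> norm (g (X i) z - g t z) + norm ((X i - t) *\<^sub>R g' t z)"
          by (metis diff_diff_eq norm_triangle_ineq4)
        also have "\<dots> \<le> B z * norm (X i - t) + norm (X i - t) * B z"
          unfolding norm_scaleR real_norm_def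
          using lip[OF z, of "X i"] bd[OF z, of t] by (intro add_mono mult_left_mono) auto
        finally show "norm (?e (X i) z) \<le> 2 * B z"
          using n unfolding norm_scaleR by (simp add: pos_divide_le_eq mult_ac)
      qed
    qed auto
    then show "((\<lambda>y. LINT z|M. ?e y z) \<circ> X) \<longlonglongrightarrow> 0" by (simp add: o_def)
  qed
  have eqn: "(LINT z|M. ?e y z) = (1 / norm (y - t)) *\<^sub>R ((LINT z|M. g y z) - ((LINT z|M. g t z) + (y - t) *\<^sub>R (LINT z|M. g' t z)))" for y
    using g ig' by simp
  show ?thesis
    using lim unfolding eqn has_vector_derivative_def has_derivative_within
    by (simp add: bounded_linear_scaleR_left)
qed

text \<open>A sequence of functions, each the derivative of the one before, identifies all iterated
  derivatives of its first member. Finite sums, series and synthesised functions are shown to be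
  Schwartz by displaying such a sequence.\<close>

lemma iter_deriv_eqI:
  assumes "\<And>l t. (F l has_vector_derivative F (Suc l) t) (at t)"
  shows "iter_deriv l (F 0) = F l"
proof (induction l)
  case (Suc l)
  then show ?case using vector_derivative_at[OF assms[of l]] by (auto simp: iter_deriv_Suc)
qed simp

lemma iter_deriv_has_vector_derivative:
  assumes "f \<in> schwartz_space"
  shows "(iter_deriv l f has_vector_derivative iter_deriv (Suc l) f t) (at t)"
  using assms by (auto simp: schwartz_space_def iter_deriv_Suc vector_derivative_works[symmetric])

lemma schwartzI:
  assumes F: "\<And>l t. (F l has_vector_derivative F (Suc l) t) (at t)"
    and bd: "\<And>k l. \<exists>C. \<forall>t. \<bar>t\<bar> ^ k * norm (F l t) \<le> C"
  shows "F 0 \<in> schwartz_space"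
proof -
  have "iter_deriv l (F 0) = F l" for l by (rule iter_deriv_eqI[of F, OF F])
  moreover have "F l differentiable (at t)" for l t
    using F[of l t] by (auto simp: differentiable_def has_vector_derivative_def)
  moreover have "bdd_above (range (\<lambda>t. \<bar>t\<bar> ^ k * norm (F l t)))" for k l
    using bd[of k l] by (auto simp: bdd_above_def)
  ultimately show ?thesis by (simp add: schwartz_space_def)
qed

lemma seminorm_le:
  assumes F: "\<And>l t. (F l has_vector_derivative F (Suc l) t) (at t)"
    and bd: "\<And>t. \<bar>t\<bar> ^ k * norm (F l t) \<le> C"
  shows "schwartz_seminorm k l (F 0) \<le> C"
  unfolding schwartz_seminorm_def iter_deriv_eqI[of F, OF F] by (intro cSUP_least) (auto simp: bd)

section \<open>Fourier inversion for Schwartz functions\<close>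

lemma fourier_cis: "fourier f \<xi> = (LINT t|lborel. f t * cis (- 2 * pi * t * \<xi>))"
  unfolding fourier_def cis_conv_exp by (simp add: mult_ac)

lemma borel_measurable_cis [measurable]: "cis \<in> borel_measurable borel"
  by (intro borel_measurable_continuous_onI continuous_intros)

lemma has_vector_derivative_cis:
  "((\<lambda>t. cis (a * t + b)) has_vector_derivative (\<i> * of_real a * cis (a * t + b))) (at t)"
  unfolding has_vector_derivative_def
  by (rule has_derivative_eq_rhs, rule has_derivative_cis, rule derivative_intros, (rule derivative_intros)+)
     (auto simp: scaleR_conv_of_real mult_ac)

text \<open>The integral is the characteristic function of the standard normal distribution at
  \<open>- sqrt (2 * pi) * \<xi>\<close>, rewritten by the substitution
  \<open>x = sqrt (2 * pi) * t\<close>.\<close>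

lemma gauss_fourier_unit:
  "integrable lborel (\<lambda>t. complex_of_real (exp (- pi * t\<^sup>2)) * cis (- 2 * pi * t * \<xi>))"
  "(LINT t|lborel. complex_of_real (exp (- pi * t\<^sup>2)) * cis (- 2 * pi * t * \<xi>)) = of_real (exp (- pi * \<xi>\<^sup>2))"
proof -
  obtain C where C: "C \<ge> 0" "\<And>u. exp (- pi * u\<^sup>2) \<le> C / br u ^ 2"
    using gauss_decay[of 2] by auto
  show "integrable lborel (\<lambda>t. complex_of_real (exp (- pi * t\<^sup>2)) * cis (- 2 * pi * t * \<xi>))"
  proof (rule Bochner_Integration.integrable_bound)
    show "integrable lborel (\<lambda>u. C * (1 / br u ^ 2))"
      by (intro integrable_mult_right integrable_br2)
    show "AE x in lborel. norm (complex_of_real (exp (- pi * x\<^sup>2)) * cis (- 2 * pi * x * \<xi>))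
         \<le> norm (C * (1 / (br x)\<^sup>2))"
      using C by (intro AE_I2) (auto simp: norm_mult)
  qed measurable
  let ?s = "- sqrt (2 * pi) * \<xi>" and ?c = "sqrt (2 * pi)"
  have "char std_normal_distribution ?s = complex_of_real (exp (- (?s^2) / 2))"
    by (simp add: char_std_normal_distribution)
  also have "- (?s^2) / 2 = - pi * \<xi>\<^sup>2" by (simp add: power_mult_distrib)
  finally have "of_real (exp (- pi * \<xi>\<^sup>2)) = char std_normal_distribution ?s" by simp
  also have "\<dots> = (LINT x|lborel. std_normal_density x *\<^sub>R iexp (?s * x))"
    unfolding char_def by (subst integral_density) auto
  also have "\<dots> = \<bar>?c\<bar> *\<^sub>R (LINT x|lborel. std_normal_density (0 + ?c * x) *\<^sub>R iexp (?s * (0 + ?c * x)))"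
    by (rule lborel_integral_real_affine) simp
  also have "\<dots> = (LINT x|lborel. \<bar>?c\<bar> *\<^sub>R (std_normal_density (0 + ?c * x) *\<^sub>R iexp (?s * (0 + ?c * x))))"
    by (rule integral_scaleR_right[symmetric])
  also have "\<dots> = (LINT t|lborel. complex_of_real (exp (- pi * t\<^sup>2)) * cis (- 2 * pi * t * \<xi>))"
  proof (intro Bochner_Integration.integral_cong refl)
    fix t
    have 1: "\<bar>?c\<bar> * std_normal_density (0 + ?c * t) = exp (- pi * t\<^sup>2)"
      by (simp add: normal_density_def power_mult_distrib)
    have 2: "?s * (0 + ?c * t) = - 2 * pi * t * \<xi>"
    proof -
      have "?s * (0 + ?c * t) = - (?c * ?c) * t * \<xi>"
        by (simp only: add_0 mult_minus_left mult_ac)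
      also have "?c * ?c = 2 * pi" by simp
      finally show ?thesis by simp
    qed
    have "\<bar>?c\<bar> *\<^sub>R (std_normal_density (0 + ?c * t) *\<^sub>R iexp (?s * (0 + ?c * t)))
       = (\<bar>?c\<bar> * std_normal_density (0 + ?c * t)) *\<^sub>R iexp (?s * (0 + ?c * t))"
      by simp
    then show "\<bar>?c\<bar> *\<^sub>R (std_normal_density (0 + ?c * t) *\<^sub>R iexp (?s * (0 + ?c * t)))
       = complex_of_real (exp (- pi * t\<^sup>2)) * cis (- 2 * pi * t * \<xi>)"
      unfolding 1 2 by (simp add: cis_conv_exp scaleR_conv_of_real)
  qed
  finally show "(LINT t|lborel. complex_of_real (exp (- pi * t\<^sup>2)) * cis (- 2 * pi * t * \<xi>)) = of_real (exp (- pi * \<xi>\<^sup>2))"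
    by simp
qed

lemma gauss_fourier:
  assumes "a > 0"
  shows "integrable lborel (\<lambda>t. complex_of_real (exp (- pi * (a * t)\<^sup>2)) * cis (- 2 * pi * t * \<xi>))"
    and "(LINT t|lborel. complex_of_real (exp (- pi * (a * t)\<^sup>2)) * cis (- 2 * pi * t * \<xi>))
       = of_real (exp (- pi * (\<xi> / a)\<^sup>2) / a)"
proof -
  let ?g = "\<lambda>t. complex_of_real (exp (- pi * t\<^sup>2)) * cis (- 2 * pi * t * (\<xi> / a))"
  have eq: "complex_of_real (exp (- pi * (a * t)\<^sup>2)) * cis (- 2 * pi * t * \<xi>) = ?g (0 + a * t)" for t
    using assms by (simp add: mult.assoc)
  show "integrable lborel (\<lambda>t. complex_of_real (exp (- pi * (a * t)\<^sup>2)) * cis (- 2 * pi * t * \<xi>))"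
    unfolding eq using gauss_fourier_unit(1)[of "\<xi> / a"] assms
    by (subst lborel_integrable_real_affine_iff) auto
  define I where "I = (LINT t|lborel. ?g (0 + a * t))"
  have "(LINT t|lborel. ?g t) = \<bar>a\<bar> *\<^sub>R I"
    unfolding I_def by (rule lborel_integral_real_affine) (use assms in auto)
  then have "I = of_real (exp (- pi * (\<xi> / a)\<^sup>2)) / of_real a"
    using assms unfolding gauss_fourier_unit(2) scaleR_conv_of_real
    by (simp add: nonzero_eq_divide_eq mult.commute del: of_real_exp)
  then show "(LINT t|lborel. complex_of_real (exp (- pi * (a * t)\<^sup>2)) * cis (- 2 * pi * t * \<xi>))
       = of_real (exp (- pi * (\<xi> / a)\<^sup>2) / a)"
    unfolding eq I_def[symmetric] by (simp only: of_real_divide)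
qed

lemma gauss_integral:
  assumes "a > 0"
  shows "integrable lborel (\<lambda>t. exp (- pi * (a * t)\<^sup>2))" "(LINT t|lborel. exp (- pi * (a * t)\<^sup>2)) = 1 / a"
proof -
  have *: "complex_of_real (exp (- pi * (a * t)\<^sup>2)) * cis (- 2 * pi * t * 0) = complex_of_real (exp (- pi * (a * t)\<^sup>2))" for t
    by simp
  show "integrable lborel (\<lambda>t. exp (- pi * (a * t)\<^sup>2))"
    using integrable_Re[OF gauss_fourier(1)[OF assms, of 0]] by (simp only: * Re_complex_of_real)
  have "complex_of_real (LINT t|lborel. exp (- pi * (a * t)\<^sup>2)) = of_real (1 / a)"
    using gauss_fourier(2)[OF assms, of 0] unfolding * integral_complex_of_real[symmetric]
    by (simp only: div_0 power_zero_numeral mult_zero_right exp_zero)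
  then show "(LINT t|lborel. exp (- pi * (a * t)\<^sup>2)) = 1 / a" by (simp only: of_real_eq_iff)
qed

lemma norm_fourier_le: "norm (fourier f \<xi>) \<le> (LINT t|lborel. norm (f t))"
  unfolding fourier_cis by (rule order_trans[OF integral_norm_bound]) (simp add: norm_mult)

lemma integrable_fourier_integrand:
  "integrable lborel f \<Longrightarrow> integrable lborel (\<lambda>t. f t * cis (a * t * \<xi>))"
  by (rule Bochner_Integration.integrable_bound) (auto simp: norm_mult)

lemma borel_measurable_fourier [measurable]:
  assumes [measurable]: "f \<in> borel_measurable borel"
  shows "fourier f \<in> borel_measurable borel"
  unfolding fourier_cis[abs_def] by measurable

lemma fourier_multiplication:
  assumes f: "integrable lborel f" and g: "integrable lborel g"
  shows "(LINT t|lborel. fourier f t * g t) = (LINT t|lborel. f t * fourier g t)"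
proof -
  have [measurable]: "f \<in> borel_measurable borel" "g \<in> borel_measurable borel"
    using f g borel_measurable_integrable by auto
  have y: "integrable lborel (\<lambda>y. f x * cis (- 2 * pi * x * y) * g y)" for x
    by (rule Bochner_Integration.integrable_bound[OF integrable_mult_right[OF integrable_norm[OF g], of "norm (f x)"]])
       (auto simp: norm_mult)
  have *: "integrable (lborel \<Otimes>\<^sub>M lborel) (\<lambda>(x, y). f x * cis (- 2 * pi * x * y) * g y)"
    by (rule lborel_pair.Fubini_integrable)
       (use f g y in \<open>auto simp: norm_mult intro!: integrable_mult_left\<close>)
  have "(LINT t|lborel. fourier f t * g t) = (LINT y|lborel. LINT x|lborel. f x * cis (- 2 * pi * x * y) * g y)"
    unfolding fourier_cis integral_mult_left_zero ..
  also have "\<dots> = (LINT x|lborel. LINT y|lborel. f x * cis (- 2 * pi * x * y) * g y)"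
    by (rule lborel_pair.Fubini_integral[OF *])
  also have "\<dots> = (LINT t|lborel. f t * fourier g t)"
    unfolding fourier_cis integral_mult_right_zero[symmetric]
    by (intro Bochner_Integration.integral_cong refl) (simp add: mult_ac)
  finally show ?thesis .
qed

text \<open>The widening Gaussians \<open>G n\<close> tend to 1 while their transforms form an
  approximate identity at 0. The multiplication formula equates the two limits: the integral of
  \<open>fourier h\<close> on one side, \<open>h 0\<close> on the other.\<close>

lemma fourier_inversion_0:
  assumes h: "integrable lborel h" "continuous_on UNIV h" "\<And>t. norm (h t) \<le> B"
    and fh: "integrable lborel (fourier h)"
  shows "(LINT \<xi>|lborel. fourier h \<xi>) = h 0"
proof -
  have [measurable]: "h \<in> borel_measurable borel" using h(1) borel_measurable_integrable by auto
  define G where "G n \<xi> = complex_of_real (exp (- pi * (1 / real (Suc n) * \<xi>)\<^sup>2))" for n \<xi>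
  have Gi: "integrable lborel (G n)" for n
    unfolding G_def by (rule integrable_of_real, rule gauss_integral) simp
  have FG: "fourier (G n) t = of_real (real (Suc n) * exp (- pi * (real (Suc n) * t)\<^sup>2))" for n t
    unfolding fourier_cis G_def
    by (subst gauss_fourier) (auto simp: mult_ac)
  have 1: "(\<lambda>n. LINT \<xi>|lborel. fourier h \<xi> * G n \<xi>) \<longlonglongrightarrow> (LINT \<xi>|lborel. fourier h \<xi>)"
  proof (rule integral_dominated_convergence)
    show "integrable lborel (\<lambda>\<xi>. norm (fourier h \<xi>))" using fh by simp
    show "AE x in lborel. norm (fourier h x * G n x) \<le> norm (fourier h x)" for n
      by (intro AE_I2) (auto simp: norm_mult G_def intro!: mult_left_le)
    show "AE x in lborel. (\<lambda>n. fourier h x * G n x) \<longlonglongrightarrow> fourier h x"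
    proof (intro AE_I2)
      fix x
      have "(\<lambda>n. 1 / real (Suc n) * x) \<longlonglongrightarrow> 0 * x"
        by (rule tendsto_mult_right[OF LIMSEQ_Suc[OF lim_1_over_n]])
      then have "(\<lambda>n. fourier h x * G n x) \<longlonglongrightarrow> fourier h x * complex_of_real (exp (- pi * (0 * x)\<^sup>2))"
        unfolding G_def by - (assumption | rule tendsto_mult_left tendsto_of_real tendsto_exp tendsto_power)+
      then show "(\<lambda>n. fourier h x * G n x) \<longlonglongrightarrow> fourier h x" by simp
    qed
    show "(\<lambda>x. fourier h x * G n x) \<in> borel_measurable lborel" for n unfolding G_def by measurable
  qed (use fh borel_measurable_integrable in auto)
  have 2: "(LINT \<xi>|lborel. fourier h \<xi> * G n \<xi>)
       = (LINT u|lborel. h (u / real (Suc n)) * of_real (exp (- pi * u\<^sup>2)))" for n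
  proof -
    have "(LINT \<xi>|lborel. fourier h \<xi> * G n \<xi>) = (LINT t|lborel. h t * fourier (G n) t)"
      by (rule fourier_multiplication[OF h(1) Gi])
    also have "\<dots> = \<bar>1 / real (Suc n)\<bar> *\<^sub>R (LINT u|lborel. h (0 + 1 / real (Suc n) * u) * fourier (G n) (0 + 1 / real (Suc n) * u))"
      by (rule lborel_integral_real_affine) simp
    also have "\<dots> = (LINT u|lborel. (1 / real (Suc n)) *\<^sub>R (h (0 + 1 / real (Suc n) * u) * fourier (G n) (0 + 1 / real (Suc n) * u)))"
      by simp
    also have "\<dots> = (LINT u|lborel. h (u / real (Suc n)) * of_real (exp (- pi * u\<^sup>2)))"
      unfolding FG by (intro Bochner_Integration.integral_cong refl) (simp add: scaleR_conv_of_real del: of_nat_Suc)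
    finally show ?thesis .
  qed
  have 3: "(\<lambda>n. LINT u|lborel. h (u / real (Suc n)) * of_real (exp (- pi * u\<^sup>2)))
       \<longlonglongrightarrow> (LINT u|lborel. h 0 * of_real (exp (- pi * u\<^sup>2)))"
  proof (rule integral_dominated_convergence)
    show "integrable lborel (\<lambda>u. B * exp (- pi * u\<^sup>2))"
      using gauss_integral(1)[of 1] by simp
    show "AE u in lborel. norm (h (u / real (Suc n)) * of_real (exp (- pi * u\<^sup>2))) \<le> B * exp (- pi * u\<^sup>2)" for n
      by (intro AE_I2) (auto simp: norm_mult h(3) intro!: mult_right_mono)
    show "AE u in lborel. (\<lambda>n. h (u / real (Suc n)) * of_real (exp (- pi * u\<^sup>2))) \<longlonglongrightarrow> h 0 * of_real (exp (- pi * u\<^sup>2))"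
    proof (intro AE_I2 tendsto_intros)
      fix u
      have "(\<lambda>n. 1 / real (Suc n) * u) \<longlonglongrightarrow> 0 * u"
        by (rule tendsto_mult_right[OF LIMSEQ_Suc[OF lim_1_over_n]])
      moreover have "isCont h 0" using h(2) by (simp add: continuous_on_eq_continuous_at)
      ultimately show "(\<lambda>n. h (u / real (Suc n))) \<longlonglongrightarrow> h 0"
        using isCont_tendsto_compose[of 0 h "\<lambda>n. 1 / real (Suc n) * u"] by simp
    qed
  qed auto
  have "(LINT u|lborel. h 0 * of_real (exp (- pi * u\<^sup>2))) = h 0 * of_real (LINT u|lborel. exp (- pi * u\<^sup>2))"
    by (simp del: of_real_exp)
  also have "\<dots> = h 0" using gauss_integral(2)[of 1] by simp
  finally show ?thesis using LIMSEQ_unique[OF 1[unfolded 2] 3] by simp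
qed

text \<open>Translating \<open>h\<close> by \<open>s\<close> multiplies its transform by a
  character, which reduces the point \<open>s\<close> to the point 0.\<close>

lemma fourier_inversion:
  assumes h: "integrable lborel h" "continuous_on UNIV h" "\<And>t. norm (h t) \<le> B"
    and fh: "integrable lborel (fourier h)"
  shows "(LINT \<xi>|lborel. fourier h \<xi> * cis (2 * pi * s * \<xi>)) = h s"
proof -
  have eq: "fourier (\<lambda>t. h (t + s)) \<xi> = fourier h \<xi> * cis (2 * pi * s * \<xi>)" for \<xi>
  proof -
    have "fourier (\<lambda>t. h (t + s)) \<xi> = (LINT t|lborel. h ((t - s) + s) * cis (- 2 * pi * (t - s) * \<xi>))"
      unfolding fourier_cis using integral_shift[of "\<lambda>t. h (t + s) * cis (- 2 * pi * t * \<xi>)" s] by simp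
    also have "\<dots> = (LINT t|lborel. h t * cis (- 2 * pi * t * \<xi>) * cis (2 * pi * s * \<xi>))"
      by (intro Bochner_Integration.integral_cong refl) (simp add: cis_mult mult.assoc, simp add: algebra_simps)
    also have "\<dots> = fourier h \<xi> * cis (2 * pi * s * \<xi>)" unfolding fourier_cis by simp
    finally show ?thesis .
  qed
  have "(LINT \<xi>|lborel. fourier (\<lambda>t. h (t + s)) \<xi>) = h (0 + s)"
  proof (rule fourier_inversion_0[where B = B])
    show "integrable lborel (\<lambda>t. h (t + s))" using integrable_shift[OF h(1), of "- s"] by simp
    show "continuous_on UNIV (\<lambda>t. h (t + s))"
      by (intro continuous_on_compose2[OF h(2)] continuous_intros) auto
    show "integrable lborel (fourier (\<lambda>t. h (t + s)))"
      unfolding eq[abs_def] using integrable_fourier_integrand[OF fh, of "2 * pi * s" 1] 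
      by (rule back_subst[of "integrable lborel"]) (auto simp: mult_ac)
  qed (rule h)
  then show ?thesis unfolding eq by simp
qed

section \<open>Decay of Schwartz functions and of their Fourier transforms\<close>

lemma sch_decay:
  assumes "f \<in> schwartz_space"
  shows "\<exists>C\<ge>0. \<forall>t. norm (iter_deriv l f t) \<le> C / br t ^ N"
proof -
  let ?A = "schwartz_seminorm N l f" and ?B = "schwartz_seminorm 0 l f"
  have "norm (iter_deriv l f t) \<le> 2 ^ N * (?A + ?B) / br t ^ N" for t
  proof -
    have "br t ^ N \<le> (2 * max 1 \<bar>t\<bar>) ^ N" by (intro power_mono) (auto simp: br_def)
    also have "\<dots> = 2 ^ N * max 1 \<bar>t\<bar> ^ N" by (simp add: power_mult_distrib)
    also have "\<dots> \<le> 2 ^ N * (\<bar>t\<bar> ^ N + \<bar>t\<bar> ^ 0)" by (intro mult_left_mono) (auto simp: max_def)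
    finally have "norm (iter_deriv l f t) * br t ^ N \<le> norm (iter_deriv l f t) * (2 ^ N * (\<bar>t\<bar> ^ N + \<bar>t\<bar> ^ 0))"
      by (intro mult_left_mono) auto
    also have "\<dots> = 2 ^ N * (\<bar>t\<bar> ^ N * norm (iter_deriv l f t) + \<bar>t\<bar> ^ 0 * norm (iter_deriv l f t))"
      by (simp add: algebra_simps)
    also have "\<dots> \<le> 2 ^ N * (?A + ?B)"
      by (intro mult_left_mono add_mono schwartz_seminorm_upper assms) auto
    finally show ?thesis by (simp add: pos_le_divide_eq)
  qed
  then show ?thesis
    using schwartz_seminorm_nonneg[OF assms] by (intro exI[of _ "2 ^ N * (?A + ?B)"]) auto
qed

lemma sch_decay0:
  assumes "f \<in> schwartz_space"
  obtains C where "C \<ge> 0" "\<And>t. norm (f t) \<le> C / br t ^ N"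
  using sch_decay[OF assms, of 0 N] by auto

lemma iter_deriv_continuous:
  assumes "f \<in> schwartz_space" shows "continuous_on UNIV (iter_deriv l f)"
  using iter_deriv_has_vector_derivative[OF assms]
  by (meson continuous_at_imp_continuous_on has_vector_derivative_continuous)

lemma iter_deriv_measurable:
  assumes "f \<in> schwartz_space" shows "iter_deriv l f \<in> borel_measurable borel"
  by (intro borel_measurable_continuous_onI iter_deriv_continuous assms)

lemma sch_continuous: "f \<in> schwartz_space \<Longrightarrow> continuous_on UNIV f"
  using iter_deriv_continuous[of f 0] by simp

lemma sch_measurable: "f \<in> schwartz_space \<Longrightarrow> f \<in> borel_measurable borel"
  using iter_deriv_measurable[of f 0] by simp

lemma integrable_decay2:
  fixes f :: "real \<Rightarrow> complex"
  assumes "f \<in> borel_measurable borel" "\<And>t. norm (f t) \<le> C / br t ^ 2"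
  shows "integrable lborel f"
proof (rule Bochner_Integration.integrable_bound[OF integrable_mult_right[OF integrable_br2, of C]])
  show "AE t in lborel. norm (f t) \<le> norm (C * (1 / br t ^ 2))"
    using assms(2) by (intro AE_I2) (simp, metis abs_ge_self abs_divide abs_power2 order_trans)
qed (use assms in simp)

lemma iter_deriv_integrable:
  assumes "f \<in> schwartz_space" shows "integrable lborel (iter_deriv l f)"
  using sch_decay[OF assms, of l 2] integrable_decay2[OF iter_deriv_measurable[OF assms]] by blast

lemma sch_integrable: "f \<in> schwartz_space \<Longrightarrow> integrable lborel f"
  using iter_deriv_integrable[of f 0] by simp

lemma sch_deriv:
  assumes f: "f \<in> schwartz_space" shows "iter_deriv 1 f \<in> schwartz_space"
proof -
  have "(\<lambda>l. iter_deriv (Suc l) f) 0 \<in> schwartz_space"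
  proof (rule schwartzI)
    show "(iter_deriv (Suc l) f has_vector_derivative iter_deriv (Suc (Suc l)) f t) (at t)" for l t
      by (rule iter_deriv_has_vector_derivative[OF f])
    show "\<exists>C. \<forall>t. \<bar>t\<bar> ^ k * norm (iter_deriv (Suc l) f t) \<le> C" for k l
      using schwartz_seminorm_upper[OF f] by blast
  qed
  then show ?thesis by simp
qed

lemma integral_derivative_eq_0:
  fixes F F' :: "real \<Rightarrow> complex"
  assumes F: "\<And>t. (F has_vector_derivative F' t) (at t)" and cont: "continuous_on UNIV F'"
    and int: "integrable lborel F'" and lim: "(F \<longlongrightarrow> 0) at_top" "(F \<longlongrightarrow> 0) at_bot"
  shows "(LINT t|lborel. F' t) = 0"
proof -
  have "(LBINT x=-\<infinity>..\<infinity>. F' x) = 0 - 0"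
  proof (rule interval_integral_FTC_integrable)
    show "isCont F' x" for x using cont by (simp add: continuous_on_eq_continuous_at)
    show "set_integrable lborel (einterval (- \<infinity>) \<infinity>) F'"
      using int by (simp add: set_integrable_def)
    show "((F \<circ> real_of_ereal) \<longlongrightarrow> 0) (at_right (- \<infinity>))" "((F \<circ> real_of_ereal) \<longlongrightarrow> 0) (at_left \<infinity>)"
      using lim by (simp_all add: ereal_tendsto_simps)
  qed (use F in auto)
  then show ?thesis by (simp add: interval_lebesgue_integral_def set_lebesgue_integral_def)
qed

lemma br_decay_tendsto_0:
  fixes F :: "real \<Rightarrow> complex"
  assumes "\<And>t. norm (F t) \<le> C / br t" 
  shows "(F \<longlongrightarrow> 0) at_top" "(F \<longlongrightarrow> 0) at_bot"
proof -
  have "filterlim br at_top at_top" unfolding br_def[abs_def]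
    by (intro filterlim_tendsto_add_at_top[OF tendsto_const] filterlim_abs_real)
  then have 1: "((\<lambda>t. C / br t) \<longlongrightarrow> 0) at_top"
    by (intro real_tendsto_divide_at_top[OF tendsto_const])
  then show "(F \<longlongrightarrow> 0) at_top"
    by (rule Lim_null_comparison[rotated]) (use assms in auto)
  have "((\<lambda>t. C / br (- t)) \<longlongrightarrow> 0) at_top" using 1 by simp
  then have "((\<lambda>t. C / br t) \<longlongrightarrow> 0) at_bot"
    by (simp only: at_bot_mirror filterlim_filtermap)
  then show "(F \<longlongrightarrow> 0) at_bot"
    by (rule Lim_null_comparison[rotated]) (use assms in auto)
qed

lemma fourier_deriv:
  assumes f: "f \<in> schwartz_space"
  shows "fourier (iter_deriv 1 f) \<xi> = 2 * pi * \<i> * \<xi> * fourier f \<xi>"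
proof -
  let ?e = "\<lambda>t. cis (- 2 * pi * t * \<xi>)"
  let ?F = "\<lambda>t. f t * ?e t"
  let ?F' = "\<lambda>t. iter_deriv 1 f t * ?e t - 2 * pi * \<i> * \<xi> * (f t * ?e t)"
  have e: "(?e has_vector_derivative (- 2 * pi * \<i> * \<xi> * ?e t)) (at t)" for t
    using has_vector_derivative_cis[of "- 2 * pi * \<xi>" 0 t] by (simp add: mult_ac)
  have f': "(f has_vector_derivative iter_deriv 1 f t) (at t)" for t
    using iter_deriv_has_vector_derivative[OF f, of 0 t] by simp
  obtain C where C: "C \<ge> 0" "\<And>t. norm (f t) \<le> C / br t ^ 1" using sch_decay0[OF f] by metis
  have i1: "integrable lborel (\<lambda>t. iter_deriv 1 f t * ?e t)"
    by (rule integrable_fourier_integrand[OF iter_deriv_integrable[OF f]])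
  have i2: "integrable lborel (\<lambda>t. f t * ?e t)"
    by (rule integrable_fourier_integrand[OF sch_integrable[OF f]])
  have "(LINT t|lborel. ?F' t) = 0"
  proof (rule integral_derivative_eq_0)
    show "(?F has_vector_derivative ?F' t) (at t)" for t
      by (rule has_vector_derivative_eq_rhs[OF has_vector_derivative_mult[OF f' e]]) (simp add: algebra_simps)
    show "continuous_on UNIV ?F'"
      by (intro continuous_intros iter_deriv_continuous f sch_continuous)
    show "integrable lborel ?F'"
      by (intro Bochner_Integration.integrable_diff integrable_mult_right i1 i2)
    have "norm (?F t) \<le> C / br t" for t using C(2)[of t] by (simp add: norm_mult)
    from br_decay_tendsto_0[of ?F, OF this] show "(?F \<longlongrightarrow> 0) at_top" "(?F \<longlongrightarrow> 0) at_bot" by auto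
  qed
  then show ?thesis
    unfolding fourier_cis using i1 i2 by simp
qed

text \<open>The next power of decay comes from the bound already known for the derivative, whose
  transform is \<open>2 * pi * \<i> * \<xi>\<close> times \<open>fourier f\<close>. Hence the
  induction has to range over all \<open>f\<close>.\<close>

lemma fourier_decay:
  assumes "f \<in> schwartz_space"
  shows "\<exists>C\<ge>0. \<forall>\<xi>. norm (fourier f \<xi>) \<le> C / br \<xi> ^ N"
  using assms
proof (induction N arbitrary: f)
  case 0
  show ?case
    by (rule exI[of _ "LINT t|lborel. norm (f t)"]) (auto simp: norm_fourier_le)
next
  case (Suc N)
  obtain C1 where C1: "C1 \<ge> 0" "\<And>\<xi>. norm (fourier f \<xi>) \<le> C1 / br \<xi> ^ N" using Suc.IH[OF Suc.prems] by auto
  obtain C2 where C2: "C2 \<ge> 0" "\<And>\<xi>. norm (fourier (iter_deriv 1 f) \<xi>) \<le> C2 / br \<xi> ^ N"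
    using Suc.IH[OF sch_deriv[OF Suc.prems]] by auto
  have "norm (fourier f \<xi>) \<le> (C1 + C2) / br \<xi> ^ Suc N" for \<xi>
  proof -
    have "\<bar>\<xi>\<bar> * norm (fourier f \<xi>) \<le> (2 * pi) * (\<bar>\<xi>\<bar> * norm (fourier f \<xi>))"
      using pi_gt3 mult_right_mono[of 1 "2 * pi" "\<bar>\<xi>\<bar> * norm (fourier f \<xi>)"] by simp
    also have "\<dots> = norm (fourier (iter_deriv 1 f) \<xi>)"
      using fourier_deriv[OF Suc.prems, of \<xi>] by (simp add: norm_mult)
    finally have "br \<xi> * norm (fourier f \<xi>) \<le> C1 / br \<xi> ^ N + C2 / br \<xi> ^ N"
      using C1(2)[of \<xi>] C2(2)[of \<xi>] by (simp add: br_def algebra_simps)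
    then have "norm (fourier f \<xi>) \<le> ((C1 + C2) / br \<xi> ^ N) / br \<xi>"
      by (subst pos_le_divide_eq[OF br_pos]) (simp add: mult.commute add_divide_distrib)
    then show ?thesis by (simp add: mult.commute)
  qed
  then show ?case using C1 C2 by (intro exI[of _ "C1 + C2"]) auto
qed

section \<open>The short-time Fourier transform\<close>

text \<open>The factor \<open>2 powr (1/4)\<close> gives the window unit norm in L^2, which makes
  \<open>synth\<close> an exact left inverse of \<open>stft\<close>; the factor \<open>pi\<close> in
  the exponent makes the window its own Fourier transform.\<close>

definition phi :: "real \<Rightarrow> real" where "phi t = 2 powr (1/4) * exp (- pi * t\<^sup>2)"

definition atom :: "real \<times> real \<Rightarrow> real \<Rightarrow> complex" where
  "atom z t = of_real (phi (t - fst z)) * cis (2 * pi * t * snd z)"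

definition stft :: "(real \<Rightarrow> complex) \<Rightarrow> real \<times> real \<Rightarrow> complex" where
  "stft f z = (LINT t|lborel. f t * cnj (atom z t))"

definition synth :: "(real \<times> real \<Rightarrow> complex) \<Rightarrow> real \<Rightarrow> complex" where
  "synth U t = (LINT z|lborel. U z * atom z t)"

lemma borel_measurable_phi [measurable]: "phi \<in> borel_measurable borel"
  unfolding phi_def[abs_def] by measurable

lemma borel_measurable_atom [measurable]:
  assumes [measurable]: "f \<in> borel_measurable M" "g \<in> borel_measurable M"
  shows "(\<lambda>w. atom (f w) (g w)) \<in> borel_measurable M"
proof -
  have [measurable]: "(\<lambda>w. fst (f w)) \<in> borel_measurable M" "(\<lambda>w. snd (f w)) \<in> borel_measurable M"
    using measurable_compose[OF assms(1), of fst borel] measurable_compose[OF assms(1), of snd borel]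
    by (auto simp flip: borel_prod)
  show ?thesis unfolding atom_def by measurable
qed

lemma borel_measurable_cnj [measurable]: "cnj \<in> borel_measurable borel"
  by (intro borel_measurable_continuous_onI continuous_intros)

lemma phi_nonneg [simp]: "0 \<le> phi t" and phi_minus [simp]: "phi (- t) = phi t"
  and phi_diff_commute: "phi (s - t) = phi (t - s)"
  by (auto simp: phi_def power2_commute)

lemma norm_atom [simp]: "norm (atom z t) = phi (t - fst z)"
  by (simp add: atom_def norm_mult)

lemma phi_decay: obtains C where "C \<ge> 0" "\<And>u. phi u \<le> C / br u ^ N"
proof -
  obtain C where C: "C \<ge> 0" "\<And>u. exp (- pi * u\<^sup>2) \<le> C / br u ^ N"
    using gauss_decay[of N] by auto
  have "phi u \<le> (2 powr (1/4) * C) / br u ^ N" for u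
    unfolding phi_def using mult_left_mono[OF C(2)[of u], of "2 powr (1/4)"] by simp
  then show ?thesis using that[of "2 powr (1/4) * C"] C(1) by simp
qed

lemma phi_square: "phi t * phi t = sqrt 2 * exp (- pi * (sqrt 2 * t)\<^sup>2)"
proof -
  have s: "2 powr (1/4) * 2 powr (1/4) = sqrt 2"
    unfolding powr_add[symmetric] by (simp add: powr_half_sqrt)
  have "phi t * phi t = (2 powr (1/4) * 2 powr (1/4)) * (exp (- pi * t\<^sup>2) * exp (- pi * t\<^sup>2))"
    unfolding phi_def by (simp only: mult_ac)
  also note s
  also have "exp (- pi * t\<^sup>2) * exp (- pi * t\<^sup>2) = exp (- pi * (sqrt 2 * t)\<^sup>2)"
    by (simp add: power_mult_distrib flip: exp_add)
  finally show ?thesis .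
qed

lemma phi_square_integral:
  "integrable lborel (\<lambda>t. phi t * phi t)" "(LINT t|lborel. phi t * phi t) = 1"
  unfolding phi_square using gauss_integral[of "sqrt 2"] by (auto simp: integral_mult_right_zero)

lemma phi_integrable: "integrable lborel phi"
  unfolding phi_def[abs_def] using gauss_integral(1)[of 1] by simp

lemma phi_fourier: "(LINT t|lborel. of_real (phi t) * cis (- 2 * pi * t * \<xi>)) = of_real (phi \<xi>)"
proof -
  have "(LINT t|lborel. of_real (phi t) * cis (- 2 * pi * t * \<xi>))
     = (LINT t|lborel. of_real (2 powr (1/4)) * (of_real (exp (- pi * t\<^sup>2)) * cis (- 2 * pi * t * \<xi>)))"
    by (intro Bochner_Integration.integral_cong refl) (simp add: phi_def mult_ac)
  then show ?thesis unfolding integral_mult_right_zero gauss_fourier_unit(2) by (simp add: phi_def)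
qed

lemma integrable_atom: "integrable lborel (atom z)"
  by (rule Bochner_Integration.integrable_bound[OF integrable_shift[OF phi_integrable, of "fst z"]])
     auto

text \<open>Translations become modulations and conversely, and the window is its own transform: on
  atoms the Fourier transform is a quarter turn of the phase plane, up to a phase.\<close>

lemma fourier_atom:
  "fourier (atom z) \<eta> = cis (2 * pi * fst z * snd z) * atom (snd z, - fst z) \<eta>"
proof -
  have "fourier (atom z) \<eta> = (LINT t|lborel. atom z (t - (- fst z)) * cis (- 2 * pi * (t - (- fst z)) * \<eta>))"
    unfolding fourier_cis using integral_shift[of "\<lambda>t. atom z t * cis (- 2 * pi * t * \<eta>)" "- fst z"] by simp
  also have "\<dots> = (LINT t|lborel. cis (2 * pi * fst z * (snd z - \<eta>)) * (of_real (phi t) * cis (- 2 * pi * t * (\<eta> - snd z))))"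
    by (intro Bochner_Integration.integral_cong refl) (simp add: atom_def cis_mult mult_ac, simp add: algebra_simps)
  also have "\<dots> = cis (2 * pi * fst z * (snd z - \<eta>)) * of_real (phi (\<eta> - snd z))"
    unfolding integral_mult_right_zero phi_fourier ..
  also have "\<dots> = cis (2 * pi * fst z * snd z) * atom (snd z, - fst z) \<eta>"
    by (simp add: atom_def cis_mult mult_ac, simp add: algebra_simps)
  finally show ?thesis .
qed

lemma cnj_atom: "cnj (atom (x, \<xi>) t) = atom (x, - \<xi>) t"
  by (simp add: atom_def cis_cnj)

lemma borel_measurable_stft [measurable]:
  assumes [measurable]: "f \<in> borel_measurable borel"
  shows "stft f \<in> borel_measurable borel"
  unfolding stft_def[abs_def] by measurable

text \<open>The multiplication formula shifts the transform from \<open>f\<close> to the atom, which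
  is thereby rotated. This symmetry lets the samples of \<open>fourier f\<close> do the work where
  those of \<open>f\<close> are too sparse.\<close>

lemma stft_fourier:
  assumes f: "integrable lborel f"
  shows "stft f (x, \<xi>) = cis (- 2 * pi * x * \<xi>) * stft (fourier f) (\<xi>, - x)"
proof -
  have "stft (fourier f) (\<xi>, - x) = (LINT t|lborel. fourier f t * atom (\<xi>, x) t)"
    unfolding stft_def cnj_atom by simp
  also have "\<dots> = (LINT t|lborel. f t * fourier (atom (\<xi>, x)) t)"
    by (rule fourier_multiplication[OF f integrable_atom])
  also have "\<dots> = (LINT t|lborel. cis (2 * pi * \<xi> * x) * (f t * cnj (atom (x, \<xi>) t)))"
    unfolding fourier_atom cnj_atom by (intro Bochner_Integration.integral_cong refl) (simp add: mult_ac)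
  also have "\<dots> = cis (2 * pi * \<xi> * x) * stft f (x, \<xi>)"
    unfolding integral_mult_right_zero stft_def ..
  finally have "cis (- 2 * pi * x * \<xi>) * stft (fourier f) (\<xi>, - x) = (cis (- 2 * pi * x * \<xi>) * cis (2 * pi * \<xi> * x)) * stft f (x, \<xi>)"
    by (simp add: mult.assoc)
  also have "cis (- 2 * pi * x * \<xi>) * cis (2 * pi * \<xi> * x) = 1" by (simp add: cis_mult)
  finally show ?thesis by simp
qed

lemma norm_integral_le:
  fixes f :: "'a \<Rightarrow> 'b::{banach, second_countable_topology}" and g :: "'a \<Rightarrow> real"
  assumes "\<And>x. x \<in> space M \<Longrightarrow> norm (f x) \<le> g x" "integrable M g"
  shows "norm (LINT x|M. f x) \<le> (LINT x|M. g x)"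
  by (rule order_trans[OF integral_norm_bound integral_mono'[OF assms(2)]])
     (use assms(1) norm_ge_zero order_trans in blast)+

text \<open>By \<open>br (fst z) \<le> br t * br (t - fst z)\<close> the decay in position is shared
  between \<open>f\<close> and the window; the two extra powers of decay of \<open>f\<close> make
  the integral converge.\<close>

lemma stft_decay_fst:
  assumes f: "f \<in> borel_measurable borel" "\<And>t. norm (f t) \<le> A / br t ^ (N + 2)" 
    and phi: "\<And>u. phi u \<le> C / br u ^ N"
  shows "norm (stft f z) \<le> A * C * brint / br (fst z) ^ N"
proof -
  have A: "0 \<le> A" using order_trans[OF norm_ge_zero f(2)[of 0]] by (simp add: br_def)
  have C: "0 \<le> C" using order_trans[OF phi_nonneg phi[of 0]] by (simp add: br_def)
  have "norm (stft f z) \<le> (LINT t|lborel. (A * C / br (fst z) ^ N) * (1 / br t ^ 2))"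
    unfolding stft_def
  proof (rule norm_integral_le)
    fix t
    have "br (fst z) \<le> br t * br (t - fst z)" using br_diff[of t "t - fst z"] by simp
    then have "br (fst z) ^ N \<le> (br t * br (t - fst z)) ^ N"
      by (intro power_mono) (auto simp: br_pos less_imp_le)
    then have *: "1 / (br t ^ N * br (t - fst z) ^ N) \<le> 1 / br (fst z) ^ N"
      unfolding power_mult_distrib by (intro divide_left_mono) auto
    have "norm (f t * cnj (atom z t)) \<le> A / br t ^ (N + 2) * (C / br (t - fst z) ^ N)"
      unfolding norm_mult complex_mod_cnj norm_atom
      by (intro mult_mono f(2) phi divide_nonneg_nonneg A less_imp_le[OF br_power_pos]) auto
    also have "\<dots> = A * C * (1 / br t ^ 2) * (1 / (br t ^ N * br (t - fst z) ^ N))"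
      by (simp only: power_add times_divide_times_eq times_divide_eq_right times_divide_eq_left
          divide_divide_eq_left mult_1 mult_1_right mult_ac)
    also have "\<dots> \<le> A * C * (1 / br t ^ 2) * (1 / br (fst z) ^ N)"
      using * A C by (intro mult_left_mono) auto
    finally show "norm (f t * cnj (atom z t)) \<le> A * C / br (fst z) ^ N * (1 / br t ^ 2)"
      by (simp only: times_divide_times_eq times_divide_eq_right times_divide_eq_left
          divide_divide_eq_left mult_1 mult_1_right mult_ac)
  qed (intro integrable_mult_right integrable_br2)
  then show ?thesis unfolding integral_mult_right_zero brint_def[symmetric] by simp
qed

text \<open>The counterpart of the Schwartz class on the phase plane: \<open>stft\<close> leads into
  it and \<open>synth\<close> leads back. No smoothness is asked, as differentiating
  \<open>synth U\<close> differentiates the atoms only.\<close>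

definition rapid :: "(real \<times> real \<Rightarrow> complex) \<Rightarrow> bool" where
  "rapid U \<longleftrightarrow> U \<in> borel_measurable borel \<and> (\<forall>s. \<exists>M. \<forall>z. norm (U z) \<le> M / om z ^ s)"

text \<open>Decay of \<open>f\<close> gives decay in position; decay of \<open>fourier f\<close>
  gives decay in frequency, by the rotation symmetry. The larger coordinate \<open>v\<close>
  controls \<open>om z\<close> up to a factor 2, so the bound in that coordinate is enough.\<close>

lemma rapid_stft:
  assumes f: "f \<in> schwartz_space"
  shows "rapid (stft f)"
  unfolding rapid_def
proof (intro conjI allI)
  show "stft f \<in> borel_measurable borel" using sch_measurable[OF f] by measurable
  fix N
  obtain A where A: "A \<ge> 0" "\<And>t. norm (f t) \<le> A / br t ^ (N + 2)" using sch_decay0[OF f] by metis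
  obtain B where B: "B \<ge> 0" "\<And>t. norm (fourier f t) \<le> B / br t ^ (N + 2)" using fourier_decay[OF f] by metis
  obtain C where C: "C \<ge> 0" "\<And>u. phi u \<le> C / br u ^ N" using phi_decay by metis
  define K where "K = (A + B) * C * brint"
  have K: "A * C * brint \<le> K" "B * C * brint \<le> K" "0 \<le> K"
    using A B C brint_nonneg unfolding K_def by (auto intro!: mult_right_mono)
  show "\<exists>M. \<forall>z. norm (stft f z) \<le> M / om z ^ N"
  proof (intro exI allI)
    fix z :: "real \<times> real"
    have *: "norm (stft f z) \<le> K / br v ^ N" if "v = fst z \<or> v = snd z" for v
    proof -
      have "norm (stft f z) \<le> A * C * brint / br (fst z) ^ N"
        by (rule stft_decay_fst[OF sch_measurable[OF f] A(2) C(2)])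
      moreover have "norm (stft f z) \<le> B * C * brint / br (snd z) ^ N"
        using stft_decay_fst[OF _ B(2) C(2), of "(snd z, - fst z)"] sch_measurable[OF f]
          stft_fourier[OF sch_integrable[OF f], of "fst z" "snd z"]
        by (auto simp: norm_mult)
      moreover have "A * C * brint / br v ^ N \<le> K / br v ^ N" "B * C * brint / br v ^ N \<le> K / br v ^ N"
        by (intro divide_right_mono K less_imp_le br_power_pos)+
      ultimately show ?thesis using that by (metis order_trans)
    qed
    define v where "v = (if \<bar>fst z\<bar> \<ge> \<bar>snd z\<bar> then fst z else snd z)"
    have "om z \<le> 2 * br v" by (auto simp: om_def br_def v_def)
    then have "om z ^ N \<le> (2 * br v) ^ N" by (intro power_mono) (auto simp: om_pos less_imp_le)
    then have "K * om z ^ N \<le> K * (2 ^ N * br v ^ N)" using K by (intro mult_left_mono) (auto simp: power_mult_distrib)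
    then have "K / br v ^ N \<le> 2 ^ N * K / om z ^ N" by (simp add: field_simps)
    moreover have "norm (stft f z) \<le> K / br v ^ N" by (rule *) (auto simp: v_def)
    ultimately show "norm (stft f z) \<le> 2 ^ N * K / om z ^ N" by simp
  qed
qed

lemma rapid_bound:
  assumes "rapid U" obtains M where "M \<ge> 0" "\<And>z. norm (U z) \<le> M / om z ^ s"
proof -
  obtain M where M: "\<And>z. norm (U z) \<le> M / om z ^ s" using assms unfolding rapid_def by blast
  have "0 \<le> M" using order_trans[OF norm_ge_zero M[of 0]] by (simp add: om_def)
  then show ?thesis using M by (rule that)
qed

lemma integrable_om_bound:
  fixes g :: "real \<times> real \<Rightarrow> complex"
  assumes "g \<in> borel_measurable borel" "\<And>z. norm (g z) \<le> M / om z ^ 4"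
  shows "integrable lborel g"
proof (rule Bochner_Integration.integrable_bound[OF integrable_mult_right[OF integrable_om4, of M]])
  show "AE z in lborel. norm (g z) \<le> norm (M * (1 / om z ^ 4))"
    unfolding real_norm_def times_divide_eq_right mult_1_right
    by (intro AE_I2 order_trans[OF assms(2) abs_ge_self])
qed (use assms in simp)

text \<open>For fixed position \<open>x\<close> the frequency integral is Fourier inversion for
  \<open>f\<close> times the window at \<open>x\<close> and yields \<open>f s\<close> times the
  squared window. What remains is the integral of the squared window over \<open>x\<close>, which is
  1.\<close>

lemma synth_stft:
  assumes f: "f \<in> schwartz_space"
  shows "synth (stft f) s = f s"
proof -
  note [measurable] = sch_measurable[OF f]
  obtain P where P: "P \<ge> 0" "\<And>u. phi u \<le> P / br u ^ 0" using phi_decay by metis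
  obtain M where M: "M \<ge> 0" "\<And>z. norm (stft f z) \<le> M / om z ^ 4" using rapid_bound[OF rapid_stft[OF f]] by metis
  obtain A where A: "A \<ge> 0" "\<And>t. norm (f t) \<le> A / br t ^ 0" using sch_decay0[OF f] by metis
  have "integrable lborel (\<lambda>z. stft f z * atom z s)"
  proof (rule integrable_om_bound)
    show "norm (stft f z * atom z s) \<le> M * P / om z ^ 4" for z
      using mult_mono[OF M(2)[of z] P(2)[of "s - fst z"]] M(1) by (simp add: norm_mult)
  qed simp
  then have int: "integrable (lborel \<Otimes>\<^sub>M lborel) (\<lambda>(x, \<xi>). stft f (x, \<xi>) * atom (x, \<xi>) s)"
    by (simp add: lborel_prod case_prod_beta')
  have stft_eq: "stft f (x, \<xi>) = fourier (\<lambda>t. f t * phi (t - x)) \<xi>" for x \<xi>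
    unfolding stft_def fourier_cis by (simp add: atom_def cis_cnj mult_ac)
  have inner: "(LINT \<xi>|lborel. stft f (x, \<xi>) * atom (x, \<xi>) s) = of_real (phi (s - x) * phi (s - x)) * f s" for x
  proof -
    let ?h = "\<lambda>t. f t * phi (t - x)"
    have "(LINT \<xi>|lborel. fourier ?h \<xi> * cis (2 * pi * s * \<xi>)) = ?h s"
    proof (rule fourier_inversion[where B = "A * P"])
      show bd: "norm (?h t) \<le> A * P" for t
        using A(2)[of t] P(2)[of "t - x"] A(1) by (auto simp: norm_mult intro!: mult_mono)
      show "continuous_on UNIV ?h"
        unfolding phi_def by (intro continuous_intros sch_continuous[OF f])
      show "integrable lborel ?h"
      proof (rule Bochner_Integration.integrable_bound[OF integrable_mult_right[OF sch_integrable[OF f], of "of_real P"]])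
        show "AE t in lborel. norm (?h t) \<le> norm (of_real P * f t)"
          using P by (intro AE_I2) (auto simp: norm_mult mult.commute[of P] intro!: mult_left_mono)
      qed simp
      \<comment> \<open>By \<open>stft_eq\<close> this transform is \<open>stft f\<close> along a
        vertical line, so its integrability is read off from the rapid decay of
        \<open>stft f\<close>.\<close>
      show "integrable lborel (fourier ?h)"
      proof (rule integrable_decay2)
        fix \<xi>
        have "norm (fourier ?h \<xi>) \<le> M / om (x, \<xi>) ^ 4" using M(2)[of "(x, \<xi>)"] by (simp add: stft_eq)
        also have "\<dots> \<le> M / br \<xi> ^ 2"
        proof (rule divide_left_mono)
          have "br \<xi> ^ 2 \<le> om (x, \<xi>) ^ 2" using br_snd_le_om[of "(x, \<xi>)"] by (intro power_mono) (auto simp: br_pos less_imp_le)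
          also have "\<dots> \<le> om (x, \<xi>) ^ 4" by (rule power_increasing) (auto simp: om_ge1)
          finally show "(br \<xi>)\<^sup>2 \<le> om (x, \<xi>) ^ 4" .
        qed (use M in auto)
        finally show "norm (fourier ?h \<xi>) \<le> M / br \<xi> ^ 2" .
      qed simp
    qed
    then have "of_real (phi (s - x)) * (LINT \<xi>|lborel. fourier ?h \<xi> * cis (2 * pi * s * \<xi>)) = of_real (phi (s - x) * phi (s - x)) * f s"
      by simp
    then show ?thesis
      unfolding integral_mult_right_zero[symmetric]
      by (simp add: stft_eq atom_def mult_ac)
  qed
  have "synth (stft f) s = (LINT x|lborel. LINT \<xi>|lborel. stft f (x, \<xi>) * atom (x, \<xi>) s)"
    unfolding synth_def using lborel_pair.integral_fst[OF int] by (simp add: lborel_prod case_prod_beta')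
  also have "\<dots> = (LINT x|lborel. of_real (phi (x - s) * phi (x - s)) * f s)"
    unfolding inner phi_diff_commute[of s] ..
  also have "\<dots> = (LINT x|lborel. of_real (phi (x - s) * phi (x - s))) * f s"
    by (rule integral_mult_left_zero)
  also have "(LINT x|lborel. complex_of_real (phi (x - s) * phi (x - s))) = of_real (LINT x|lborel. phi (x - s) * phi (x - s))"
    by (rule integral_complex_of_real)
  also have "(LINT x|lborel. phi (x - s) * phi (x - s)) = 1"
    using integral_shift[of "\<lambda>x. phi x * phi x" s] phi_square_integral(2) by simp
  finally show ?thesis by simp
qed

lemma weight_nonneg [simp]: "0 \<le> br u" "0 \<le> br u ^ n" "0 \<le> om z" "0 \<le> om z ^ n"
  using br_pos[of u] om_pos[of z] by auto

lemma borel_measurable_fst_snd [measurable]: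
  "(\<lambda>z::real \<times> real. fst z) \<in> borel_measurable borel" "(\<lambda>z::real \<times> real. snd z) \<in> borel_measurable borel"
  by (simp_all flip: borel_prod)

section \<open>Synthesis of Schwartz functions\<close>

text \<open>The derivative of an atom is the atom times
  \<open>2 * pi * \<i> * \<xi> - 2 * pi * (t - x)\<close>. The product rule then gives this
  recursion for the polynomial factor, in the variable \<open>t - x\<close>.\<close>

primrec atom_poly :: "nat \<Rightarrow> real \<Rightarrow> complex poly" where
  "atom_poly 0 \<xi> = 1"
| "atom_poly (Suc l) \<xi> = pderiv (atom_poly l \<xi>) + [:2 * pi * \<i> * \<xi>, - 2 * pi:] * atom_poly l \<xi>"

definition atom_deriv :: "nat \<Rightarrow> real \<times> real \<Rightarrow> real \<Rightarrow> complex" where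
  "atom_deriv l z t = poly (atom_poly l (snd z)) (of_real (t - fst z)) * atom z t"

lemma atom_has_vector_derivative:
  "(atom z has_vector_derivative
     (2 * pi * \<i> * of_real (snd z) - 2 * pi * of_real (t - fst z)) * atom z t) (at t)"
proof -
  have "((\<lambda>t. phi (t - fst z)) has_real_derivative (- 2 * pi * (t - fst z) * phi (t - fst z))) (at t)"
    unfolding phi_def by (auto intro!: derivative_eq_intros)
  then have 1: "((\<lambda>t. complex_of_real (phi (t - fst z))) has_vector_derivative
      of_real (- 2 * pi * (t - fst z) * phi (t - fst z))) (at t)"
    by (intro has_vector_derivative_of_real) (simp add: has_real_derivative_iff_has_vector_derivative)
  have 2: "((\<lambda>t. cis (2 * pi * t * snd z)) has_vector_derivative
      \<i> * of_real (2 * pi * snd z) * cis (2 * pi * t * snd z)) (at t)"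
  proof -
    have eq: "2 * pi * s * snd z = 2 * pi * snd z * s + 0" for s by simp
    show ?thesis unfolding eq by (rule has_vector_derivative_cis)
  qed
  show ?thesis
    unfolding atom_def[abs_def]
    by (rule has_vector_derivative_eq_rhs[OF has_vector_derivative_mult[OF 1 2]]) (simp add: algebra_simps)
qed

lemma atom_deriv_has_vector_derivative:
  "(atom_deriv l z has_vector_derivative atom_deriv (Suc l) z t) (at t)"
proof -
  let ?q = "atom_poly l (snd z)"
  have "((\<lambda>t. complex_of_real (t - fst z)) has_vector_derivative 1) (at t)"
    using has_vector_derivative_of_real[of "\<lambda>t. t - fst z" 1 "at t"]
    by (auto intro!: derivative_eq_intros)
  from field_vector_diff_chain_at[OF this poly_DERIV, of ?q]
  have "((\<lambda>t. poly ?q (of_real (t - fst z))) has_vector_derivative poly (pderiv ?q) (of_real (t - fst z))) (at t)"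
    by (simp add: o_def)
  from has_vector_derivative_mult[OF this atom_has_vector_derivative[of z t]] show ?thesis
    unfolding atom_deriv_def[abs_def]
    by (rule has_vector_derivative_eq_rhs) (simp add: algebra_simps)
qed

lemma atom_poly_bounds:
  "degree (atom_poly l \<xi>) \<le> l" "\<exists>C\<ge>0. \<forall>\<xi> i. norm (coeff (atom_poly l \<xi>) i) \<le> C * br \<xi> ^ l"
proof -
  have deg: "degree (atom_poly l \<xi>) \<le> l" for l \<xi>
  proof (induction l)
    case (Suc l)
    have "degree ([:2 * pi * \<i> * \<xi>, - 2 * pi:] * atom_poly l \<xi>) \<le> degree [:2 * pi * \<i> * \<xi>, - 2 * pi:] + degree (atom_poly l \<xi>)"
      by (rule degree_mult_le)
    also have "\<dots> \<le> Suc 0 + l"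
      by (intro add_mono Suc.IH) simp
    finally show ?case using Suc.IH
      by (auto intro!: degree_add_le simp: degree_pderiv)
  qed simp
  then show "degree (atom_poly l \<xi>) \<le> l" .
  show "\<exists>C\<ge>0. \<forall>\<xi> i. norm (coeff (atom_poly l \<xi>) i) \<le> C * br \<xi> ^ l"
  proof (induction l)
    case 0
    show ?case by (rule exI[of _ 1]) (auto simp: coeff_1)
  next
    case (Suc l)
    then obtain C where C: "C \<ge> 0" "\<And>\<xi> i. norm (coeff (atom_poly l \<xi>) i) \<le> C * br \<xi> ^ l" by auto
    have "norm (coeff (atom_poly (Suc l) \<xi>) i) \<le> (real l + 4 * pi) * C * br \<xi> ^ Suc l" for \<xi> i
    proof -
      let ?c = "coeff (atom_poly l \<xi>)" and ?B = "C * br \<xi> ^ l"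
      have B: "0 \<le> ?B" using C(1) by simp
      have 1: "norm (of_nat (Suc i) * ?c (Suc i)) \<le> real l * ?B"
      proof (cases "Suc i \<le> l")
        case True
        then show ?thesis unfolding norm_mult norm_of_nat by (intro mult_mono C(2)) auto
      next
        case False
        then have "?c (Suc i) = 0" using deg[of l \<xi>] by (intro coeff_eq_0) auto
        then show ?thesis using B by simp
      qed
      have 2: "norm (2 * pi * \<i> * \<xi> * ?c i) \<le> 2 * pi * \<bar>\<xi>\<bar> * ?B"
        using mult_left_mono[OF C(2)[of \<xi> i], of "2 * pi * \<bar>\<xi>\<bar>"] by (simp add: norm_mult)
      have 3: "norm (- 2 * pi * (case i of 0 \<Rightarrow> 0 | Suc j \<Rightarrow> ?c j)) \<le> 2 * pi * ?B"
        using B mult_left_mono[OF C(2)[of \<xi> "i - 1"], of "2 * pi"]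
        by (cases i) (simp_all add: norm_mult)
      have "coeff (atom_poly (Suc l) \<xi>) i = of_nat (Suc i) * ?c (Suc i) +
         (2 * pi * \<i> * \<xi> * ?c i + - 2 * pi * (case i of 0 \<Rightarrow> 0 | Suc j \<Rightarrow> ?c j))"
        by (cases i) (simp_all add: coeff_pderiv coeff_pCons)
      also have "norm \<dots> \<le> real l * ?B + (2 * pi * \<bar>\<xi>\<bar> * ?B + 2 * pi * ?B)"
        by (intro norm_triangle_le add_mono 1 2 3)
      also have "\<dots> = (real l + 2 * pi * br \<xi>) * ?B" by (simp add: br_def algebra_simps)
      also have "\<dots> \<le> ((real l + 4 * pi) * br \<xi>) * ?B"
      proof (intro mult_right_mono B)
        have "real l * 1 \<le> real l * br \<xi>" by (intro mult_left_mono) (auto simp: br_ge1)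
        moreover have "0 \<le> pi * br \<xi>" by (simp add: br_pos less_imp_le)
        ultimately show "real l + 2 * pi * br \<xi> \<le> (real l + 4 * pi) * br \<xi>"
          unfolding distrib_right by linarith
      qed
      finally show ?thesis by (simp add: mult_ac)
    qed
    then show ?case using C(1) by (intro exI[of _ "(real l + 4 * pi) * C"]) auto
  qed
qed

text \<open>Each derivative in \<open>t\<close> costs at most one power of the frequency; the powers
  of \<open>t - fst z\<close> in the polynomial factor are absorbed by \<open>l\<close> further
  powers of Gaussian decay.\<close>

lemma atom_deriv_bound:
  obtains K where "K \<ge> 0" "\<And>z t. norm (atom_deriv l z t) \<le> K * br (snd z) ^ l / br (t - fst z) ^ N"
proof -
  obtain C where C: "C \<ge> 0" "\<And>\<xi> i. norm (coeff (atom_poly l \<xi>) i) \<le> C * br \<xi> ^ l"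
    using atom_poly_bounds(2) by blast
  obtain P where P: "P \<ge> 0" "\<And>u. phi u \<le> P / br u ^ (N + l)" using phi_decay by metis
  have "norm (atom_deriv l z t) \<le> (real (Suc l) * C * P) * br (snd z) ^ l / br (t - fst z) ^ N" for z t
  proof -
    let ?q = "atom_poly l (snd z)" and ?u = "t - fst z"
    have "norm (poly ?q (of_real ?u)) = norm (\<Sum>i\<le>degree ?q. coeff ?q i * of_real ?u ^ i)"
      by (simp add: poly_altdef)
    also have "\<dots> \<le> (\<Sum>i\<le>degree ?q. C * br (snd z) ^ l * br ?u ^ l)"
    proof (rule sum_norm_le)
      fix i assume i: "i \<in> {..degree ?q}"
      have "norm (complex_of_real ?u ^ i) \<le> br ?u ^ i"
        unfolding norm_power by (intro power_mono) (auto simp: br_def simp del: of_real_diff)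
      also have "\<dots> \<le> br ?u ^ l" using i atom_poly_bounds(1)[of l "snd z"]
        by (intro power_increasing br_ge1) auto
      finally show "norm (coeff ?q i * complex_of_real ?u ^ i) \<le> C * br (snd z) ^ l * br ?u ^ l"
        unfolding norm_mult using C(1) by (intro mult_mono C(2)) auto
    qed
    also have "\<dots> = real (Suc (degree ?q)) * (C * br (snd z) ^ l * br ?u ^ l)" by simp
    also have "\<dots> \<le> real (Suc l) * (C * br (snd z) ^ l * br ?u ^ l)"
      using atom_poly_bounds(1)[of l "snd z"] C(1) by (intro mult_right_mono) auto
    finally have 1: "norm (poly ?q (of_real ?u)) \<le> real (Suc l) * (C * br (snd z) ^ l * br ?u ^ l)" .
    have "norm (atom_deriv l z t) \<le> real (Suc l) * (C * br (snd z) ^ l * br ?u ^ l) * (P / br ?u ^ (N + l))"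
      unfolding atom_deriv_def norm_mult norm_atom
      by (intro mult_mono 1 P(2)) (use C(1) in auto)
    also have "\<dots> = (real (Suc l) * C * P) * br (snd z) ^ l / br ?u ^ N"
      by (simp add: power_add field_simps)
    finally show ?thesis .
  qed
  then show ?thesis using C(1) P(1) by (intro that[of "real (Suc l) * C * P"]) auto
qed

lemma borel_measurable_atom_deriv [measurable]: "(\<lambda>z. atom_deriv l z t) \<in> borel_measurable borel"
proof -
  have c: "(\<lambda>\<xi>. coeff (atom_poly l \<xi>) i) \<in> borel_measurable borel" for l i
  proof (induction l arbitrary: i)
    case (Suc l)
    note [measurable] = Suc.IH
    show ?case by (cases i) (simp_all add: coeff_pderiv coeff_pCons)
  qed simp
  have [measurable]: "(\<lambda>z::real \<times> real. coeff (atom_poly l (snd z)) i) \<in> borel_measurable borel" for i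
    by (rule measurable_compose[OF borel_measurable_fst_snd(2) c])
  \<comment> \<open>For measurability the range of summation must not vary with \<open>z\<close>, so
    the sum runs up to the degree bound \<open>l\<close> and not up to the degree.\<close>
  have "atom_deriv l z t = (\<Sum>i\<le>l. coeff (atom_poly l (snd z)) i * of_real (t - fst z) ^ i) * atom z t" for z
    unfolding atom_deriv_def using atom_poly_bounds(1)[of l "snd z"]
    by (subst poly_altdef, intro arg_cong2[where f = "(*)"] sum.mono_neutral_left refl)
       (auto intro!: coeff_eq_0)
  then show ?thesis by (simp only:) measurable
qed

lemma br_power_le: "br t ^ k \<le> br (fst z) ^ k * br (t - fst z) ^ k"
  unfolding power_mult_distrib[symmetric]
  using br_add[of "fst z" "t - fst z"] by (intro power_mono) (auto simp: br_pos less_imp_le)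

lemma synth_derivs:
  assumes U: "rapid U"
  shows "((\<lambda>t. LINT z|lborel. U z * atom_deriv l z t) has_vector_derivative
     (LINT z|lborel. U z * atom_deriv (Suc l) z t)) (at t)"
proof -
  have [measurable]: "U \<in> borel_measurable borel" using U by (simp add: rapid_def)
  have bd: "\<exists>M. \<forall>z t. norm (U z * atom_deriv l z t) \<le> M / om z ^ 4" for l
  proof -
    obtain K where K: "K \<ge> 0" "\<And>z t. norm (atom_deriv l z t) \<le> K * br (snd z) ^ l / br (t - fst z) ^ 0"
      using atom_deriv_bound by metis
    obtain M where M: "M \<ge> 0" "\<And>z. norm (U z) \<le> M / om z ^ (4 + l)" using rapid_bound[OF U] by metis
    have "norm (U z * atom_deriv l z t) \<le> M * K / om z ^ 4" for z t
    proof -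
      have "K * br (snd z) ^ l / br (t - fst z) ^ 0 \<le> K * om z ^ l"
        using K(1) by (simp, intro mult_left_mono power_mono br_snd_le_om) (auto simp: br_pos less_imp_le)
      then have "norm (U z * atom_deriv l z t) \<le> M / om z ^ (4 + l) * (K * om z ^ l)"
        unfolding norm_mult by (intro mult_mono M(2) order_trans[OF K(2)]) (use M(1) in auto)
      then show ?thesis by (simp add: power_add)
    qed
    then show ?thesis by blast
  qed
  obtain B where B: "\<And>z t. norm (U z * atom_deriv (Suc l) z t) \<le> B / om z ^ 4" using bd by blast
  obtain B' where B': "\<And>z t. norm (U z * atom_deriv l z t) \<le> B' / om z ^ 4" using bd by blast
  show ?thesis
  proof (rule leibniz[where B = "\<lambda>z. B * (1 / om z ^ 4)"])
    show "integrable lborel (\<lambda>z. U z * atom_deriv l z t)" for t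
      by (rule integrable_om_bound[OF _ B']) measurable
    show "norm (U z * atom_deriv (Suc l) z t) \<le> B * (1 / om z ^ 4)" for t z
      using B[of z t] by simp
    show "((\<lambda>t. U z * atom_deriv l z t) has_vector_derivative U z * atom_deriv (Suc l) z t) (at t)" for t z
      by (intro has_vector_derivative_mult_right atom_deriv_has_vector_derivative)
    show "integrable lborel (\<lambda>z. B * (1 / om z ^ 4))"
      by (intro integrable_mult_right integrable_om4)
  qed measurable
qed

lemma synth_eq_0: "(\<lambda>t. LINT z|lborel. U z * atom_deriv 0 z t) = synth U"
  by (auto simp: synth_def atom_deriv_def)

text \<open>In the exponent, \<open>k\<close> powers pay for \<open>\<bar>t\<bar> ^ k\<close> once
  this weight has been moved to \<open>fst z\<close>, \<open>l\<close> powers pay for the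
  derivatives, and 4 for integrability. That \<open>C\<close> depends on neither \<open>U\<close>
  nor \<open>M\<close> is what permits summation over the nodes later.\<close>

lemma synth_bound:
  "\<exists>C\<ge>0. \<forall>U M t. U \<in> borel_measurable borel \<longrightarrow> (\<forall>z. norm (U z) \<le> M / om z ^ (k + l + 4))
     \<longrightarrow> \<bar>t\<bar> ^ k * norm (LINT z|lborel. U z * atom_deriv l z t) \<le> C * M"
proof -
  obtain K where K: "K \<ge> 0" "\<And>z t. norm (atom_deriv l z t) \<le> K * br (snd z) ^ l / br (t - fst z) ^ k"
    using atom_deriv_bound by metis
  let ?I = "LINT z|lborel. 1 / om z ^ 4"
  have I: "0 \<le> ?I" by (intro integral_nonneg_AE AE_I2) (auto simp: less_imp_le)
  have "\<bar>t\<bar> ^ k * norm (LINT z|lborel. U z * atom_deriv l z t) \<le> K * ?I * M"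
    if [measurable]: "U \<in> borel_measurable borel" and U: "\<And>z. norm (U z) \<le> M / om z ^ (k + l + 4)" for U M t
  proof -
    have M: "0 \<le> M" using order_trans[OF norm_ge_zero U[of 0]] by (simp add: om_def)
    have "\<bar>t\<bar> ^ k * norm (LINT z|lborel. U z * atom_deriv l z t) = norm (LINT z|lborel. of_real (\<bar>t\<bar> ^ k) * (U z * atom_deriv l z t))"
      by (simp add: norm_mult norm_power)
    also have "\<dots> \<le> (LINT z|lborel. (M * K) * (1 / om z ^ 4))"
    proof (rule norm_integral_le)
      fix z :: "real \<times> real"
      have "norm (of_real (\<bar>t\<bar> ^ k) * (U z * atom_deriv l z t)) = \<bar>t\<bar> ^ k * norm (atom_deriv l z t) * norm (U z)"
        by (simp add: norm_mult norm_power)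
      also have "\<dots> \<le> (om z ^ k * br (t - fst z) ^ k) * (K * om z ^ l / br (t - fst z) ^ k) * (M / om z ^ (k + l + 4))"
      proof (intro mult_mono U order_trans[OF K(2)])
        have "\<bar>t\<bar> ^ k \<le> br t ^ k" by (intro power_mono) (auto simp: br_def)
        also have "\<dots> \<le> br (fst z) ^ k * br (t - fst z) ^ k" by (rule br_power_le)
        also have "\<dots> \<le> om z ^ k * br (t - fst z) ^ k"
          by (intro mult_right_mono power_mono br_fst_le_om) (auto simp: br_pos less_imp_le)
        finally show "\<bar>t\<bar> ^ k \<le> om z ^ k * br (t - fst z) ^ k" .
        show "K * br (snd z) ^ l / br (t - fst z) ^ k \<le> K * om z ^ l / br (t - fst z) ^ k"
          using K(1) by (intro divide_right_mono mult_left_mono power_mono br_snd_le_om) (auto simp: br_pos less_imp_le)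
      qed (use K(1) in \<open>auto simp: om_pos less_imp_le br_pos\<close>)
      also have "\<dots> = (M * K) * (1 / om z ^ 4)"
        by (simp add: power_add field_simps)
      finally show "norm (of_real (\<bar>t\<bar> ^ k) * (U z * atom_deriv l z t)) \<le> (M * K) * (1 / om z ^ 4)" .
    qed (intro integrable_mult_right integrable_om4)
    also have "\<dots> = K * ?I * M" by (simp only: integral_mult_right_zero mult_ac)
    finally show ?thesis .
  qed
  then show ?thesis using mult_nonneg_nonneg[OF K(1) I] by blast
qed

lemma synth_schwartz:
  assumes U: "rapid U"
  shows "synth U \<in> schwartz_space"
proof -
  let ?F = "\<lambda>l t. LINT z|lborel. U z * atom_deriv l z t"
  have "?F 0 \<in> schwartz_space"
  proof (rule schwartzI)
    fix k l
    obtain C where C: "\<forall>U M t. U \<in> borel_measurable borel \<longrightarrow> (\<forall>z. norm (U z) \<le> M / om z ^ (k + l + 4))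
     \<longrightarrow> \<bar>t\<bar> ^ k * norm (LINT z|lborel. U z * atom_deriv l z t) \<le> C * M" using synth_bound by blast
    obtain M where M: "\<And>z. norm (U z) \<le> M / om z ^ (k + l + 4)" using rapid_bound[OF U] by metis
    have "U \<in> borel_measurable borel" using U by (simp add: rapid_def)
    from C[rule_format, OF this M] show "\<exists>C. \<forall>t. \<bar>t\<bar> ^ k * norm (?F l t) \<le> C" by blast
  qed (rule synth_derivs[OF U])
  then show ?thesis unfolding synth_eq_0 .
qed

lemma synth_seminorm:
  "\<exists>C\<ge>0. \<forall>U M. rapid U \<longrightarrow> (\<forall>z. norm (U z) \<le> M / om z ^ (k + l + 4))
     \<longrightarrow> schwartz_seminorm k l (synth U) \<le> C * M"
proof -
  obtain C where C: "C \<ge> 0" "\<forall>U M t. U \<in> borel_measurable borel \<longrightarrow> (\<forall>z. norm (U z) \<le> M / om z ^ (k + l + 4))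
     \<longrightarrow> \<bar>t\<bar> ^ k * norm (LINT z|lborel. U z * atom_deriv l z t) \<le> C * M" using synth_bound by blast
  have "schwartz_seminorm k l (synth U) \<le> C * M"
    if U: "rapid U" and M: "\<forall>z. norm (U z) \<le> M / om z ^ (k + l + 4)" for U M
  proof -
    have "U \<in> borel_measurable borel" using U by (simp add: rapid_def)
    then have "\<bar>t\<bar> ^ k * norm (LINT z|lborel. U z * atom_deriv l z t) \<le> C * M" for t
      using C(2) M by blast
    then show ?thesis
      unfolding synth_eq_0[symmetric] by (intro seminorm_le[where F = "\<lambda>l t. LINT z|lborel. U z * atom_deriv l z t"] synth_derivs U)
  qed
  then show ?thesis using C(1) by blast
qed

lemma
  fixes I :: "'i set" and u :: "'i \<Rightarrow> real \<Rightarrow> complex"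
  assumes u: "\<And>i. i \<in> I \<Longrightarrow> u i \<in> schwartz_space"
  shows sch_sum: "(\<lambda>t. \<Sum>i\<in>I. c i * u i t) \<in> schwartz_space"
    and iter_deriv_sum: "iter_deriv l (\<lambda>t. \<Sum>i\<in>I. c i * u i t) = (\<lambda>t. \<Sum>i\<in>I. c i * iter_deriv l (u i) t)"
    and seminorm_sum: "schwartz_seminorm k l (\<lambda>t. \<Sum>i\<in>I. c i * u i t) \<le> (\<Sum>i\<in>I. norm (c i) * schwartz_seminorm k l (u i))"
proof -
  define F where "F l t = (\<Sum>i\<in>I. c i * iter_deriv l (u i) t)" for l t
  have F0: "F 0 = (\<lambda>t. \<Sum>i\<in>I. c i * u i t)" by (simp add: F_def fun_eq_iff)
  have der: "(F l has_vector_derivative F (Suc l) t) (at t)" for l t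
    unfolding F_def[abs_def]
    by (intro has_vector_derivative_sum has_vector_derivative_mult_right iter_deriv_has_vector_derivative u)
  have bd: "\<bar>t\<bar> ^ k * norm (F l t) \<le> (\<Sum>i\<in>I. norm (c i) * schwartz_seminorm k l (u i))" for k l t
  proof -
    have "norm (F l t) \<le> (\<Sum>i\<in>I. norm (c i) * norm (iter_deriv l (u i) t))"
      unfolding F_def by (rule sum_norm_le) (simp add: norm_mult)
    then have "\<bar>t\<bar> ^ k * norm (F l t) \<le> \<bar>t\<bar> ^ k * (\<Sum>i\<in>I. norm (c i) * norm (iter_deriv l (u i) t))"
      by (intro mult_left_mono) auto
    also have "\<dots> = (\<Sum>i\<in>I. norm (c i) * (\<bar>t\<bar> ^ k * norm (iter_deriv l (u i) t)))"
      by (simp add: sum_distrib_left mult_ac)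
    also have "\<dots> \<le> (\<Sum>i\<in>I. norm (c i) * schwartz_seminorm k l (u i))"
      by (intro sum_mono mult_left_mono schwartz_seminorm_upper u) auto
    finally show ?thesis .
  qed
  show "(\<lambda>t. \<Sum>i\<in>I. c i * u i t) \<in> schwartz_space"
    unfolding F0[symmetric] using bd by (intro schwartzI der) blast
  show "iter_deriv l (\<lambda>t. \<Sum>i\<in>I. c i * u i t) = (\<lambda>t. \<Sum>i\<in>I. c i * iter_deriv l (u i) t)"
    unfolding F0[symmetric] iter_deriv_eqI[of F, OF der] by (simp add: F_def fun_eq_iff)
  show "schwartz_seminorm k l (\<lambda>t. \<Sum>i\<in>I. c i * u i t) \<le> (\<Sum>i\<in>I. norm (c i) * schwartz_seminorm k l (u i))"
    unfolding F0[symmetric] by (intro seminorm_le der bd)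
qed

section \<open>Series of Schwartz functions\<close>

text \<open>Reading a series as an integral for counting measure makes \<open>leibniz\<close>
  available for termwise differentiation.\<close>

lemma integral_count_space_infsum:
  fixes f :: "'i \<Rightarrow> 'b::{banach, second_countable_topology}"
  assumes "(\<lambda>i. norm (f i)) summable_on UNIV"
  shows "integrable (count_space UNIV) f" "(LINT i|count_space UNIV. f i) = (\<Sum>\<^sub>\<infinity>i. f i)"
proof -
  have "Infinite_Set_Sum.abs_summable_on f UNIV" using assms abs_summable_equivalent by blast
  then show "integrable (count_space UNIV) f" "(LINT i|count_space UNIV. f i) = (\<Sum>\<^sub>\<infinity>i. f i)"
    using infsetsum_infsum[of f UNIV] by (auto simp: Infinite_Set_Sum.abs_summable_on_def infsetsum_def)
qed

lemma
  fixes u :: "'i \<Rightarrow> real \<Rightarrow> complex"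
  assumes u: "\<And>i. u i \<in> schwartz_space"
    and sm: "\<And>k l. (\<lambda>i. schwartz_seminorm k l (u i)) summable_on UNIV"
  shows sch_infsum: "(\<lambda>t. \<Sum>\<^sub>\<infinity>i. u i t) \<in> schwartz_space"
    and iter_deriv_infsum: "iter_deriv l (\<lambda>t. \<Sum>\<^sub>\<infinity>i. u i t) = (\<lambda>t. \<Sum>\<^sub>\<infinity>i. iter_deriv l (u i) t)"
    and abs_summable_iter_deriv: "(\<lambda>i. norm (iter_deriv l (u i) t)) summable_on UNIV"
proof -
  define F where "F l t = (\<Sum>\<^sub>\<infinity>i. iter_deriv l (u i) t)" for l t
  have F0: "F 0 = (\<lambda>t. \<Sum>\<^sub>\<infinity>i. u i t)" by (simp add: F_def fun_eq_iff)
  have le: "\<bar>t\<bar> ^ k * norm (iter_deriv l (u i) t) \<le> schwartz_seminorm k l (u i)" for k l t i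
    by (rule schwartz_seminorm_upper[OF u])
  have le0: "norm (iter_deriv l (u i) t) \<le> schwartz_seminorm 0 l (u i)" for l t i
    using le[of t 0] by simp
  have abs: "(\<lambda>i. norm (iter_deriv l (u i) t)) summable_on UNIV" for l t
    by (rule summable_on_comparison_test[OF sm]) (auto intro!: le0)
  then show "(\<lambda>i. norm (iter_deriv l (u i) t)) summable_on UNIV" .
  have Fi: "F l t = (LINT i|count_space UNIV. iter_deriv l (u i) t)" for l t
    unfolding F_def using integral_count_space_infsum(2)[OF abs] by simp
  have der: "(F l has_vector_derivative F (Suc l) t) (at t)" for l t
    unfolding Fi[abs_def]
  proof (rule leibniz[where B = "\<lambda>i. schwartz_seminorm 0 (Suc l) (u i)"])
    show "integrable (count_space UNIV) (\<lambda>i. iter_deriv l (u i) t)" for t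
      by (rule integral_count_space_infsum(1)[OF abs])
    show "integrable (count_space UNIV) (\<lambda>i. schwartz_seminorm 0 (Suc l) (u i))"
      using sm[of 0 "Suc l"] by (intro integral_count_space_infsum(1)) (simp add: schwartz_seminorm_nonneg[OF u])
  qed (auto intro!: le0 iter_deriv_has_vector_derivative u)
  have bd: "\<bar>t\<bar> ^ k * norm (F l t) \<le> (\<Sum>\<^sub>\<infinity>i. schwartz_seminorm k l (u i))" for k l t
  proof -
    have "\<bar>t\<bar> ^ k * norm (F l t) \<le> \<bar>t\<bar> ^ k * (\<Sum>\<^sub>\<infinity>i. norm (iter_deriv l (u i) t))"
      unfolding F_def by (intro mult_left_mono norm_infsum_bound abs) auto
    also have "\<dots> = (\<Sum>\<^sub>\<infinity>i. \<bar>t\<bar> ^ k * norm (iter_deriv l (u i) t))"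
      by (rule infsum_cmult_right[symmetric]) (rule abs)
    also have "\<dots> \<le> (\<Sum>\<^sub>\<infinity>i. schwartz_seminorm k l (u i))"
      by (intro infsum_mono summable_on_cmult_right abs sm le)
    finally show ?thesis .
  qed
  show "(\<lambda>t. \<Sum>\<^sub>\<infinity>i. u i t) \<in> schwartz_space"
    unfolding F0[symmetric] using bd by (intro schwartzI der) blast
  show "iter_deriv l (\<lambda>t. \<Sum>\<^sub>\<infinity>i. u i t) = (\<lambda>t. \<Sum>\<^sub>\<infinity>i. iter_deriv l (u i) t)"
    unfolding F0[symmetric] iter_deriv_eqI[of F, OF der] by (simp add: F_def fun_eq_iff)
qed

lemma
  fixes u :: "'i \<Rightarrow> real \<Rightarrow> complex"
  assumes u: "\<And>i. u i \<in> schwartz_space"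
    and sm: "\<And>k l. (\<lambda>i. schwartz_seminorm k l (u i)) summable_on UNIV"
  shows sch_partial_sum: "(\<lambda>t. \<Sum>n\<in>F. u n t) \<in> schwartz_space"
    and sch_partial_sums_tendsto:
      "((\<lambda>F. schwartz_seminorm k l (\<lambda>t. (\<Sum>n\<in>F. u n t) - (\<Sum>\<^sub>\<infinity>i. u i t))) \<longlongrightarrow> 0) (finite_subsets_at_top UNIV)"
proof -
  let ?s = "\<lambda>t. \<Sum>\<^sub>\<infinity>i. u i t"
  have s: "?s \<in> schwartz_space" by (rule sch_infsum[OF u sm])
  have part: "(\<lambda>t. \<Sum>n\<in>F. u n t) \<in> schwartz_space"
    "iter_deriv l (\<lambda>t. \<Sum>n\<in>F. u n t) = (\<lambda>t. \<Sum>n\<in>F. iter_deriv l (u n) t)" for F l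
    using sch_sum[of F u "\<lambda>_. 1"] iter_deriv_sum[of F u l "\<lambda>_. 1"] u by simp_all
  then show "(\<lambda>t. \<Sum>n\<in>F. u n t) \<in> schwartz_space" by blast
  let ?p = "\<lambda>i. schwartz_seminorm k l (u i)"
  \<comment> \<open>Every seminorm of the remainder is at most the tail of the series of seminorms,
    which vanishes along the finite sets.\<close>
  have bd: "schwartz_seminorm k l (\<lambda>t. (\<Sum>n\<in>F. u n t) - ?s t) \<le> infsum ?p UNIV - sum ?p F" if F: "finite F" for F
  proof -
    have "\<bar>t\<bar> ^ k * norm ((\<Sum>n\<in>F. iter_deriv l (u n) t) - (\<Sum>\<^sub>\<infinity>i. iter_deriv l (u i) t)) \<le> infsum ?p UNIV - sum ?p F" for t
    proof -
      let ?d = "\<lambda>i. iter_deriv l (u i) t"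
      have abs: "(\<lambda>i. norm (?d i)) summable_on A" for A
        using abs_summable_iter_deriv[OF u sm] by (rule summable_on_subset_banach) auto
      have sm': "?p summable_on A" for A
        using sm by (rule summable_on_subset_banach) auto
      have "infsum ?d UNIV = infsum ?d F + infsum ?d (UNIV - F)"
        using infsum_Diff[of ?d UNIV F] abs_summable_summable[OF abs] by simp
      then have "norm (sum ?d F - infsum ?d UNIV) = norm (infsum ?d (UNIV - F))"
        using F by (simp add: norm_minus_commute)
      also have "\<dots> \<le> infsum (\<lambda>i. norm (?d i)) (UNIV - F)"
        by (intro norm_infsum_bound abs)
      finally have "\<bar>t\<bar> ^ k * norm (sum ?d F - infsum ?d UNIV) \<le> \<bar>t\<bar> ^ k * infsum (\<lambda>i. norm (?d i)) (UNIV - F)"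
        by (intro mult_left_mono) auto
      also have "\<dots> = infsum (\<lambda>i. \<bar>t\<bar> ^ k * norm (?d i)) (UNIV - F)"
        by (rule infsum_cmult_right[symmetric]) (rule abs)
      also have "\<dots> \<le> infsum ?p (UNIV - F)"
        by (intro infsum_mono summable_on_cmult_right abs sm' schwartz_seminorm_upper u)
      also have "\<dots> = infsum ?p UNIV - sum ?p F"
        using infsum_Diff[of ?p UNIV F] sm' F by simp
      finally show ?thesis .
    qed
    then show ?thesis
      unfolding schwartz_seminorm_def[of k l "\<lambda>t. (\<Sum>n\<in>F. u n t) - ?s t"] iter_deriv_diff[OF part(1) s] part(2) iter_deriv_infsum[OF u sm]
      by (intro cSUP_least) auto
  qed
  have "(sum ?p \<longlongrightarrow> infsum ?p UNIV) (finite_subsets_at_top UNIV)"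
    using sm by (rule infsum_tendsto)
  then have lim: "((\<lambda>F. infsum ?p UNIV - sum ?p F) \<longlongrightarrow> infsum ?p UNIV - infsum ?p UNIV) (finite_subsets_at_top UNIV)"
    by (intro tendsto_intros)
  show "((\<lambda>F. schwartz_seminorm k l (\<lambda>t. (\<Sum>n\<in>F. u n t) - ?s t)) \<longlongrightarrow> 0) (finite_subsets_at_top UNIV)"
  proof (rule tendsto_sandwich[OF _ _ tendsto_const])
    show "\<forall>\<^sub>F F in finite_subsets_at_top UNIV. 0 \<le> schwartz_seminorm k l (\<lambda>t. (\<Sum>n\<in>F. u n t) - ?s t)"
      by (intro always_eventually allI schwartz_seminorm_nonneg schwartz_space_diff part s)
    show "\<forall>\<^sub>F F in finite_subsets_at_top UNIV. schwartz_seminorm k l (\<lambda>t. (\<Sum>n\<in>F. u n t) - ?s t) \<le> infsum ?p UNIV - sum ?p F"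
      by (rule eventually_finite_subsets_at_top_weakI) (rule bd)
    show "((\<lambda>F. infsum ?p UNIV - sum ?p F) \<longlongrightarrow> 0) (finite_subsets_at_top UNIV)"
      using lim by simp
  qed
qed

lemma schwartz_has_sumI:
  assumes u: "\<And>i. u i \<in> schwartz_space"
    and sm: "\<And>k l. (\<lambda>i. schwartz_seminorm k l (u i)) summable_on UNIV"
  shows "schwartz_has_sum u (\<lambda>t. \<Sum>\<^sub>\<infinity>i. u i t)"
  unfolding schwartz_has_sum_def limitin_schwartz_iff
  by (intro conjI allI always_eventually sch_infsum[OF u sm] sch_partial_sum[OF u sm]
      sch_partial_sums_tendsto[OF u sm])

section \<open>Riemann sums over the sampling points\<close>

text \<open>\<open>idx t\<close> is the index of the half-open gap that contains \<open>t\<close>,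
  so the gaps partition the line; equal consecutive nodes give an empty gap, which no
  \<open>t\<close> selects. The decay of the gaps is stated at \<open>t\<close> and not at the
  nodes, ready for use under an integral.\<close>

locale sampling =
  fixes x :: "int \<Rightarrow> real" and idx :: "real \<Rightarrow> int" and C0 :: real
  assumes x_mono: "mono x" and C0: "0 \<le> C0"
    and idx_iff: "idx t = n \<longleftrightarrow> x n \<le> t \<and> t < x (n + 1)"
    and gap: "t - x (idx t) \<le> C0 / br t ^ 3"
begin

text \<open>\<open>p\<close> rounds \<open>t\<close> down to a node and \<open>w n\<close> is the
  length of a gap, so the integral of \<open>F (p t)\<close> is the Riemann sum of \<open>F\<close>
  with left endpoints.\<close>

definition p where "p t = x (idx t)"
definition w where "w n = x (n + 1) - x n"

lemma p_le: "p t \<le> t" and p_gap: "t - p t \<le> C0 / br t ^ 3"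
  using idx_iff[of t "idx t"] gap by (auto simp: p_def)

lemma p_near: "\<bar>t - p t\<bar> \<le> C0"
proof -
  have "C0 / br t ^ 3 \<le> C0 / 1" using C0 by (intro divide_left_mono br_power_ge1) (auto simp: br_pos)
  then show ?thesis using p_le[of t] p_gap[of t] by simp
qed

lemma w_nonneg: "0 \<le> w n"
  using monoD[OF x_mono, of n "n + 1"] by (simp add: w_def)

lemma idx_vimage: "idx -` {n} = {x n..<x (n + 1)}"
  by (rule set_eqI) (simp only: vimage_singleton_eq idx_iff atLeastLessThan_iff)

lemma idx_measurable [measurable]: "idx \<in> measurable borel (count_space UNIV)"
proof (rule measurable_count_space_eq2_countable[THEN iffD2, rule_format])
  show "idx \<in> space borel \<rightarrow> UNIV \<and> (\<forall>a\<in>UNIV. idx -` {a} \<inter> space borel \<in> sets borel)"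
    by (auto simp: idx_vimage)
qed

lemma p_measurable [measurable]: "p \<in> borel_measurable borel"
  unfolding p_def[abs_def] by measurable

text \<open>The preimage of an index is its gap, so the image of Lebesgue measure gives the index
  the length of the gap as weight. Integrals of step functions thus become series, absolute
  convergence included.\<close>

lemma distr_idx: "distr lborel (count_space UNIV) idx = density (count_space UNIV) (\<lambda>n. ennreal (w n))"
proof (rule measure_eqI_countable[of _ UNIV])
  fix n :: int
  have "emeasure (distr lborel (count_space UNIV) idx) {n} = emeasure lborel {x n..<x (n + 1)}"
    by (subst emeasure_distr) (auto simp: idx_vimage)
  also have "\<dots> = ennreal (w n)" using w_nonneg[of n] by (simp add: w_def)
  also have "\<dots> = emeasure (density (count_space UNIV) (\<lambda>n. ennreal (w n))) {n}"
    by (simp add: emeasure_density nn_integral_count_space_indicator[symmetric])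
  finally show "emeasure (distr lborel (count_space UNIV) idx) {n} = emeasure (density (count_space UNIV) (\<lambda>n. ennreal (w n))) {n}" .
qed auto

lemma integral_idx:
  fixes F :: "int \<Rightarrow> 'b::{banach, second_countable_topology}"
  assumes F: "integrable lborel (\<lambda>t. F (idx t))"
  shows "(\<lambda>n. norm (w n *\<^sub>R F n)) summable_on UNIV" "(\<Sum>\<^sub>\<infinity>n. w n *\<^sub>R F n) = (LINT t|lborel. F (idx t))"
proof -
  have "integrable (distr lborel (count_space UNIV) idx) F"
    using F by (subst integrable_distr_eq) auto
  then have "integrable (count_space UNIV) (\<lambda>n. w n *\<^sub>R F n)"
    unfolding distr_idx using w_nonneg by (subst (asm) integrable_density) auto
  then have "Infinite_Set_Sum.abs_summable_on (\<lambda>n. w n *\<^sub>R F n) UNIV"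
    by (simp add: Infinite_Set_Sum.abs_summable_on_def)
  then show abs: "(\<lambda>n. norm (w n *\<^sub>R F n)) summable_on UNIV"
    by (rule abs_summable_equivalent[THEN iffD2])
  have "(LINT t|lborel. F (idx t)) = (LINT n|distr lborel (count_space UNIV) idx. F n)"
    by (rule integral_distr[symmetric]) auto
  also have "\<dots> = (LINT n|count_space UNIV. w n *\<^sub>R F n)"
    unfolding distr_idx using w_nonneg by (subst integral_density) auto
  also have "\<dots> = (\<Sum>\<^sub>\<infinity>n. w n *\<^sub>R F n)" by (rule integral_count_space_infsum(2)[OF abs])
  finally show "(\<Sum>\<^sub>\<infinity>n. w n *\<^sub>R F n) = (LINT t|lborel. F (idx t))" by simp
qed

end

text \<open>Some node exceeds \<open>\<bar>t\<bar>\<close> in modulus, and evenness supplies its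
  negative; the two lie on different sides of \<open>t\<close>.\<close>

lemma unbounded_both:
  fixes x :: "int \<Rightarrow> real"
  assumes x: "mono x" and lim: "filterlim (\<lambda>n. \<bar>x n\<bar>) at_top (filtercomap abs at_top)"
    and sym: "range x = range (\<lambda>n. - x n)"
  shows "\<exists>n. x n > t" "\<exists>n. x n < t"
proof -
  have large: "\<exists>N. \<forall>n. \<bar>n\<bar> \<ge> N \<longrightarrow> \<bar>x n\<bar> > B" for B
  proof -
    have "eventually (\<lambda>n. \<bar>x n\<bar> > B) (filtercomap abs at_top)"
      using lim by (rule filterlim_at_top_dense[THEN iffD1, rule_format])
    then show ?thesis unfolding eventually_filtercomap eventually_at_top_linorder by blast
  qed
  have neg: "\<exists>q. x q = - x n" for n
    using sym by (metis (no_types, lifting) imageE rangeI)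
  obtain N where N: "\<And>n. \<bar>n\<bar> \<ge> N \<Longrightarrow> \<bar>x n\<bar> > \<bar>t\<bar>" using large by blast
  have n: "\<bar>x (max N 0)\<bar> > \<bar>t\<bar>" by (rule N) auto
  obtain q where q: "x q = - x (max N 0)" using neg by blast
  have "x (max N 0) > t \<and> x q < t \<or> x q > t \<and> x (max N 0) < t"
    using n q by linarith
  then show "\<exists>n. x n > t" "\<exists>n. x n < t" by blast+
qed

lemma idx_exists:
  fixes x :: "int \<Rightarrow> real"
  assumes x: "mono x" and ex: "\<And>t. \<exists>n. x n > t" "\<And>t. \<exists>n. x n < t"
  shows "\<exists>idx. \<forall>t n. idx t = n \<longleftrightarrow> x n \<le> t \<and> t < x (n + 1)"
proof -
  have "\<exists>n. x n \<le> t \<and> t < x (n + 1)" for t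
  proof -
    obtain a where a: "x a < t" using ex by blast
    obtain b where b: "x b > t" using ex by blast
    have ab: "a < b" using a b monoD[OF x, of b a] by force
    \<comment> \<open>The first node beyond \<open>t\<close> after the index \<open>a\<close>. The
      node before it is at most \<open>t\<close>, by minimality or, if \<open>k = 0\<close>, by the
      choice of \<open>a\<close>.\<close>
    define k where "k = (LEAST k. x (a + int k + 1) > t)"
    have "x (a + int (nat (b - a - 1)) + 1) > t" using ab b by simp
    then have k: "x (a + int k + 1) > t" unfolding k_def by (rule LeastI)
    have "x (a + int k) \<le> t"
    proof (cases k)
      case (Suc j)
      have "\<not> x (a + int j + 1) > t" using not_less_Least[of j "\<lambda>k. x (a + int k + 1) > t"] Suc by (simp add: k_def)
      then show ?thesis using Suc by (simp add: add_ac)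
    qed (use a in simp)
    then show ?thesis using k by blast
  qed
  then obtain idx where idx: "\<And>t. x (idx t) \<le> t \<and> t < x (idx t + 1)" by metis
  have "n = idx t" if "x n \<le> t" "t < x (n + 1)" for t n
  proof (rule ccontr)
    assume "n \<noteq> idx t"
    then consider "n + 1 \<le> idx t" | "idx t + 1 \<le> n" by linarith
    then show False
    proof cases
      case 1
      from monoD[OF x 1] that idx[of t] show False by linarith
    next
      case 2
      from monoD[OF x 2] that idx[of t] show False by linarith
    qed
  qed
  then show ?thesis using idx by blast
qed

text \<open>The limsup controls the gaps only far out to the right. Evenness carries the bound to
  the left, and the bounded range in between is absorbed by the constant.\<close>

lemma sampling_exists:
  fixes x :: "int \<Rightarrow> real"
  assumes x: "mono x" and lim: "filterlim (\<lambda>n. \<bar>x n\<bar>) at_top (filtercomap abs at_top)"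
    and sym: "range x = range (\<lambda>n. - x n)" and D: "D \<ge> 3"
    and limsup: "Limsup at_top (\<lambda>n. ereal (\<bar>x (n + 1)\<bar> powr D * \<bar>x (n + 1) - x n\<bar>)) \<le> 1"
  shows "\<exists>idx C. sampling x idx C"
proof -
  note ub = unbounded_both[OF x lim sym]
  obtain idx where idx: "\<And>t n. idx t = n \<longleftrightarrow> x n \<le> t \<and> t < x (n + 1)"
    using idx_exists[OF x ub] by blast
  have idx': "x (idx t) \<le> t" "t < x (idx t + 1)" for t using idx[of t "idx t"] by auto
  have le_idx: "x n \<le> t \<Longrightarrow> n \<le> idx t" for n t
    using monoD[OF x, of "idx t + 1" n] idx'[of t] by force
  have "Limsup at_top (\<lambda>n. ereal (\<bar>x (n + 1)\<bar> powr D * \<bar>x (n + 1) - x n\<bar>)) < ereal 2"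
    using limsup by (rule le_less_trans) (simp add: one_ereal_def)
  then have "eventually (\<lambda>n. ereal (\<bar>x (n + 1)\<bar> powr D * \<bar>x (n + 1) - x n\<bar>) < ereal 2) at_top"
    by (rule Limsup_lessD)
  then obtain N where N: "\<And>n. n \<ge> N \<Longrightarrow> \<bar>x (n + 1)\<bar> powr D * \<bar>x (n + 1) - x n\<bar> < 2"
    by (auto simp: eventually_at_top_linorder)
  \<comment> \<open>Beyond \<open>R\<close> the index of the gap is at least \<open>N\<close>, and
    \<open>t \<ge> 1\<close> makes the powers with exponents 3 and \<open>D\<close>
    comparable.\<close>
  define R where "R = max 1 (x N)"
  have gap: "x (idx t + 1) - x (idx t) \<le> 2 / t ^ 3" if t: "t \<ge> R" for t
  proof -
    have t1: "t \<ge> 1" using t by (simp add: R_def)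
    have n: "idx t \<ge> N" using t by (intro le_idx) (simp add: R_def)
    have "t ^ 3 = t powr 3" using t1 powr_realpow[of t 3] by simp
    also have "\<dots> \<le> t powr D" using t1 D by (intro powr_mono) auto
    also have "\<dots> \<le> \<bar>x (idx t + 1)\<bar> powr D" using t1 D idx'(2)[of t] by (intro powr_mono2) auto
    finally have "t ^ 3 * \<bar>x (idx t + 1) - x (idx t)\<bar> \<le> \<bar>x (idx t + 1)\<bar> powr D * \<bar>x (idx t + 1) - x (idx t)\<bar>"
      by (intro mult_right_mono) auto
    also have "\<dots> \<le> 2" using N[OF n] by simp
    finally have "(x (idx t + 1) - x (idx t)) * t ^ 3 \<le> 2"
      using monoD[OF x, of "idx t" "idx t + 1"] by (simp add: mult.commute)
    then show ?thesis using t1 by (subst pos_le_divide_eq) auto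
  qed
  have neg: "\<exists>q. x q = - x n" for n
    using sym by (metis (no_types, lifting) imageE rangeI)
  have outer: "t - x (idx t) \<le> 2 / \<bar>t\<bar> ^ 3" if t: "\<bar>t\<bar> \<ge> R" for t
  proof (cases "t \<ge> 0")
    case True
    then show ?thesis using gap[of t] t idx'[of t] by simp
  next
    case False
    show ?thesis
    proof (cases "x (idx t) = t")
      case True
      then show ?thesis by simp
    next
      case neq: False
      \<comment> \<open>By evenness the gap around \<open>t\<close> lies in the reflection of the gap around \<open>- t\<close>.\<close>
      have t': "- t \<ge> R" using False t by simp
      let ?m = "idx (- t)" and ?n = "idx t"
      obtain q where q: "x q = - x ?m" using neg by blast
      obtain r where r: "x r = - x (?m + 1)" using neg by blast
      have "x q > x ?n" using q idx'[of "- t"] idx'[of t] neq by linarith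
      then have "q \<ge> ?n + 1" using monoD[OF x, of q ?n] by force
      then have 1: "x (?n + 1) \<le> - x ?m" using monoD[OF x, of "?n + 1" q] q by simp
      have "x r \<le> t" using r idx'[of "- t"] by linarith
      then have "r \<le> ?n" by (rule le_idx)
      then have 2: "- x (?m + 1) \<le> x ?n" using monoD[OF x, of r ?n] r by simp
      have "t - x ?n \<le> x (?m + 1) - x ?m" using 1 2 idx'[of t] by linarith
      also have "\<dots> \<le> 2 / (- t) ^ 3" by (rule gap[OF t'])
      finally show ?thesis using False by simp
    qed
  qed
  \<comment> \<open>For \<open>\<bar>t\<bar> < R\<close> the node below \<open>t\<close> is not
    smaller than the node below \<open>- R\<close>, so \<open>B\<close> bounds the distance from
    \<open>t\<close> to its node.\<close>
  define B where "B = max 0 (R - x (idx (- R)))"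
  \<comment> \<open>16 is \<open>2 * 2 ^ 3\<close>, from the outer bound and
    \<open>br t \<le> 2 * \<bar>t\<bar>\<close> for \<open>\<bar>t\<bar> \<ge> 1\<close>; the other
    term serves the bounded range.\<close>
  have "sampling x idx (16 + B * br R ^ 3)"
  proof
    show "t - x (idx t) \<le> (16 + B * br R ^ 3) / br t ^ 3" for t
    proof (cases "\<bar>t\<bar> \<ge> R")
      case True
      have R1: "1 \<le> \<bar>t\<bar>" using True by (simp add: R_def)
      have "br t ^ 3 \<le> (2 * \<bar>t\<bar>) ^ 3" using R1 by (intro power_mono) (auto simp: br_def)
      then have "2 * br t ^ 3 \<le> 16 * \<bar>t\<bar> ^ 3" by (simp add: power_mult_distrib)
      then have "2 / \<bar>t\<bar> ^ 3 \<le> 16 / br t ^ 3"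
        using R1 by (subst frac_le_eq) (auto intro!: divide_nonpos_pos mult_pos_pos simp: br_pos)
      also have "\<dots> \<le> (16 + B * br R ^ 3) / br t ^ 3"
        by (intro divide_right_mono) (auto simp: B_def)
      finally show ?thesis using outer[OF True] by linarith
    next
      case False
      have "idx (- R) \<le> idx t" using False idx'(1)[of "- R"] by (intro le_idx) auto
      then have "x (idx (- R)) \<le> x (idx t)" by (rule monoD[OF x])
      then have "t - x (idx t) \<le> B" using False by (simp add: B_def)
      also have "\<dots> \<le> (16 + B * br R ^ 3) / br t ^ 3"
      proof (subst pos_le_divide_eq)
        have "br t ^ 3 \<le> br R ^ 3" using False by (intro power_mono) (auto simp: br_def)
        then have "B * br t ^ 3 \<le> B * br R ^ 3" by (intro mult_left_mono) (auto simp: B_def)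
        then show "B * br t ^ 3 \<le> 16 + B * br R ^ 3" by simp
      qed (simp add: br_pos)
      finally show ?thesis .
    qed
  qed (use x idx in \<open>auto simp: B_def\<close>)
  then show ?thesis by blast
qed

section \<open>The error kernel of the Riemann sums\<close>

text \<open>The quarter turn by which the Fourier transform acts on the atoms, see
  \<open>fourier_atom\<close>.\<close>

definition rot :: "real \<times> real \<Rightarrow> real \<times> real" where "rot z = (snd z, - fst z)"

lemma om_rot [simp]: "om (rot z) = om z" by (simp add: om_def rot_def)

lemma rot_measurable [measurable]: "rot \<in> borel_measurable borel"
  unfolding rot_def[abs_def] by (intro borel_measurable_continuous_onI continuous_intros)

lemma distr_rot: "distr lborel lborel rot = (lborel :: (real \<times> real) measure)"
proof -
  have m: "rot \<in> measurable (lborel \<Otimes>\<^sub>M lborel) (lborel \<Otimes>\<^sub>M lborel)"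
    using rot_measurable by (simp add: lborel_prod measurable_lborel2 measurable_lborel1)
  have "distr (lborel \<Otimes>\<^sub>M lborel) (lborel \<Otimes>\<^sub>M lborel) rot = (lborel \<Otimes>\<^sub>M lborel :: (real \<times> real) measure)"
  proof (rule measure_eqI)
    show "sets (distr (lborel \<Otimes>\<^sub>M lborel) (lborel \<Otimes>\<^sub>M lborel) rot) = sets (lborel \<Otimes>\<^sub>M lborel)" by simp
  next
    fix A assume A': "A \<in> sets (distr (lborel \<Otimes>\<^sub>M lborel) (lborel \<Otimes>\<^sub>M lborel) rot)"
    then have A [measurable]: "A \<in> sets (lborel \<Otimes>\<^sub>M lborel)" by simp
    note m [measurable]
    have "emeasure (distr (lborel \<Otimes>\<^sub>M lborel) (lborel \<Otimes>\<^sub>M lborel) rot) A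
        = (\<integral>\<^sup>+z. indicator A z \<partial>(distr (lborel \<Otimes>\<^sub>M lborel) (lborel \<Otimes>\<^sub>M lborel) rot))"
      by (rule nn_integral_indicator[OF A', symmetric])
    also have "\<dots> = (\<integral>\<^sup>+z. indicator A (rot z) \<partial>(lborel \<Otimes>\<^sub>M lborel))"
      by (rule nn_integral_distr[OF m]) simp
    also have "\<dots> = (\<integral>\<^sup>+\<xi>. \<integral>\<^sup>+x. indicator A (\<xi>, - x) \<partial>lborel \<partial>lborel)"
      by (subst lborel_pair.nn_integral_snd[symmetric]) (auto simp: rot_def)
    also have "\<dots> = (\<integral>\<^sup>+\<xi>. \<integral>\<^sup>+x. indicator A (\<xi>, x) \<partial>lborel \<partial>lborel)"
    proof (rule nn_integral_cong)
      fix \<xi> :: real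
      show "(\<integral>\<^sup>+x. indicator A (\<xi>, - x) \<partial>lborel) = (\<integral>\<^sup>+x. indicator A (\<xi>, x) \<partial>lborel)"
        using nn_integral_real_affine[of "\<lambda>x. indicator A (\<xi>, x)" "- 1" 0] by simp
    qed
    also have "\<dots> = (\<integral>\<^sup>+z. indicator A z \<partial>(lborel \<Otimes>\<^sub>M lborel))"
      by (rule lborel.nn_integral_fst) simp
    also have "\<dots> = emeasure (lborel \<Otimes>\<^sub>M lborel) A" by (rule nn_integral_indicator[OF A])
    finally show "emeasure (distr (lborel \<Otimes>\<^sub>M lborel) (lborel \<Otimes>\<^sub>M lborel) rot) A = emeasure (lborel \<Otimes>\<^sub>M lborel) A" .
  qed
  then show ?thesis by (simp add: lborel_prod)
qed

lemma integral_rot: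
  fixes g :: "real \<times> real \<Rightarrow> 'b::{banach, second_countable_topology}"
  assumes [measurable]: "g \<in> borel_measurable borel"
  shows "(LINT z|lborel. g (rot z)) = (LINT z|lborel. g z)"
    and "integrable lborel (\<lambda>z. g (rot z)) \<longleftrightarrow> integrable lborel g"
proof -
  have "(LINT z|lborel. g z) = (LINT z|distr lborel lborel rot. g z)" by (simp add: distr_rot)
  also have "\<dots> = (LINT z|lborel. g (rot z))" by (rule integral_distr) auto
  finally show "(LINT z|lborel. g (rot z)) = (LINT z|lborel. g z)" by simp
  have "integrable lborel g \<longleftrightarrow> integrable (distr lborel lborel rot) g" by (simp add: distr_rot)
  also have "\<dots> \<longleftrightarrow> integrable lborel (\<lambda>z. g (rot z))" by (rule integrable_distr_eq) auto
  finally show "integrable lborel (\<lambda>z. g (rot z)) \<longleftrightarrow> integrable lborel g" by simp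
qed

lemma fourier_synth:
  assumes U: "rapid U"
  shows "fourier (synth U) \<eta> = (LINT z|lborel. U z * (cis (2 * pi * fst z * snd z) * atom (rot z) \<eta>))"
proof -
  have [measurable]: "U \<in> borel_measurable borel" using U by (simp add: rapid_def)
  obtain M where M: "M \<ge> 0" "\<And>z. norm (U z) \<le> M / om z ^ 4" using rapid_bound[OF U] by metis
  have Ui: "integrable lborel U" by (rule integrable_om_bound[OF _ M(2)]) simp
  have "(\<lambda>t. norm (U z * atom z t * cis (- 2 * pi * t * \<eta>))) = (\<lambda>t. norm (U z) * phi (t - fst z))" for z
    by (simp add: norm_mult)
  moreover have "(LINT t|lborel. norm (U z) * phi (t - fst z)) = norm (U z) * (LINT t|lborel. phi t)" for z
    using integral_shift[of phi "fst z"] by simp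
  ultimately have n: "(LINT t|lborel. norm (U z * atom z t * cis (- 2 * pi * t * \<eta>))) = norm (U z) * (LINT t|lborel. phi t)" for z
    by simp
  have i: "integrable lborel (\<lambda>t. U z * atom z t * cis (- 2 * pi * t * \<eta>))" for z
    by (rule integrable_fourier_integrand[OF integrable_mult_right[OF integrable_atom]])
  have *: "integrable (lborel \<Otimes>\<^sub>M lborel) (\<lambda>(z, t). U z * atom z t * cis (- 2 * pi * t * \<eta>))"
  proof (rule lborel_pair.Fubini_integrable)
    show "(\<lambda>(z, t). U z * atom z t * cis (- 2 * pi * t * \<eta>)) \<in> borel_measurable (lborel \<Otimes>\<^sub>M lborel)"
      by measurable
    show "integrable lborel (\<lambda>z. LINT t|lborel. norm (case (z, t) of (z, t) \<Rightarrow> U z * atom z t * cis (- 2 * pi * t * \<eta>)))"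
      unfolding prod.case n using Ui by simp
    show "AE z in lborel. integrable lborel (\<lambda>t. case (z, t) of (z, t) \<Rightarrow> U z * atom z t * cis (- 2 * pi * t * \<eta>))"
      unfolding prod.case by (intro AE_I2 i)
  qed
  have "fourier (synth U) \<eta> = (LINT t|lborel. LINT z|lborel. U z * atom z t * cis (- 2 * pi * t * \<eta>))"
    unfolding fourier_cis synth_def integral_mult_left_zero ..
  also have "\<dots> = (LINT z|lborel. LINT t|lborel. U z * atom z t * cis (- 2 * pi * t * \<eta>))"
    by (rule lborel_pair.Fubini_integral[OF *])
  also have "\<dots> = (LINT z|lborel. U z * fourier (atom z) \<eta>)"
    unfolding fourier_cis mult.assoc integral_mult_right_zero ..
  finally show ?thesis unfolding fourier_atom rot_def .
qed

lemma stft_rot: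
  assumes f: "f \<in> schwartz_space"
  shows "stft f z = cis (- 2 * pi * fst z * snd z) * stft (fourier f) (rot z)"
    and "stft (fourier f) (rot z) = cis (2 * pi * fst z * snd z) * stft f z"
proof -
  show *: "stft f z = cis (- 2 * pi * fst z * snd z) * stft (fourier f) (rot z)"
    using stft_fourier[OF sch_integrable[OF f], of "fst z" "snd z"] by (simp add: rot_def)
  have "cis (2 * pi * fst z * snd z) * stft f z = (cis (2 * pi * fst z * snd z) * cis (- 2 * pi * fst z * snd z)) * stft (fourier f) (rot z)"
    unfolding * by (simp only: mult.assoc)
  then show "stft (fourier f) (rot z) = cis (2 * pi * fst z * snd z) * stft f z"
    by (simp add: cis_mult)
qed

text \<open>The argument passes through the phase plane: up to a phase, the transform of
  \<open>fourier f\<close> is the rotated \<open>stft f\<close>, hence rapid, and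
  \<open>fourier f\<close> is its synthesis. Smoothness then comes from
  \<open>synth_schwartz\<close>.\<close>

lemma fourier_schwartz:
  assumes f: "f \<in> schwartz_space"
  shows "fourier f \<in> schwartz_space" "rapid (stft (fourier f))"
proof -
  note [measurable] = sch_measurable[OF f]
  have inv: "rot (- snd z, fst z) = z" for z by (simp add: rot_def)
  show r: "rapid (stft (fourier f))"
    unfolding rapid_def
  proof (intro conjI allI)
    fix s
    obtain M where M: "\<And>z. norm (stft f z) \<le> M / om z ^ s" using rapid_bound[OF rapid_stft[OF f]] by metis
    have "norm (stft (fourier f) z) \<le> M / om z ^ s" for z
      using M[of "(- snd z, fst z)"] stft_rot(2)[OF f, of "(- snd z, fst z)"]
      unfolding inv by (simp add: norm_mult om_def add_ac)
    then show "\<exists>M. \<forall>z. norm (stft (fourier f) z) \<le> M / om z ^ s" by blast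
  qed simp
  have "fourier f \<eta> = synth (stft (fourier f)) \<eta>" for \<eta>
  proof -
    have "fourier f \<eta> = fourier (synth (stft f)) \<eta>" using synth_stft[OF f] by presburger
    also have "\<dots> = (LINT z|lborel. stft (fourier f) (rot z) * atom (rot z) \<eta>)"
      unfolding fourier_synth[OF rapid_stft[OF f]] stft_rot(2)[OF f] by (simp add: mult_ac)
    also have "\<dots> = synth (stft (fourier f)) \<eta>"
      unfolding synth_def by (rule integral_rot) simp
    finally show ?thesis .
  qed
  then have "fourier f = synth (stft (fourier f))" by blast
  then show "fourier f \<in> schwartz_space" using synth_schwartz[OF r] by simp
qed

text \<open>Measures the derivative of a product of two atoms. Only the frequencies enter, since the
  contributions of the positions go into the Gaussian factors.\<close>

definition slope :: "real \<times> real \<Rightarrow> real \<times> real \<Rightarrow> real" where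
  "slope z z' = 1 + \<bar>snd z\<bar> + \<bar>snd z'\<bar>"

lemma norm_2pi: "norm (2 * complex_of_real pi) = 2 * pi"
  by (simp add: norm_mult)

lemma atom_product_derivative:
  "((\<lambda>t. atom z' t * cnj (atom z t)) has_vector_derivative
     (2 * pi * \<i> * of_real (snd z') - 2 * pi * of_real (t - fst z')
      - 2 * pi * \<i> * of_real (snd z) - 2 * pi * of_real (t - fst z)) * (atom z' t * cnj (atom z t))) (at t)"
  by (rule has_vector_derivative_eq_rhs[OF has_vector_derivative_mult[OF atom_has_vector_derivative
      has_vector_derivative_cnj[OF atom_has_vector_derivative]]]) (simp add: algebra_simps)

lemma norm_atom_product_derivative:
  "norm ((2 * pi * \<i> * of_real (snd z') - 2 * pi * of_real (t - fst z')
      - 2 * pi * \<i> * of_real (snd z) - 2 * pi * of_real (t - fst z)) * (atom z' t * cnj (atom z t)))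
   \<le> 2 * pi * slope z z' * (br (t - fst z') * phi (t - fst z')) * (br (t - fst z) * phi (t - fst z))"
proof -
  let ?a = "t - fst z" and ?a' = "t - fst z'" and ?s = "slope z z'"
  have "norm (2 * pi * \<i> * of_real (snd z') - 2 * pi * complex_of_real ?a' - 2 * pi * \<i> * of_real (snd z) - 2 * pi * complex_of_real ?a)
      \<le> norm (2 * pi * \<i> * of_real (snd z')) + norm (2 * pi * complex_of_real ?a') + norm (2 * pi * \<i> * of_real (snd z)) + norm (2 * pi * complex_of_real ?a)"
    by (intro norm_triangle_le_diff add_mono order_refl)
  also have "\<dots> = 2 * pi * (\<bar>snd z'\<bar> + \<bar>?a'\<bar> + \<bar>snd z\<bar> + \<bar>?a\<bar>)"
    by (simp only: norm_mult norm_2pi norm_of_real norm_ii) (simp add: algebra_simps)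
  also have "\<dots> \<le> 2 * pi * (?s * br ?a' * br ?a)"
  proof (intro mult_left_mono)
    have "?s * br ?a' * br ?a = ?s + ?s * \<bar>?a'\<bar> + ?s * \<bar>?a\<bar> + ?s * (\<bar>?a'\<bar> * \<bar>?a\<bar>)"
      by (simp add: br_def algebra_simps)
    moreover have "1 * \<bar>?a'\<bar> \<le> ?s * \<bar>?a'\<bar>" "1 * \<bar>?a\<bar> \<le> ?s * \<bar>?a\<bar>"
      by (intro mult_right_mono; simp add: slope_def)+
    moreover have "0 \<le> ?s * (\<bar>?a'\<bar> * \<bar>?a\<bar>)" by (simp add: slope_def)
    ultimately show "\<bar>snd z'\<bar> + \<bar>?a'\<bar> + \<bar>snd z\<bar> + \<bar>?a\<bar> \<le> ?s * br ?a' * br ?a"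
      using slope_def[of z z'] by linarith
  qed simp
  finally have "norm (2 * pi * \<i> * of_real (snd z') - 2 * pi * of_real ?a' - 2 * pi * \<i> * of_real (snd z) - 2 * pi * of_real ?a) * (phi ?a' * phi ?a)
      \<le> 2 * pi * (?s * br ?a' * br ?a) * (phi ?a' * phi ?a)"
    by (intro mult_right_mono) auto
  then show ?thesis by (simp add: norm_mult mult_ac)
qed

context sampling begin

text \<open>\<open>errk z z'\<close> is the error made at \<open>z\<close> when the transform of the atom at \<open>z'\<close> is computed by
  the Riemann sum.\<close>

definition gap_integrand where
  "gap_integrand z z' t = atom z' t * cnj (atom z t) - atom z' (p t) * cnj (atom z (p t))"

definition errk where "errk z z' = (LINT t|lborel. gap_integrand z z' t)"

lemma gap_integrand_measurable [measurable]:
  assumes [measurable]: "f \<in> borel_measurable M" "g \<in> borel_measurable M" "h \<in> borel_measurable M"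
  shows "(\<lambda>v. gap_integrand (f v) (g v) (h v)) \<in> borel_measurable M"
  unfolding gap_integrand_def by measurable

text \<open>The mean value theorem on \<open>{p t..t}\<close>: the interval has length at most
  \<open>C0 / br t ^ 3\<close>, and the derivative is \<open>slope\<close> times two weighted
  Gaussians. As \<open>p t\<close> is within \<open>C0\<close> of \<open>t\<close>, these may be
  evaluated at \<open>t\<close>; their decay moves \<open>br t ^ 3\<close> to
  \<open>br (fst z) ^ 3\<close> and localises \<open>fst z'\<close> near
  \<open>fst z\<close>.\<close>

lemma gap_integrand_bound:
  "\<exists>K\<ge>0. \<forall>z z' t. norm (gap_integrand z z' t) \<le>
     K * slope z z' / (br (fst z) ^ 3 * br (fst z - fst z') ^ N) * (1 / br (t - fst z) ^ 2)"
proof -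
  \<comment> \<open>\<open>N\<close> powers for the distance of the positions, 3 for moving
    \<open>br t ^ 3\<close> to \<open>fst z\<close>, 2 for the integration over \<open>t\<close>.
    The further power in the choice of \<open>P\<close> absorbs the factor
    \<open>br u\<close>.\<close>
  let ?M = "N + 5"
  obtain P where P: "P \<ge> 0" "\<And>u. phi u \<le> P / br u ^ (?M + 1)" using phi_decay by metis
  have bP: "br u * phi u \<le> P / br u ^ ?M" for u
  proof -
    have "br u * phi u \<le> br u * (P / br u ^ (?M + 1))" by (intro mult_left_mono P) auto
    also have "br u * (P / br u ^ (?M + 1)) = P / br u ^ ?M"
      unfolding power_add[of _ ?M 1] power_one_right by simp
    finally show ?thesis .
  qed
  have shift: "br (\<tau> - a) * phi (\<tau> - a) \<le> P * br C0 ^ ?M / br (t - a) ^ ?M" if "\<bar>t - \<tau>\<bar> \<le> C0" for \<tau> t a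
  proof -
    have "br (t - a) \<le> br (\<tau> - a) * br (t - \<tau>)" using br_add[of "\<tau> - a" "t - \<tau>"] by simp
    also have "\<dots> \<le> br (\<tau> - a) * br C0" using that by (intro mult_left_mono) (auto simp: br_def)
    finally have "br (t - a) ^ ?M \<le> (br (\<tau> - a) * br C0) ^ ?M" by (intro power_mono) auto
    then have "P * br (t - a) ^ ?M \<le> P * (br (\<tau> - a) ^ ?M * br C0 ^ ?M)"
      using P(1) unfolding power_mult_distrib by (intro mult_left_mono) auto
    then have "P / br (\<tau> - a) ^ ?M \<le> P * br C0 ^ ?M / br (t - a) ^ ?M"
      by (subst frac_le_eq) (auto intro!: divide_nonpos_pos mult_pos_pos simp: br_pos mult_ac)
    then show ?thesis using bP[of "\<tau> - a"] by linarith
  qed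
  define Q where "Q = P * br C0 ^ ?M"
  have Q: "0 \<le> Q" unfolding Q_def using P(1) by simp
  have "norm (gap_integrand z z' t) \<le>
     (2 * pi * Q * Q * C0) * slope z z' / (br (fst z) ^ 3 * br (fst z - fst z') ^ N) * (1 / br (t - fst z) ^ 2)" for z z' t
  proof -
    let ?g = "\<lambda>t. atom z' t * cnj (atom z t)"
    let ?x = "fst z" and ?x' = "fst z'" and ?s = "slope z z'"
    let ?B = "2 * pi * ?s * (Q / br (t - ?x') ^ ?M) * (Q / br (t - ?x) ^ ?M)"
    have s0: "0 \<le> ?s" by (simp add: slope_def)
    have B0: "0 \<le> ?B" using s0 Q by simp
    have a: "norm (?g t - ?g (p t)) \<le> ?B * norm (t - p t)"
    proof (rule differentiable_bound[of "{p t..t}" ?g "\<lambda>\<tau> h. h *\<^sub>R ((2 * pi * \<i> * of_real (snd z') - 2 * pi * of_real (\<tau> - fst z')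
      - 2 * pi * \<i> * of_real (snd z) - 2 * pi * of_real (\<tau> - fst z)) * (atom z' \<tau> * cnj (atom z \<tau>)))"])
      fix \<tau> assume \<tau>: "\<tau> \<in> {p t..t}"
      show "(?g has_derivative (\<lambda>h. h *\<^sub>R ((2 * pi * \<i> * of_real (snd z') - 2 * pi * of_real (\<tau> - fst z')
      - 2 * pi * \<i> * of_real (snd z) - 2 * pi * of_real (\<tau> - fst z)) * (atom z' \<tau> * cnj (atom z \<tau>))))) (at \<tau> within {p t..t})"
        using atom_product_derivative[of z' z \<tau>] unfolding has_vector_derivative_def by (rule has_derivative_at_withinI)
      have near: "\<bar>t - \<tau>\<bar> \<le> C0" using \<tau> p_near[of t] by auto
      have d: "norm ((2 * pi * \<i> * of_real (snd z') - 2 * pi * of_real (\<tau> - fst z')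
      - 2 * pi * \<i> * of_real (snd z) - 2 * pi * of_real (\<tau> - fst z)) * (atom z' \<tau> * cnj (atom z \<tau>))) \<le> ?B"
      proof (rule order_trans[OF norm_atom_product_derivative])
        show "2 * pi * ?s * (br (\<tau> - ?x') * phi (\<tau> - ?x')) * (br (\<tau> - ?x) * phi (\<tau> - ?x)) \<le> ?B"
          by (intro mult_mono shift[OF near, folded Q_def] order_refl) (use s0 Q in auto)
      qed
      show "onorm (\<lambda>h. h *\<^sub>R ((2 * pi * \<i> * of_real (snd z') - 2 * pi * of_real (\<tau> - fst z')
      - 2 * pi * \<i> * of_real (snd z) - 2 * pi * of_real (\<tau> - fst z)) * (atom z' \<tau> * cnj (atom z \<tau>)))) \<le> ?B"
        by (rule onorm_le) (unfold norm_scaleR real_norm_def mult.commute[of ?B], intro mult_left_mono d abs_ge_zero)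
    qed (use p_le[of t] in auto)
    have "norm (t - p t) \<le> C0 / br t ^ 3" using p_le[of t] p_gap[of t] by simp
    then have 1: "norm (gap_integrand z z' t) \<le> ?B * (C0 / br t ^ 3)"
      unfolding gap_integrand_def by (intro order_trans[OF a mult_left_mono] B0)
    have "br (?x - ?x') \<le> br (t - ?x) * br (t - ?x')" using br_diff[of "t - ?x'" "t - ?x"] by (simp add: mult.commute)
    then have "br (?x - ?x') ^ N \<le> (br (t - ?x) * br (t - ?x')) ^ N" by (intro power_mono) auto
    moreover have "br ?x ^ 3 \<le> (br t * br (t - ?x)) ^ 3" using br_diff[of t "t - ?x"] by (intro power_mono) auto
    ultimately have "br ?x ^ 3 * br (?x - ?x') ^ N \<le> (br t * br (t - ?x)) ^ 3 * (br (t - ?x) * br (t - ?x')) ^ N"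
      by (intro mult_mono) auto
    also have "\<dots> \<le> (br t * br (t - ?x)) ^ 3 * (br (t - ?x) * br (t - ?x')) ^ N * br (t - ?x') ^ 5"
      using mult_left_mono[OF br_power_ge1[of "t - ?x'" 5], of "(br t * br (t - ?x)) ^ 3 * (br (t - ?x) * br (t - ?x')) ^ N"] by simp
    finally have "br ?x ^ 3 * br (?x - ?x') ^ N * br (t - ?x) ^ 2 \<le> (br t * br (t - ?x)) ^ 3 * (br (t - ?x) * br (t - ?x')) ^ N * br (t - ?x') ^ 5 * br (t - ?x) ^ 2"
      by (intro mult_right_mono) auto
    also have "\<dots> = br (t - ?x') ^ ?M * br (t - ?x) ^ ?M * br t ^ 3"
      by (simp add: power_mult_distrib power_add)
    finally have 2: "1 / (br (t - ?x') ^ ?M * br (t - ?x) ^ ?M * br t ^ 3) \<le> 1 / (br ?x ^ 3 * br (?x - ?x') ^ N * br (t - ?x) ^ 2)"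
      by (intro divide_left_mono mult_pos_pos br_power_pos zero_le_one)
    have "?B * (C0 / br t ^ 3) = (2 * pi * Q * Q * C0 * ?s) * (1 / (br (t - ?x') ^ ?M * br (t - ?x) ^ ?M * br t ^ 3))"
      by (simp only: times_divide_times_eq times_divide_eq_right times_divide_eq_left divide_divide_eq_left mult_1_right mult_1 mult_ac)
    also have "\<dots> \<le> (2 * pi * Q * Q * C0 * ?s) * (1 / (br ?x ^ 3 * br (?x - ?x') ^ N * br (t - ?x) ^ 2))"
      using 2 Q C0 s0 by (intro mult_left_mono) auto
    also have "\<dots> = (2 * pi * Q * Q * C0) * ?s / (br ?x ^ 3 * br (?x - ?x') ^ N) * (1 / br (t - ?x) ^ 2)"
      by (simp only: times_divide_times_eq times_divide_eq_right times_divide_eq_left divide_divide_eq_left mult_1_right mult_1 mult_ac)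
    finally show ?thesis using 1 by linarith
  qed
  moreover have "0 \<le> 2 * pi * Q * Q * C0" using Q C0 by simp
  ultimately show ?thesis by blast
qed

lemma integrable_gap_integrand: "integrable lborel (gap_integrand z z')"
proof -
  obtain K where K: "\<forall>z z' t. norm (gap_integrand z z' t) \<le>
     K * slope z z' / (br (fst z) ^ 3 * br (fst z - fst z') ^ 0) * (1 / br (t - fst z) ^ 2)"
    using gap_integrand_bound by blast
  show ?thesis
  proof (rule Bochner_Integration.integrable_bound[OF integrable_mult_right[OF integrable_br2_shift]])
    show "AE t in lborel. norm (gap_integrand z z' t) \<le> norm (K * slope z z' / (br (fst z) ^ 3 * br (fst z - fst z') ^ 0) * (1 / br (t - fst z) ^ 2))"
      unfolding real_norm_def by (intro AE_I2 order_trans[OF K[rule_format] abs_ge_self])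
  qed measurable
qed

text \<open>The kernel decays off the diagonal in position only. In frequency the bound even grows,
  so the frequency integral must be paid for by the weight of the function on which the kernel
  acts.\<close>

lemma errk_bound:
  "\<exists>K\<ge>0. \<forall>z z'. norm (errk z z') \<le> K * slope z z' / (br (fst z) ^ 3 * br (fst z - fst z') ^ N)"
proof -
  obtain K where K: "K \<ge> 0" "\<forall>z z' t. norm (gap_integrand z z' t) \<le>
     K * slope z z' / (br (fst z) ^ 3 * br (fst z - fst z') ^ N) * (1 / br (t - fst z) ^ 2)"
    using gap_integrand_bound by blast
  have "norm (errk z z') \<le> (K * brint) * slope z z' / (br (fst z) ^ 3 * br (fst z - fst z') ^ N)" for z z'
  proof -
    have "norm (errk z z') \<le> (LINT t|lborel. K * slope z z' / (br (fst z) ^ 3 * br (fst z - fst z') ^ N) * (1 / br (t - fst z) ^ 2))"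
      unfolding errk_def by (rule norm_integral_le[OF K(2)[rule_format]]) (intro integrable_mult_right integrable_br2_shift)
    also have "\<dots> = (K * brint) * slope z z' / (br (fst z) ^ 3 * br (fst z - fst z') ^ N)"
      unfolding integral_mult_right_zero integral_br2_shift
      by (simp only: times_divide_eq_left times_divide_eq_right mult_ac)
    finally show ?thesis .
  qed
  moreover have "0 \<le> K * brint" using K(1) brint_nonneg by simp
  ultimately show ?thesis by blast
qed

lemma errk_measurable [measurable]:
  assumes [measurable]: "f \<in> borel_measurable M" "g \<in> borel_measurable M"
  shows "(\<lambda>v. errk (f v) (g v)) \<in> borel_measurable M"
  unfolding errk_def by measurable

end

section \<open>Lipschitz dependence of the error kernel on its first argument\<close>

lemma phi_lipschitz: "\<exists>L\<ge>0. \<forall>a b. \<bar>phi a - phi b\<bar> \<le> L * \<bar>a - b\<bar>"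
proof -
  obtain P where P: "P \<ge> 0" "\<And>u. phi u \<le> P / br u ^ 1" using phi_decay by metis
  have "norm (phi a - phi b) \<le> (2 * pi * P) * norm (a - b)" for a b
  proof (rule differentiable_bound[of UNIV phi "\<lambda>u. (*) (- 2 * pi * u * phi u)"])
    fix u :: real
    have "(phi has_real_derivative (- 2 * pi * u * phi u)) (at u)"
      unfolding phi_def by (auto intro!: derivative_eq_intros)
    then show "(phi has_derivative (*) (- 2 * pi * u * phi u)) (at u)"
      unfolding has_field_derivative_def .
    have "\<bar>u\<bar> * phi u \<le> br u * (P / br u ^ 1)" by (intro mult_mono P(2)) (auto simp: br_def)
    then have "2 * pi * (\<bar>u\<bar> * phi u) \<le> 2 * pi * P" by (intro mult_left_mono) auto
    then have *: "\<bar>- 2 * pi * u * phi u\<bar> \<le> 2 * pi * P" by (simp add: abs_mult mult_ac)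
    show "onorm ((*) (- 2 * pi * u * phi u)) \<le> 2 * pi * P"
    proof (rule onorm_le)
      show "norm (- 2 * pi * u * phi u * h) \<le> 2 * pi * P * norm h" for h
        unfolding norm_mult[of _ h] using * by (intro mult_right_mono) auto
    qed
  qed auto
  then show ?thesis using P(1) by (intro exI[of _ "2 * pi * P"]) auto
qed

lemma norm_cis_diff_le: "norm (cis a - cis b) \<le> \<bar>a - b\<bar>"
proof -
  have "norm (cis a - cis b) \<le> 1 * norm (a - b)"
  proof (rule differentiable_bound[of UNIV cis "\<lambda>u h. h *\<^sub>R (\<i> * cis u)"])
    show "(cis has_derivative (\<lambda>h. h *\<^sub>R (\<i> * cis u))) (at u)" for u
      using has_vector_derivative_cis[of 1 0 u] by (simp add: has_vector_derivative_def)
    show "onorm (\<lambda>h. h *\<^sub>R (\<i> * cis u)) \<le> 1" for u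
      by (rule onorm_le) (simp add: norm_mult)
  qed auto
  then show ?thesis by simp
qed

definition pdist :: "real \<times> real \<Rightarrow> real \<times> real \<Rightarrow> real" where
  "pdist z v = \<bar>fst z - fst v\<bar> + \<bar>snd z - snd v\<bar>"

lemma pdist_nonneg [simp]: "0 \<le> pdist z v" by (simp add: pdist_def)

lemma atom_lipschitz: "\<exists>L\<ge>0. \<forall>z v t. norm (atom z t - atom v t) \<le> L * pdist z v * br t"
proof -
  obtain L where L: "L \<ge> 0" "\<forall>a b. \<bar>phi a - phi b\<bar> \<le> L * \<bar>a - b\<bar>" using phi_lipschitz by blast
  obtain P where P: "P \<ge> 0" "\<And>u. phi u \<le> P / br u ^ 0" using phi_decay by metis
  have "norm (atom z t - atom v t) \<le> (L + 2 * pi * P) * pdist z v * br t" for z v t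
  proof -
    let ?a = "cis (2 * pi * t * snd z)" and ?b = "cis (2 * pi * t * snd v)"
    have "atom z t - atom v t = of_real (phi (t - fst z) - phi (t - fst v)) * ?a + of_real (phi (t - fst v)) * (?a - ?b)"
      by (simp add: atom_def algebra_simps)
    then have "norm (atom z t - atom v t) \<le> \<bar>phi (t - fst z) - phi (t - fst v)\<bar> + phi (t - fst v) * norm (?a - ?b)"
      using norm_triangle_ineq[of "of_real (phi (t - fst z) - phi (t - fst v)) * ?a" "of_real (phi (t - fst v)) * (?a - ?b)"]
      by (simp only: norm_mult norm_cis norm_of_real mult_1_right abs_of_nonneg[OF phi_nonneg])
    also have "\<dots> \<le> L * \<bar>fst z - fst v\<bar> + P * (2 * pi * \<bar>t\<bar> * \<bar>snd z - snd v\<bar>)"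
    proof (intro add_mono mult_mono)
      show "\<bar>phi (t - fst z) - phi (t - fst v)\<bar> \<le> L * \<bar>fst z - fst v\<bar>"
        using L(2)[rule_format, of "t - fst z" "t - fst v"] by (simp add: abs_minus_commute)
      show "phi (t - fst v) \<le> P" using P(2)[of "t - fst v"] by simp
      have "\<bar>2 * pi * t * snd z - 2 * pi * t * snd v\<bar> = 2 * pi * \<bar>t\<bar> * \<bar>snd z - snd v\<bar>"
        by (simp add: abs_mult flip: right_diff_distrib)
      then show "norm (?a - ?b) \<le> 2 * pi * \<bar>t\<bar> * \<bar>snd z - snd v\<bar>"
        using norm_cis_diff_le[of "2 * pi * t * snd z" "2 * pi * t * snd v"] by simp
    qed (use P in auto)
    also have "\<dots> \<le> L * (pdist z v * br t) + P * (2 * pi * (pdist z v * br t))"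
    proof (intro add_mono mult_left_mono)
      have "\<bar>fst z - fst v\<bar> * 1 \<le> pdist z v * br t"
        by (intro mult_mono br_ge1) (auto simp: pdist_def)
      then show "\<bar>fst z - fst v\<bar> \<le> pdist z v * br t" by simp
      have "\<bar>snd z - snd v\<bar> * \<bar>t\<bar> \<le> pdist z v * br t"
        by (intro mult_mono) (auto simp: pdist_def br_def)
      then have "2 * pi * (\<bar>snd z - snd v\<bar> * \<bar>t\<bar>) \<le> 2 * pi * (pdist z v * br t)" by (intro mult_left_mono) auto
      then show "2 * pi * \<bar>t\<bar> * \<bar>snd z - snd v\<bar> \<le> 2 * pi * (pdist z v * br t)" by (simp only: mult_ac)
    qed (use L P in auto)
    also have "\<dots> = (L + 2 * pi * P) * pdist z v * br t" by (simp add: algebra_simps)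
    finally show ?thesis .
  qed
  then show ?thesis using L(1) P(1) by (intro exI[of _ "L + 2 * pi * P"]) auto
qed

context sampling begin

lemma br_shift:
  assumes "\<bar>t - \<tau>\<bar> \<le> C0" shows "1 / br (\<tau> - a) ^ N \<le> br C0 ^ N / br (t - a) ^ N"
proof -
  have "br (t - a) \<le> br (\<tau> - a) * br (t - \<tau>)" using br_add[of "\<tau> - a" "t - \<tau>"] by simp
  also have "\<dots> \<le> br (\<tau> - a) * br C0" using assms by (intro mult_left_mono) (auto simp: br_def)
  finally have "br (t - a) ^ N \<le> (br (\<tau> - a) * br C0) ^ N" by (intro power_mono) auto
  then show ?thesis by (simp add: field_simps power_mult_distrib br_pos)
qed

lemma br_p: "1 / br (p t - a) ^ N \<le> br C0 ^ N * (1 / br (t - a) ^ N)"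
  using br_shift[OF p_near, of t a N] by simp

text \<open>This is the cost of freezing the first argument at a grid corner. The growth in
  \<open>fst z'\<close> stems from the phase of the atom at \<open>z\<close>: its derivative in
  frequency has the size of \<open>t\<close>, and the atom at \<open>z'\<close> keeps
  \<open>t\<close> near \<open>fst z'\<close>.\<close>

lemma errk_lipschitz:
  "\<exists>L\<ge>0. \<forall>z v z'. norm (errk z z' - errk v z') \<le> L * pdist z v * br (fst z')"
proof -
  obtain L where L: "L \<ge> 0" "\<forall>z v t. norm (atom z t - atom v t) \<le> L * pdist z v * br t"
    using atom_lipschitz by blast
  obtain P where P: "P \<ge> 0" "\<And>u. phi u \<le> P / br u ^ 3" using phi_decay by metis
  define K where "K = L * (P + P * br C0 ^ 2) * brint"
  have "norm (errk z z' - errk v z') \<le> K * pdist z v * br (fst z')" for z v z'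
  proof -
    let ?x' = "fst z'" and ?d = "pdist z v"
    have pw: "norm (atom z' \<tau> * cnj (atom z \<tau> - atom v \<tau>)) \<le> L * ?d * br ?x' * P * (1 / br (\<tau> - ?x') ^ 2)" for \<tau>
    proof -
      have "norm (atom z' \<tau> * cnj (atom z \<tau> - atom v \<tau>)) \<le> (P / br (\<tau> - ?x') ^ 3) * (L * ?d * br \<tau>)"
        unfolding norm_mult complex_mod_cnj norm_atom
        by (intro mult_mono P(2) L(2)[rule_format]) (use P(1) in auto)
      also have "\<dots> \<le> (P / br (\<tau> - ?x') ^ 3) * (L * ?d * (br ?x' * br (\<tau> - ?x')))"
        using P(1) L(1) br_add[of ?x' "\<tau> - ?x'"] by (intro mult_left_mono) auto
      also have "\<dots> = L * ?d * br ?x' * P * (1 / br (\<tau> - ?x') ^ 2)"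
        by (simp add: power3_eq_cube power2_eq_square field_simps)
      finally show ?thesis .
    qed
    have "norm (gap_integrand z z' t - gap_integrand v z' t) \<le> L * ?d * br ?x' * (P + P * br C0 ^ 2) * (1 / br (t - ?x') ^ 2)" for t
    proof -
      have "gap_integrand z z' t - gap_integrand v z' t = atom z' t * cnj (atom z t - atom v t) - atom z' (p t) * cnj (atom z (p t) - atom v (p t))"
        unfolding gap_integrand_def by (simp add: algebra_simps)
      then have "norm (gap_integrand z z' t - gap_integrand v z' t) \<le>
          norm (atom z' t * cnj (atom z t - atom v t)) + norm (atom z' (p t) * cnj (atom z (p t) - atom v (p t)))"
        by (metis norm_triangle_ineq4)
      also have "\<dots> \<le> L * ?d * br ?x' * P * (1 / br (t - ?x') ^ 2) + L * ?d * br ?x' * P * (br C0 ^ 2 * (1 / br (t - ?x') ^ 2))"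
        using L(1) P(1) by (intro add_mono pw order_trans[OF pw] mult_left_mono br_p) auto
      also have "\<dots> = L * ?d * br ?x' * (P + P * br C0 ^ 2) * (1 / br (t - ?x') ^ 2)" 
        unfolding distrib_left distrib_right by (simp only: mult_ac)
      finally show ?thesis .
    qed
    then have "norm (LINT t|lborel. gap_integrand z z' t - gap_integrand v z' t)
        \<le> (LINT t|lborel. L * ?d * br ?x' * (P + P * br C0 ^ 2) * (1 / br (t - ?x') ^ 2))"
      by (rule norm_integral_le) (intro integrable_mult_right integrable_br2_shift)
    also have "(LINT t|lborel. gap_integrand z z' t - gap_integrand v z' t) = errk z z' - errk v z'"
      unfolding errk_def by (intro Bochner_Integration.integral_diff integrable_gap_integrand)
    finally show ?thesis
      unfolding integral_mult_right_zero integral_br2_shift K_def by (simp only: mult_ac)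
  qed
  moreover have "0 \<le> K" unfolding K_def using L(1) P(1) brint_nonneg by simp
  ultimately show ?thesis by blast
qed

text \<open>The gain of decay. Put \<open>x = fst z\<close> and
  \<open>T = br x + \<bar>snd z'\<bar>\<close>. The condition on \<open>z\<close> gives
  \<open>slope z z' \<le> T\<close>, and \<open>T \<le> om z' * br (x - fst z')\<close> turns the
  weight of \<open>z'\<close> into \<open>T ^ s\<close> at the expense of off-diagonal decay. One
  \<open>T\<close> cancels; of the other \<open>s - 1\<close> powers, \<open>s - 3\<close> are
  replaced by powers of \<open>br x\<close> and two are integrated over frequency, which leaves one
  factor \<open>1 / br x\<close>. With the three powers from the gap this makes
  \<open>3 + (s - 3) + 1 = s + 1\<close> powers of \<open>br x\<close>, which is comparable to
  \<open>om z\<close>.\<close>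

lemma errk_weight:
  assumes s: "s \<ge> 5"
  shows "\<exists>C\<ge>0. \<forall>z. \<bar>snd z\<bar> \<le> \<bar>fst z\<bar> \<longrightarrow> integrable lborel (\<lambda>z'. norm (errk z z') * (1 / om z' ^ s)) \<and>
     (LINT z'|lborel. norm (errk z z') * (1 / om z' ^ s)) \<le> C * (1 / om z ^ (s + 1))"
proof -
  obtain K where K: "K \<ge> 0" "\<forall>z z'. norm (errk z z') \<le> K * slope z z' / (br (fst z) ^ 3 * br (fst z - fst z') ^ (s + 2))"
    using errk_bound by blast
  define C where "C = K * brint * brint * 2 ^ (s + 1)"
  have C: "0 \<le> C" unfolding C_def using K(1) brint_nonneg by simp
  have "integrable lborel (\<lambda>z'. norm (errk z z') * (1 / om z' ^ s)) \<and>
     (LINT z'|lborel. norm (errk z z') * (1 / om z' ^ s)) \<le> C * (1 / om z ^ (s + 1))" if z: "\<bar>snd z\<bar> \<le> \<bar>fst z\<bar>" for z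
  proof -
    let ?x = "fst z"
    define g where "g z' = (K / br ?x ^ s) * ((1 / br (fst z' - ?x) ^ 2) * (1 / (br ?x + \<bar>snd z'\<bar>) ^ 2))" for z'
    have gi: "integrable lborel g" "(LINT z'|lborel. g z') = K / br ?x ^ s * (brint * (brint / br ?x))"
      unfolding g_def[abs_def] integral_mult_right_zero
        integrable_product(2)[OF integrable_br2_shift[of ?x] scaled_br2(1)[OF br_pos[of ?x]]]
        integral_br2_shift scaled_br2(2)[OF br_pos]
      by (intro integrable_mult_right integrable_product integrable_br2_shift scaled_br2 br_pos) (rule refl)
    have le: "norm (errk z z') * (1 / om z' ^ s) \<le> g z'" for z'
    proof -
      let ?T = "br ?x + \<bar>snd z'\<bar>" and ?d = "br (?x - fst z')"
      have T0: "0 < ?T" using br_pos[of ?x] by linarith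
      have "slope z z' \<le> ?T" using z by (simp add: slope_def br_def)
      moreover have "1 / om z' ^ s \<le> ?d ^ s / ?T ^ s"
      proof -
        have "?T \<le> om z' * ?d"
        proof -
          have "om z' * ?d = om z' + om z' * \<bar>?x - fst z'\<bar>" by (simp add: br_def algebra_simps)
          moreover have "1 * \<bar>?x - fst z'\<bar> \<le> om z' * \<bar>?x - fst z'\<bar>" by (intro mult_right_mono om_ge1) simp
          ultimately have "om z' + \<bar>?x - fst z'\<bar> \<le> om z' * ?d"
            by (simp only: mult_1 add_le_cancel_left)
          then show ?thesis unfolding br_def[of ?x] om_def[of z'] by linarith
        qed
        then have "?T ^ s \<le> (om z' * ?d) ^ s" using T0 by (intro power_mono) auto
        then show ?thesis using T0 by (simp add: power_mult_distrib field_simps om_pos)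
      qed
      ultimately have "norm (errk z z') * (1 / om z' ^ s) \<le> (K * ?T / (br ?x ^ 3 * ?d ^ (s + 2))) * (?d ^ s / ?T ^ s)"
        using K(1) T0 by (intro mult_mono order_trans[OF K(2)[rule_format]] divide_right_mono mult_left_mono) auto
      also have "\<dots> = K / (br ?x ^ 3 * ?d ^ 2 * ?T ^ (s - 1))"
      proof -
        have cancel: "A \<noteq> 0 \<Longrightarrow> T \<noteq> 0 \<Longrightarrow> (K * T / (b * (A * e))) * (A / (X * T)) = K / (b * e * X)" for A T b e X :: real
          by simp
        have "?T ^ s = ?T ^ (s - 1) * ?T" using s by (simp flip: power_Suc2)
        then show ?thesis unfolding power_add[of ?d s 2] using T0 by (simp only:) (rule cancel, auto)
      qed
      also have "\<dots> \<le> K / (br ?x ^ 3 * ?d ^ 2 * (br ?x ^ (s - 3) * ?T ^ 2))"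
      proof (intro divide_left_mono mult_left_mono mult_pos_pos)
        have "br ?x ^ (s - 3) * ?T ^ 2 \<le> ?T ^ (s - 3) * ?T ^ 2"
          by (intro mult_right_mono power_mono) auto
        also have "\<dots> = ?T ^ (s - 3 + 2)" by (rule power_add[symmetric])
        also have "s - 3 + 2 = s - 1" using s by simp
        finally show "br ?x ^ (s - 3) * ?T ^ 2 \<le> ?T ^ (s - 1)" .
      qed (use K(1) T0 in \<open>auto simp: br_pos\<close>)
      also have "br ?x ^ 3 * ?d ^ 2 * (br ?x ^ (s - 3) * ?T ^ 2) = br ?x ^ s * (?d ^ 2 * ?T ^ 2)"
      proof -
        have "br ?x ^ s = br ?x ^ 3 * br ?x ^ (s - 3)" using s by (simp flip: power_add)
        then show ?thesis by (simp only: mult_ac)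
      qed
      also have "?d = br (fst z' - ?x)" using br_neg[of "fst z' - ?x"] by simp
      finally show ?thesis unfolding g_def by simp
    qed
    have "integrable lborel (\<lambda>z'. norm (errk z z') * (1 / om z' ^ s))"
    proof (rule Bochner_Integration.integrable_bound[OF gi(1)])
      show "AE z' in lborel. norm (norm (errk z z') * (1 / om z' ^ s)) \<le> norm (g z')"
      proof (intro AE_I2)
        fix z'
        have "0 \<le> norm (errk z z') * (1 / om z' ^ s)" by simp
        then show "norm (norm (errk z z') * (1 / om z' ^ s)) \<le> norm (g z')"
          using le[of z'] unfolding real_norm_def by linarith
      qed
    qed measurable
    moreover have "(LINT z'|lborel. norm (errk z z') * (1 / om z' ^ s)) \<le> (LINT z'|lborel. g z')"
      by (rule integral_mono[OF calculation gi(1) le])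
    moreover have "(LINT z'|lborel. g z') \<le> C * (1 / om z ^ (s + 1))"
    proof -
      have "om z \<le> 2 * br ?x" using z by (simp add: om_def br_def)
      then have "om z ^ (s + 1) \<le> 2 ^ (s + 1) * br ?x ^ (s + 1)"
        unfolding power_mult_distrib[symmetric] by (intro power_mono) auto
      then have "1 / br ?x ^ (s + 1) \<le> 2 ^ (s + 1) * (1 / om z ^ (s + 1))"
        by (simp add: field_simps br_pos om_pos)
      then have "(K * brint * brint) * (1 / br ?x ^ (s + 1)) \<le> (K * brint * brint) * (2 ^ (s + 1) * (1 / om z ^ (s + 1)))"
        using K(1) brint_nonneg by (intro mult_left_mono) auto
      then show ?thesis unfolding gi(2) C_def by (simp add: mult_ac)
    qed
    ultimately show ?thesis by linarith
  qed
  then show ?thesis using C by blast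
qed

section \<open>The sampling identity and the summability of samples\<close>

lemma integrable_sampled:
  assumes "F \<in> borel_measurable borel" "\<And>t. norm (F t) \<le> A / br (t - a) ^ 2"
  shows "integrable lborel (\<lambda>t. F (p t) :: complex)"
proof -
  note [measurable] = assms(1)
  have A: "0 \<le> A" using order_trans[OF norm_ge_zero assms(2)[of a]] by (simp add: br_def)
  show ?thesis
  proof (rule Bochner_Integration.integrable_bound[OF integrable_mult_right[OF integrable_br2_shift]])
    show "AE t in lborel. norm (F (p t)) \<le> norm (A * br C0 ^ 2 * (1 / br (t - a) ^ 2))"
    proof (intro AE_I2)
      fix t
      have "norm (F (p t)) \<le> A * (1 / br (p t - a) ^ 2)" using assms(2)[of "p t"] by simp
      also have "\<dots> \<le> A * (br C0 ^ 2 * (1 / br (t - a) ^ 2))" by (intro mult_left_mono br_p A)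
      finally show "norm (F (p t)) \<le> norm (A * br C0 ^ 2 * (1 / br (t - a) ^ 2))"
        using A by simp
    qed
  qed measurable
qed

text \<open>For a single atom this is the definition of \<open>errk\<close>. A superposition of
  atoms follows by Fubini, since \<open>gap_integrand\<close> is dominated, uniformly in
  \<open>z'\<close>, by an integrable function of \<open>t\<close>.\<close>

lemma sampling_identity:
  assumes U: "rapid U" and f: "f = synth U"
  shows "stft f z - (LINT t|lborel. f (p t) * cnj (atom z (p t))) = (LINT z'|lborel. errk z z' * U z')"
proof -
  have [measurable]: "U \<in> borel_measurable borel" using U by (simp add: rapid_def)
  have fS: "f \<in> schwartz_space" unfolding f by (rule synth_schwartz[OF U])
  note [measurable] = sch_measurable[OF fS]
  obtain M where M: "M \<ge> 0" "\<And>z. norm (U z) \<le> M / om z ^ 4" using rapid_bound[OF U] by metis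
  have Ui: "integrable lborel U" by (rule integrable_om_bound[OF _ M(2)]) simp
  obtain P where P: "P \<ge> 0" "\<And>u. phi u \<le> P / br u ^ 2" using phi_decay by metis
  obtain Q where Q: "Q \<ge> 0" "\<And>u. phi u \<le> Q / br u ^ 0" using phi_decay by metis
  obtain A where A: "A \<ge> 0" "\<And>t. norm (f t) \<le> A / br t ^ 0" using sch_decay0[OF fS] by metis
  have bd1: "norm (f t * cnj (atom z t)) \<le> (A * P) / br (t - fst z) ^ 2" for t
    unfolding norm_mult complex_mod_cnj norm_atom using mult_mono[OF A(2)[of t] P(2)[of "t - fst z"]] A(1) by simp
  have i1: "integrable lborel (\<lambda>t. f t * cnj (atom z t))"
  proof (rule Bochner_Integration.integrable_bound[OF integrable_mult_right[OF integrable_br2_shift[of "fst z"], of "A * P"]])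
    show "AE t in lborel. norm (f t * cnj (atom z t)) \<le> norm (A * P * (1 / br (t - fst z) ^ 2))"
      unfolding real_norm_def times_divide_eq_right mult_1_right
      by (intro AE_I2 order_trans[OF bd1 abs_ge_self])
  qed measurable
  have i2: "integrable lborel (\<lambda>t. f (p t) * cnj (atom z (p t)))"
    using integrable_sampled[where F = "\<lambda>t. f t * cnj (atom z t)", OF _ bd1] by simp
  define G where "G = Q * P * (1 + br C0 ^ 2)"
  have G: "norm (gap_integrand z z' t) \<le> G * (1 / br (t - fst z) ^ 2)" for z' t
  proof -
    have a: "norm (atom z' \<tau> * cnj (atom z \<tau>)) \<le> Q * (P * (1 / br (\<tau> - fst z) ^ 2))" for \<tau>
      unfolding norm_mult complex_mod_cnj norm_atom using P(2)[of "\<tau> - fst z"] Q(2)[of "\<tau> - fst z'"] Q(1)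
      by (intro mult_mono) auto
    have "norm (gap_integrand z z' t) \<le> norm (atom z' t * cnj (atom z t)) + norm (atom z' (p t) * cnj (atom z (p t)))"
      unfolding gap_integrand_def by (rule norm_triangle_ineq4)
    also have "\<dots> \<le> Q * (P * (1 / br (t - fst z) ^ 2)) + Q * (P * (br C0 ^ 2 * (1 / br (t - fst z) ^ 2)))"
      using P(1) Q(1) by (intro add_mono a order_trans[OF a] mult_left_mono br_p) auto
    also have "\<dots> = G * (1 / br (t - fst z) ^ 2)" unfolding G_def distrib_left distrib_right mult_1_right by (simp only: mult_ac)
    finally show ?thesis .
  qed
  have G0: "0 \<le> G" unfolding G_def using P(1) Q(1) by simp
  have *: "integrable (lborel \<Otimes>\<^sub>M lborel) (\<lambda>(z', t). gap_integrand z z' t * U z')"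
  proof (rule lborel_pair.Fubini_integrable)
    have le: "(LINT t|lborel. norm (gap_integrand z z' t)) \<le> G * brint" for z'
    proof -
      have "(LINT t|lborel. norm (gap_integrand z z' t)) \<le> (LINT t|lborel. G * (1 / br (t - fst z) ^ 2))"
        by (intro integral_mono G integrable_norm integrable_gap_integrand integrable_mult_right integrable_br2_shift)
      then show ?thesis by (simp only: integral_mult_right_zero integral_br2_shift)
    qed
    have "integrable lborel (\<lambda>z'. (LINT t|lborel. norm (gap_integrand z z' t)) * norm (U z'))"
    proof (rule Bochner_Integration.integrable_bound[OF integrable_mult_right[OF integrable_norm[OF Ui], of "G * brint"]])
      show "AE z' in lborel. norm ((LINT t|lborel. norm (gap_integrand z z' t)) * norm (U z')) \<le> norm (G * brint * norm (U z'))"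
      proof (intro AE_I2)
        fix z'
        have "0 \<le> (LINT t|lborel. norm (gap_integrand z z' t))" by (rule integral_nonneg_AE) simp
        then have "\<bar>LINT t|lborel. norm (gap_integrand z z' t)\<bar> \<le> \<bar>G * brint\<bar>"
          using le[of z'] by linarith
        then show "norm ((LINT t|lborel. norm (gap_integrand z z' t)) * norm (U z')) \<le> norm (G * brint * norm (U z'))"
          unfolding real_norm_def abs_mult[of _ "norm (U z')"] by (intro mult_right_mono) auto
      qed
    qed measurable
    then show "integrable lborel (\<lambda>z'. LINT t|lborel. norm (case (z', t) of (z', t) \<Rightarrow> gap_integrand z z' t * U z'))"
      unfolding prod.case norm_mult integral_mult_left_zero .
    show "AE z' in lborel. integrable lborel (\<lambda>t. case (z', t) of (z', t) \<Rightarrow> gap_integrand z z' t * U z')"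
      unfolding prod.case by (intro AE_I2 integrable_mult_left integrable_gap_integrand)
  qed measurable
  have at: "integrable lborel (\<lambda>z'. U z' * atom z' t)" for t
  proof (rule Bochner_Integration.integrable_bound[OF integrable_mult_right[OF integrable_norm[OF Ui], of Q]])
    show "AE z' in lborel. norm (U z' * atom z' t) \<le> norm (Q * norm (U z'))"
    proof (intro AE_I2)
      fix z' show "norm (U z' * atom z' t) \<le> norm (Q * norm (U z'))"
        using mult_right_mono[OF Q(2)[of "t - fst z'"], of "norm (U z')"] Q(1) by (simp add: norm_mult mult.commute)
    qed
  qed measurable
  have "(LINT z'|lborel. errk z z' * U z') = (LINT z'|lborel. LINT t|lborel. gap_integrand z z' t * U z')"
    unfolding errk_def integral_mult_left_zero ..
  also have "\<dots> = (LINT t|lborel. LINT z'|lborel. gap_integrand z z' t * U z')"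
    by (rule lborel_pair.Fubini_integral[OF *, symmetric])
  also have "\<dots> = (LINT t|lborel. f t * cnj (atom z t) - f (p t) * cnj (atom z (p t)))"
  proof (intro Bochner_Integration.integral_cong refl)
    fix t
    have "(LINT z'|lborel. gap_integrand z z' t * U z') = (LINT z'|lborel. (U z' * atom z' t) * cnj (atom z t) - (U z' * atom z' (p t)) * cnj (atom z (p t)))"
      unfolding gap_integrand_def by (intro Bochner_Integration.integral_cong refl) (simp add: algebra_simps)
    also have "\<dots> = (LINT z'|lborel. (U z' * atom z' t) * cnj (atom z t)) - (LINT z'|lborel. (U z' * atom z' (p t)) * cnj (atom z (p t)))"
      by (intro Bochner_Integration.integral_diff integrable_mult_left at)
    also have "\<dots> = f t * cnj (atom z t) - f (p t) * cnj (atom z (p t))"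
      unfolding f synth_def by (simp only: integral_mult_left_zero)
    finally show "(LINT z'|lborel. gap_integrand z z' t * U z') = f t * cnj (atom z t) - f (p t) * cnj (atom z (p t))" .
  qed
  also have "\<dots> = stft f z - (LINT t|lborel. f (p t) * cnj (atom z (p t)))"
    unfolding stft_def by (rule Bochner_Integration.integral_diff[OF i1 i2])
  finally show ?thesis ..
qed

lemma sampled_sum:
  assumes f: "f \<in> schwartz_space"
  shows "(LINT t|lborel. f (p t) * cnj (atom z (p t))) = (\<Sum>\<^sub>\<infinity>n. f (x n) * (of_real (w n) * cnj (atom z (x n))))"
proof -
  note [measurable] = sch_measurable[OF f]
  obtain P where P: "P \<ge> 0" "\<And>u. phi u \<le> P / br u ^ 2" using phi_decay by metis
  obtain A where A: "A \<ge> 0" "\<And>t. norm (f t) \<le> A / br t ^ 0" using sch_decay0[OF f] by metis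
  have bd1: "norm (f t * cnj (atom z t)) \<le> (A * P) / br (t - fst z) ^ 2" for t
    unfolding norm_mult complex_mod_cnj norm_atom using mult_mono[OF A(2)[of t] P(2)[of "t - fst z"]] A(1) by simp
  have "integrable lborel (\<lambda>t. f (x (idx t)) * cnj (atom z (x (idx t))))"
    using integrable_sampled[where F = "\<lambda>t. f t * cnj (atom z t)", OF _ bd1] by (simp add: p_def)
  from integral_idx(2)[where F = "\<lambda>n. f (x n) * cnj (atom z (x n))", OF this]
  show ?thesis by (simp add: p_def scaleR_conv_of_real mult_ac)
qed

text \<open>The series is the integral of a step function of rapid decay. The factor
  \<open>w n\<close> compensates for nodes that lie arbitrarily close together; in the
  reconstruction it is supplied by the functions \<open>samp i\<close>.\<close>

lemma samples_summable:
  assumes f: "f \<in> schwartz_space"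
  shows "(\<lambda>n. norm (f (x n)) * (w n * br (x n) ^ M)) summable_on UNIV"
proof -
  note [measurable] = sch_measurable[OF f]
  obtain A where A: "A \<ge> 0" "\<And>t. norm (f t) \<le> A / br t ^ (M + 2)" using sch_decay0[OF f] by metis
  have "norm (f t * of_real (br t ^ M)) \<le> A / br (t - 0) ^ 2" for t
  proof -
    have "norm (f t * of_real (br t ^ M)) \<le> A / br t ^ (M + 2) * br t ^ M"
      unfolding norm_mult norm_of_real abs_of_nonneg[OF weight_nonneg(2)] by (intro mult_right_mono A(2)) simp
    then show ?thesis by (simp add: power_add power2_eq_square)
  qed
  from integrable_sampled[where F = "\<lambda>t. f t * of_real (br t ^ M)", OF _ this]
  have "integrable lborel (\<lambda>t. f (x (idx t)) * of_real (br (x (idx t)) ^ M))" by (simp add: p_def)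
  from integral_idx(1)[where F = "\<lambda>n. f (x n) * of_real (br (x n) ^ M)", OF this]
  show ?thesis
    by (rule summable_on_cong[THEN iffD1, rotated]) (simp add: norm_mult norm_power abs_of_nonneg w_nonneg)
qed

end

section \<open>Neumann series for kernels that gain decay\<close>

text \<open>Contraction is asked in the weight of exponent 5 alone; in the other weights the gain
  comes with an arbitrary constant. Exponent 5 still leaves 4 powers for integrability when one is
  lost to the growth of the kernel in \<open>z'\<close>.\<close>

locale gaining_kernel =
  fixes G :: "real \<times> real \<Rightarrow> real \<times> real \<Rightarrow> complex"
  assumes G_measurable: "case_prod G \<in> borel_measurable (borel \<Otimes>\<^sub>M borel)"
    and G_integrable: "s \<ge> 5 \<Longrightarrow> integrable lborel (\<lambda>z'. norm (G z z') * (1 / om z' ^ s))"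
    and G_gain: "s \<ge> 5 \<Longrightarrow> \<exists>C\<ge>0. \<forall>z. (LINT z'|lborel. norm (G z z') * (1 / om z' ^ s)) \<le> C * (1 / om z ^ (s + 1))"
    and G_half: "(LINT z'|lborel. norm (G z z') * (1 / om z' ^ 5)) \<le> 1 / 2 * (1 / om z ^ 5)"
begin

lemma G_measurable2 [measurable]:
  assumes [measurable]: "f \<in> borel_measurable M" "g \<in> borel_measurable M"
  shows "(\<lambda>v. G (f v) (g v)) \<in> borel_measurable M"
  using measurable_compose[OF measurable_Pair[OF assms] G_measurable] by simp

definition op where "op U z = (LINT z'|lborel. G z z' * U z')"

lemma op_measurable [measurable]:
  assumes [measurable]: "U \<in> borel_measurable borel"
  shows "op U \<in> borel_measurable borel"
  unfolding op_def[abs_def] by measurable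

lemma op_integrable:
  assumes [measurable]: "U \<in> borel_measurable borel" and U: "\<And>z. norm (U z) \<le> M * (1 / om z ^ s)" and s: "s \<ge> 5"
  shows "integrable lborel (\<lambda>z'. G z z' * U z')"
proof (rule Bochner_Integration.integrable_bound[OF integrable_mult_right[OF G_integrable[OF s, of z], of M]])
  show "AE z' in lborel. norm (G z z' * U z') \<le> norm (M * (norm (G z z') * (1 / om z' ^ s)))"
  proof (intro AE_I2)
    fix z'
    have "norm (G z z' * U z') \<le> norm (G z z') * (M * (1 / om z' ^ s))"
      unfolding norm_mult by (intro mult_left_mono U) auto
    also have "\<dots> = M * (norm (G z z') * (1 / om z' ^ s))" by (simp only: mult_ac)
    finally show "norm (G z z' * U z') \<le> norm (M * (norm (G z z') * (1 / om z' ^ s)))"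
      unfolding real_norm_def by linarith
  qed
qed measurable

lemma op_bound:
  assumes U: "\<And>z. norm (U z) \<le> M * (1 / om z ^ s)" and s: "s \<ge> 5"
  shows "norm (op U z) \<le> M * (LINT z'|lborel. norm (G z z') * (1 / om z' ^ s))"
proof -
  have "norm (op U z) \<le> (LINT z'|lborel. M * (norm (G z z') * (1 / om z' ^ s)))"
    unfolding op_def
  proof (rule norm_integral_le)
    fix z'
    have "norm (G z z' * U z') \<le> norm (G z z') * (M * (1 / om z' ^ s))"
      unfolding norm_mult by (intro mult_left_mono U) auto
    also have "\<dots> = M * (norm (G z z') * (1 / om z' ^ s))" by (simp only: mult_ac)
    finally show "norm (G z z' * U z') \<le> M * (norm (G z z') * (1 / om z' ^ s))" .
  qed (intro integrable_mult_right G_integrable s)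
  then show ?thesis by (simp only: integral_mult_right_zero)
qed

lemma bound_nonneg:
  fixes U :: "real \<times> real \<Rightarrow> complex"
  assumes U: "\<And>z. norm (U z) \<le> M * (1 / om z ^ s)" shows "0 \<le> M"
  using order_trans[OF norm_ge_zero U[of 0]] by (simp add: om_def)

lemma op_half:
  assumes U: "\<And>z. norm (U z) \<le> M * (1 / om z ^ 5)"
  shows "norm (op U z) \<le> (M / 2) * (1 / om z ^ 5)"
proof -
  have "norm (op U z) \<le> M * (1 / 2 * (1 / om z ^ 5))"
    by (rule order_trans[OF op_bound[OF U order_refl] mult_left_mono[OF G_half bound_nonneg[OF U]]])
  then show ?thesis by simp
qed

text \<open>The series converges geometrically in the weight of exponent 5, whence the factor 2.
  Faster decay of the solution is not read off from the series but from the equation, in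
  \<open>neumann_bootstrap\<close>.\<close>

lemma neumann_exists:
  assumes V [measurable]: "V \<in> borel_measurable borel" and Vb: "\<And>z. norm (V z) \<le> M * (1 / om z ^ 5)"
  shows "\<exists>W. W \<in> borel_measurable borel \<and> (\<forall>z. W z = V z + op W z) \<and> (\<forall>z. norm (W z) \<le> 2 * M * (1 / om z ^ 5))"
proof -
  define u where "u k = (op ^^ k) V" for k
  have um [measurable]: "u k \<in> borel_measurable borel" for k
    by (induction k) (auto simp: u_def)
  have ub: "norm (u k z) \<le> (M * (1 / 2) ^ k) * (1 / om z ^ 5)" for k z
  proof (induction k arbitrary: z)
    case (Suc k)
    show ?case using op_half[of "u k", OF Suc.IH, of z] by (simp add: u_def)
  qed (use Vb in \<open>simp add: u_def\<close>)
  have sm: "summable (\<lambda>k. norm (u k z))" for z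
  proof (rule summable_comparison_test'[where g = "\<lambda>k. (M * (1 / 2) ^ k) * (1 / om z ^ 5)"])
    show "summable (\<lambda>k. (M * (1 / 2) ^ k) * (1 / om z ^ 5))"
      by (intro summable_mult2 summable_mult summable_geometric) simp
    show "norm (norm (u k z)) \<le> (M * (1 / 2) ^ k) * (1 / om z ^ 5)" for k
      unfolding real_norm_def abs_norm_cancel by (rule ub)
  qed
  define W where "W z = (\<Sum>k. u k z)" for z
  have Wm: "W \<in> borel_measurable borel" unfolding W_def[abs_def] by measurable
  have Wb: "norm (W z) \<le> 2 * M * (1 / om z ^ 5)" for z
  proof -
    have "norm (W z) \<le> (\<Sum>k. norm (u k z))" unfolding W_def by (rule summable_norm[OF sm])
    also have "\<dots> \<le> (\<Sum>k. (M * (1 / 2) ^ k) * (1 / om z ^ 5))"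
      by (intro suminf_le ub sm summable_mult2 summable_mult summable_geometric) simp
    also have "\<dots> = (M * (\<Sum>k. (1 / 2) ^ k)) * (1 / om z ^ 5)"
      by (subst suminf_mult2[symmetric], intro summable_mult summable_geometric, simp,
          subst suminf_mult, intro summable_geometric, simp_all)
    also have "(\<Sum>k. (1 / 2 :: real) ^ k) = 2" by (subst suminf_geometric) auto
    finally show ?thesis by (simp add: mult.commute)
  qed
  have "W z = V z + op W z" for z
  proof -
    have M0: "0 \<le> M" by (rule bound_nonneg[OF Vb])
    have ui: "integrable lborel (\<lambda>z'. G z z' * u k z')" for k
      by (rule op_integrable[OF um ub order_refl])
    let ?J = "LINT z'|lborel. norm (G z z') * (1 / om z' ^ 5)"
    have nb: "(LINT z'|lborel. norm (G z z' * u k z')) \<le> (M * (1 / 2) ^ k) * ?J" for k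
    proof -
      have "(LINT z'|lborel. norm (G z z' * u k z')) \<le> (LINT z'|lborel. (M * (1 / 2) ^ k) * (norm (G z z') * (1 / om z' ^ 5)))"
      proof (intro integral_mono integrable_norm ui integrable_mult_right G_integrable order_refl)
        fix z'
        have "norm (G z z') * norm (u k z') \<le> norm (G z z') * ((M * (1 / 2) ^ k) * (1 / om z' ^ 5))"
          by (intro mult_left_mono ub) simp
        then show "norm (G z z' * u k z') \<le> (M * (1 / 2) ^ k) * (norm (G z z') * (1 / om z' ^ 5))"
          by (simp only: norm_mult mult_ac)
      qed
      then show ?thesis by (simp only: integral_mult_right_zero)
    qed
    have "op W z = (LINT z'|lborel. (\<Sum>k. G z z' * u k z'))"
      unfolding op_def W_def using summable_norm_cancel[OF sm] by (simp add: suminf_mult)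
    also have "\<dots> = (\<Sum>k. (LINT z'|lborel. G z z' * u k z'))"
    proof (rule integral_suminf[OF ui])
      show "AE z' in lborel. summable (\<lambda>k. norm (G z z' * u k z'))"
        unfolding norm_mult by (intro AE_I2 summable_mult sm)
      show "summable (\<lambda>k. LINT z'|lborel. norm (G z z' * u k z'))"
      proof (rule summable_comparison_test'[of "\<lambda>k. (M * (1 / 2) ^ k) * ?J"])
        show "summable (\<lambda>k. (M * (1 / 2) ^ k) * ?J)"
          by (intro summable_mult2 summable_mult summable_geometric) simp
        show "norm (LINT z'|lborel. norm (G z z' * u k z')) \<le> (M * (1 / 2) ^ k) * ?J" for k
          using nb[of k] by (simp add: integral_nonneg_AE)
      qed
    qed
    also have "\<dots> = (\<Sum>k. u (Suc k) z)" by (simp add: u_def op_def)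
    also have "\<dots> = W z - V z"
      unfolding W_def using suminf_split_head[OF summable_norm_cancel[OF sm, of z]] by (simp add: u_def)
    finally show ?thesis by simp
  qed
  then show ?thesis using Wm Wb by blast
qed

text \<open>Each use of the equation halves the contribution of \<open>M\<close>, so in the limit
  only \<open>r\<close> matters. Nothing but the existence of \<open>M\<close> enters the final
  bound.\<close>

lemma neumann_estimate:
  assumes D: "\<And>z. D z = r z + op D z" and b: "\<And>z. norm (D z) \<le> M * (1 / om z ^ 5)"
    and r: "\<And>z. norm (r z) \<le> e * (1 / om z ^ 5)"
  shows "norm (D z) \<le> 2 * e * (1 / om z ^ 5)"
proof -
  have a: "norm (D z) \<le> (2 * e + M * (1 / 2) ^ k) * (1 / om z ^ 5)" for k z
  proof (induction k arbitrary: z)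
    case 0
    have "0 \<le> e" by (rule bound_nonneg[OF r])
    then have "M * (1 / om z ^ 5) \<le> (2 * e + M * (1 / 2) ^ 0) * (1 / om z ^ 5)"
      by (intro mult_right_mono) auto
    then show ?case using b[of z] by (rule order_trans[rotated])
  next
    case (Suc k)
    have "norm (D z) \<le> norm (r z) + norm (op D z)" using D[of z] norm_triangle_ineq by metis
    also have "\<dots> \<le> e * (1 / om z ^ 5) + ((2 * e + M * (1 / 2) ^ k) / 2) * (1 / om z ^ 5)"
      by (intro add_mono r op_half Suc.IH)
    also have "\<dots> = (2 * e + M * (1 / 2) ^ Suc k) * (1 / om z ^ 5)"
      unfolding distrib_right[symmetric] by simp
    finally show ?case .
  qed
  have lim: "(\<lambda>k. (2 * e + M * (1 / 2) ^ k) * (1 / om z ^ 5)) \<longlonglongrightarrow> (2 * e + M * 0) * (1 / om z ^ 5)"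
    by (intro tendsto_mult_right tendsto_add tendsto_const tendsto_mult_left LIMSEQ_realpow_zero) auto
  have "norm (D z) \<le> (2 * e + M * 0) * (1 / om z ^ 5)"
    by (rule LIMSEQ_le_const[OF lim]) (use a in blast)
  then show ?thesis by simp
qed

text \<open>In \<open>W = V + op W\<close> the operator gains a power, so the decay of
  \<open>W\<close> improves one power at a time as long as that of \<open>V\<close> permits. The
  constant depends on the order \<open>n\<close> only.\<close>

lemma neumann_bootstrap:
  "\<exists>K\<ge>0. \<forall>V W M. (\<forall>z. norm (V z) \<le> M * (1 / om z ^ (5 + n))) \<longrightarrow> (\<forall>z. W z = V z + op W z)
     \<longrightarrow> (\<forall>z. norm (W z) \<le> 2 * M * (1 / om z ^ 5)) \<longrightarrow> (\<forall>z. norm (W z) \<le> K * M * (1 / om z ^ (5 + n)))"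
proof (induction n)
  case 0
  show ?case by (rule exI[of _ 2]) simp
next
  case (Suc n)
  then obtain K where K: "K \<ge> 0" "\<forall>V W M. (\<forall>z. norm (V z) \<le> M * (1 / om z ^ (5 + n))) \<longrightarrow> (\<forall>z. W z = V z + op W z)
     \<longrightarrow> (\<forall>z. norm (W z) \<le> 2 * M * (1 / om z ^ 5)) \<longrightarrow> (\<forall>z. norm (W z) \<le> K * M * (1 / om z ^ (5 + n)))" by blast
  have "5 \<le> 5 + n" by simp
  from G_gain[OF this] obtain C where C: "C \<ge> 0"
    "\<forall>z. (LINT z'|lborel. norm (G z z') * (1 / om z' ^ (5 + n))) \<le> C * (1 / om z ^ (5 + n + 1))" by blast
  have "norm (W z) \<le> (1 + K * C) * M * (1 / om z ^ (5 + Suc n))"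
    if V: "\<forall>z. norm (V z) \<le> M * (1 / om z ^ (5 + Suc n))" and W: "\<forall>z. W z = V z + op W z"
      and Wb: "\<forall>z. norm (W z) \<le> 2 * M * (1 / om z ^ 5)" for V W M z
  proof -
    have M: "0 \<le> M" using V by (intro bound_nonneg[of V M "5 + Suc n"]) blast
    have "norm (V z) \<le> M * (1 / om z ^ (5 + n))" for z
    proof (rule order_trans[OF V[rule_format]])
      show "M * (1 / om z ^ (5 + Suc n)) \<le> M * (1 / om z ^ (5 + n))"
        by (intro mult_left_mono divide_left_mono power_increasing om_ge1 mult_pos_pos om_power_pos M) auto
    qed
    then have b: "norm (W z) \<le> K * M * (1 / om z ^ (5 + n))" for z using K(2) W Wb by blast
    have "norm (op W z) \<le> (K * M) * (LINT z'|lborel. norm (G z z') * (1 / om z' ^ (5 + n)))"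
      by (rule op_bound[OF b]) simp
    also have "\<dots> \<le> (K * M) * (C * (1 / om z ^ (5 + n + 1)))"
      using K(1) M by (intro mult_left_mono C(2)[rule_format]) auto
    finally have "norm (op W z) \<le> (K * M) * (C * (1 / om z ^ (5 + Suc n)))" by simp
    moreover have "norm (W z) \<le> norm (V z) + norm (op W z)" using W norm_triangle_ineq by metis
    ultimately have "norm (W z) \<le> M * (1 / om z ^ (5 + Suc n)) + (K * M) * (C * (1 / om z ^ (5 + Suc n)))"
      using V[rule_format, of z] by linarith
    also have "\<dots> = (1 + K * C) * M * (1 / om z ^ (5 + Suc n))" unfolding distrib_right mult_1 by (simp only: mult_ac)
    finally show ?thesis .
  qed
  then show ?case using K(1) C(1) by (intro exI[of _ "1 + K * C"] conjI) (simp, blast)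
qed

end

context sampling begin

lemma errk_weight_integrable:
  assumes s: "s \<ge> 5"
  shows "integrable lborel (\<lambda>z'. norm (errk v z') * (1 / om z' ^ s))"
proof -
  obtain K where K: "K \<ge> 0" "\<forall>z z'. norm (errk z z') \<le> K * slope z z' / (br (fst z) ^ 3 * br (fst z - fst z') ^ 0)"
    using errk_bound by blast
  show ?thesis
  proof (rule Bochner_Integration.integrable_bound[OF integrable_mult_right[OF integrable_om[of "s - 1"], of "K * br (snd v)"]])
    show "AE z' in lborel. norm (norm (errk v z') * (1 / om z' ^ s)) \<le> norm (K * br (snd v) * (1 / om z' ^ (s - 1)))"
    proof (intro AE_I2)
      fix z'
      have "slope v z' \<le> br (snd v) * om z'"
      proof -
        have "\<bar>snd v\<bar> * 1 \<le> \<bar>snd v\<bar> * om z'" by (intro mult_left_mono om_ge1) simp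
        then show ?thesis unfolding br_def distrib_right mult_1 slope_def using br_snd_le_om[of z'] by (simp add: br_def)
      qed
      then have "K * slope v z' / (br (fst v) ^ 3 * br (fst v - fst z') ^ 0) \<le> K * (br (snd v) * om z') / 1"
        using K(1) br_power_ge1[of "fst v" 3] by (intro frac_le mult_left_mono) auto
      then have "norm (errk v z') \<le> K * (br (snd v) * om z')"
        using K(2)[rule_format, of v z'] by simp
      then have "norm (errk v z') * (1 / om z' ^ s) \<le> K * (br (snd v) * om z') * (1 / om z' ^ s)"
        by (intro mult_right_mono) auto
      also have "\<dots> = K * br (snd v) * (1 / om z' ^ (s - 1))"
      proof -
        have "s = Suc (s - 1)" using s by simp
        then have "om z' ^ s = om z' * om z' ^ (s - 1)" by (metis power_Suc)
        then show ?thesis by simp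
      qed
      finally show "norm (norm (errk v z') * (1 / om z' ^ s)) \<le> norm (K * br (snd v) * (1 / om z' ^ (s - 1)))"
        unfolding real_norm_def using abs_ge_self[of "K * br (snd v) * (1 / om z' ^ (s - 1))"] by simp
    qed
  qed (use s in auto)
qed

end

section \<open>Linearity of synthesis and sums over a disjoint union\<close>

lemma synth_linear:
  assumes U: "rapid U" and V: "\<And>i. i \<in> I \<Longrightarrow> rapid (V i)"
  shows "synth (\<lambda>z. U z - (\<Sum>i\<in>I. c i * V i z)) t = synth U t - (\<Sum>i\<in>I. c i * synth (V i) t)"
proof -
  have i: "integrable lborel (\<lambda>z. U z * atom z t)" if U: "rapid U" for U
  proof -
    have [measurable]: "U \<in> borel_measurable borel" using U by (simp add: rapid_def)
    obtain M where M: "\<And>z. norm (U z) \<le> M / om z ^ 4" using rapid_bound[OF U] by metis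
    obtain P where P: "P \<ge> 0" "\<And>u. phi u \<le> P / br u ^ 0" using phi_decay by metis
    show ?thesis
    proof (rule integrable_om_bound)
      show "norm (U z * atom z t) \<le> (M * P) / om z ^ 4" for z
        using mult_mono[OF M[of z] P(2)[of "t - fst z"]] order_trans[OF norm_ge_zero M[of z]]
        by (simp add: norm_mult)
    qed measurable
  qed
  have "synth (\<lambda>z. U z - (\<Sum>i\<in>I. c i * V i z)) t = (LINT z|lborel. U z * atom z t - (\<Sum>i\<in>I. c i * (V i z * atom z t)))"
    unfolding synth_def by (intro Bochner_Integration.integral_cong refl) (simp add: left_diff_distrib sum_distrib_right mult.assoc)
  also have "\<dots> = synth U t - (\<Sum>i\<in>I. c i * synth (V i) t)"
    unfolding synth_def using i U V
    by (subst Bochner_Integration.integral_diff) (auto intro!: Bochner_Integration.integrable_sum integrable_mult_right simp: Bochner_Integration.integral_sum)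
  finally show ?thesis .
qed

lemma infsum_Inl_only:
  fixes g :: "'a + 'b \<Rightarrow> complex"
  assumes "\<And>n. g (Inr n) = 0" shows "(\<Sum>\<^sub>\<infinity>i. g i) = (\<Sum>\<^sub>\<infinity>n. g (Inl n))"
proof -
  have "(\<Sum>\<^sub>\<infinity>i. g i) = (\<Sum>\<^sub>\<infinity>i\<in>range Inl. g i)"
    by (rule infsum_cong_neutral) (auto, metis assms obj_sumE rangeI)
  also have "\<dots> = (\<Sum>\<^sub>\<infinity>n. g (Inl n))" by (subst infsum_reindex) (auto simp: o_def)
  finally show ?thesis .
qed

lemma infsum_Inr_only:
  fixes g :: "'a + 'b \<Rightarrow> complex"
  assumes "\<And>n. g (Inl n) = 0" shows "(\<Sum>\<^sub>\<infinity>i. g i) = (\<Sum>\<^sub>\<infinity>n. g (Inr n))"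
proof -
  have "(\<Sum>\<^sub>\<infinity>i. g i) = (\<Sum>\<^sub>\<infinity>i\<in>range Inr. g i)"
    by (rule infsum_cong_neutral) (auto, metis assms obj_sumE rangeI)
  also have "\<dots> = (\<Sum>\<^sub>\<infinity>n. g (Inr n))" by (subst infsum_reindex) (auto simp: o_def)
  finally show ?thesis .
qed

lemma summable_on_sum_type:
  fixes g :: "'a + 'b \<Rightarrow> real"
  assumes "(\<lambda>n. g (Inl n)) summable_on UNIV" "(\<lambda>n. g (Inr n)) summable_on UNIV"
  shows "g summable_on UNIV"
proof -
  have "g summable_on (range Inl \<union> range Inr)"
    using assms by (intro summable_on_union) (auto simp: summable_on_reindex o_def)
  moreover have "range Inl \<union> range Inr = (UNIV :: ('a + 'b) set)" by (rule UNIV_sum[symmetric])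
  ultimately show ?thesis by simp
qed

section \<open>Splitting the phase plane\<close>

locale two_samplings = X: sampling x idx C + Y: sampling y idy C'
  for x idx C y idy C'
begin

definition cone where "cone z \<longleftrightarrow> \<bar>snd z\<bar> < \<bar>fst z\<bar>" for z :: "real \<times> real"

definition ph where "ph z = cis (2 * pi * fst z * snd z)" for z :: "real \<times> real"

text \<open>The region and the phases are evaluated at \<open>z\<close> and only the error kernel at \<open>v\<close>, so that freezing
  \<open>v\<close> at the corners of a grid gives an operator of finite rank.\<close>

definition ker where
  "ker v z z' = (if cone z then X.errk v z' else cnj (ph z) * (Y.errk (rot v) (rot z') * ph z'))"

definition node where "node i = (case i of Inl n \<Rightarrow> x n | Inr n \<Rightarrow> y n)"
definition wt where "wt i = (case i of Inl n \<Rightarrow> X.w n | Inr n \<Rightarrow> Y.w n)"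
definition sample where "sample i f = (case i of Inl n \<Rightarrow> f (x n) | Inr n \<Rightarrow> fourier f (y n))"

definition samp where
  "samp i z = (case i of Inl n \<Rightarrow> if cone z then of_real (X.w n) * cnj (atom z (x n)) else 0
     | Inr n \<Rightarrow> if cone z then 0 else cnj (ph z) * (of_real (Y.w n) * cnj (atom (rot z) (y n))))"

lemma norm_ph [simp]: "norm (ph z) = 1" by (simp add: ph_def)

lemma cone_measurable [measurable]: "Measurable.pred borel cone"
  unfolding cone_def[abs_def] by measurable

lemma ph_measurable [measurable]: "ph \<in> borel_measurable borel"
  unfolding ph_def[abs_def] by measurable

lemma samp_measurable [measurable]: "samp i \<in> borel_measurable borel"
  unfolding samp_def[abs_def] by (cases i) simp_all

lemma ker_measurable [measurable]:
  assumes [measurable]: "f \<in> borel_measurable M" "g \<in> borel_measurable M" "h \<in> borel_measurable M"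
  shows "(\<lambda>v. ker (f v) (g v) (h v)) \<in> borel_measurable M"
proof -
  have [measurable]: "Measurable.pred M (\<lambda>v. cone (g v))"
    by (rule measurable_compose[OF assms(2) cone_measurable])
  show ?thesis unfolding ker_def by measurable
qed

lemma wt_nonneg: "0 \<le> wt i"
  using X.w_nonneg Y.w_nonneg by (auto simp: wt_def split: sum.splits)

lemma norm_ker: "norm (ker v z z') = (if cone z then norm (X.errk v z') else norm (Y.errk (rot v) (rot z')))"
  by (simp add: ker_def norm_mult)

text \<open>In the cone this is the sampling identity for \<open>f\<close>. Elsewhere it is the
  identity for \<open>fourier f\<close> at the rotated point, brought back by a phase; substituting
  \<open>rot\<close> in the error integral produces the second phase \<open>ph z'\<close>.\<close>

lemma phase_identity:
  assumes f: "f \<in> schwartz_space"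
  shows "stft f z = (\<Sum>\<^sub>\<infinity>i. sample i f * samp i z) + (LINT z'|lborel. ker z z z' * stft f z')"
proof (cases "cone z")
  case True
  have "f = synth (stft f)" by (rule ext) (simp add: synth_stft[OF f])
  from X.sampling_identity[OF rapid_stft[OF f] this, of z]
  have "stft f z = (\<Sum>\<^sub>\<infinity>n. f (x n) * (of_real (X.w n) * cnj (atom z (x n)))) + (LINT z'|lborel. X.errk z z' * stft f z')"
    unfolding X.sampled_sum[OF f] by (simp only: diff_eq_eq add.commute)
  also have "(\<Sum>\<^sub>\<infinity>n. f (x n) * (of_real (X.w n) * cnj (atom z (x n)))) = (\<Sum>\<^sub>\<infinity>i. sample i f * samp i z)"
    using True by (subst infsum_Inl_only) (auto simp: sample_def samp_def)
  finally show ?thesis using True by (simp add: ker_def)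
next
  case False
  let ?g = "fourier f"
  note g = fourier_schwartz[OF f]
  note [measurable] = sch_measurable[OF f] sch_measurable[OF g(1)]
  have "?g = synth (stft ?g)" by (rule ext) (simp add: synth_stft[OF g(1)])
  from Y.sampling_identity[OF g(2) this, of "rot z"]
  have 1: "stft ?g (rot z) = (\<Sum>\<^sub>\<infinity>n. ?g (y n) * (of_real (Y.w n) * cnj (atom (rot z) (y n)))) + (LINT z'|lborel. Y.errk (rot z) z' * stft ?g z')"
    unfolding Y.sampled_sum[OF g(1)] by (simp only: diff_eq_eq add.commute)
  have 2: "(LINT z'|lborel. Y.errk (rot z) z' * stft ?g z') = (LINT z'|lborel. Y.errk (rot z) (rot z') * (ph z' * stft f z'))"
    using integral_rot(1)[of "\<lambda>z'. Y.errk (rot z) z' * stft ?g z'"] by (simp add: stft_rot(2)[OF f] ph_def)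
  have "cnj (ph z) = cis (- 2 * pi * fst z * snd z)" by (simp add: ph_def cis_cnj)
  then have "stft f z = cnj (ph z) * stft ?g (rot z)" using stft_rot(1)[OF f, of z] by simp
  also have "\<dots> = (\<Sum>\<^sub>\<infinity>n. ?g (y n) * (cnj (ph z) * (of_real (Y.w n) * cnj (atom (rot z) (y n)))))
     + (LINT z'|lborel. cnj (ph z) * (Y.errk (rot z) (rot z') * ph z') * stft f z')"
    unfolding 1 2 distrib_left infsum_cmult_right'[symmetric] integral_mult_right_zero[symmetric]
    by (simp only: mult_ac)
  also have "(\<Sum>\<^sub>\<infinity>n. ?g (y n) * (cnj (ph z) * (of_real (Y.w n) * cnj (atom (rot z) (y n))))) = (\<Sum>\<^sub>\<infinity>i. sample i f * samp i z)"
    using False by (subst infsum_Inr_only) (auto simp: sample_def samp_def)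
  finally show ?thesis using False by (simp add: ker_def)
qed

lemma ker_weight_integrable:
  assumes s: "s \<ge> 5"
  shows "integrable lborel (\<lambda>z'. norm (ker v z z') * (1 / om z' ^ s))"
proof (cases "cone z")
  case True
  then show ?thesis using X.errk_weight_integrable[OF s] by (simp add: norm_ker)
next
  case False
  have "integrable lborel (\<lambda>z'. norm (Y.errk (rot v) (rot z')) * (1 / om (rot z') ^ s))"
    using Y.errk_weight_integrable[OF s, of "rot v"]
    by (subst integral_rot(2)[where g = "\<lambda>z'. norm (Y.errk (rot v) z') * (1 / om z' ^ s)"]) auto
  then show ?thesis using False by (simp add: norm_ker)
qed

text \<open>The quarter turn carries the complement of the cone into the region
  \<open>\<bar>snd z\<bar> \<le> \<bar>fst z\<bar>\<close>, so \<open>errk_weight\<close> serves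
  both cases; the weight is invariant under it.\<close>

lemma ker_gain:
  assumes s: "s \<ge> 5"
  shows "\<exists>C\<ge>0. \<forall>z. (LINT z'|lborel. norm (ker z z z') * (1 / om z' ^ s)) \<le> C * (1 / om z ^ (s + 1))"
proof -
  obtain A where A: "A \<ge> 0" "\<forall>z. \<bar>snd z\<bar> \<le> \<bar>fst z\<bar> \<longrightarrow>
     (LINT z'|lborel. norm (X.errk z z') * (1 / om z' ^ s)) \<le> A * (1 / om z ^ (s + 1))" using X.errk_weight[OF s] by blast
  obtain B where B: "B \<ge> 0" "\<forall>z. \<bar>snd z\<bar> \<le> \<bar>fst z\<bar> \<longrightarrow>
     (LINT z'|lborel. norm (Y.errk z z') * (1 / om z' ^ s)) \<le> B * (1 / om z ^ (s + 1))" using Y.errk_weight[OF s] by blast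
  have "(LINT z'|lborel. norm (ker z z z') * (1 / om z' ^ s)) \<le> (A + B) * (1 / om z ^ (s + 1))" for z
  proof (cases "cone z")
    case True
    then have "(LINT z'|lborel. norm (ker z z z') * (1 / om z' ^ s)) \<le> A * (1 / om z ^ (s + 1))"
      unfolding norm_ker using A(2)[rule_format, of z] by (simp add: cone_def)
    also have "\<dots> \<le> (A + B) * (1 / om z ^ (s + 1))" using B(1) by (intro mult_right_mono) auto
    finally show ?thesis .
  next
    case False
    have "(LINT z'|lborel. norm (ker z z z') * (1 / om z' ^ s)) = (LINT z'|lborel. norm (Y.errk (rot z) (rot z')) * (1 / om (rot z') ^ s))"
      using False by (simp add: norm_ker)
    also have "\<dots> = (LINT z'|lborel. norm (Y.errk (rot z) z') * (1 / om z' ^ s))"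
      by (rule integral_rot(1)[where g = "\<lambda>z'. norm (Y.errk (rot z) z') * (1 / om z' ^ s)"]) measurable
    also have "\<dots> \<le> B * (1 / om (rot z) ^ (s + 1))"
      using False by (intro B(2)[rule_format]) (simp add: cone_def rot_def)
    also have "\<dots> \<le> (A + B) * (1 / om z ^ (s + 1))" unfolding om_rot using A(1) by (intro mult_right_mono) auto
    finally show ?thesis .
  qed
  then show ?thesis using A(1) B(1) by (intro exI[of _ "A + B"]) auto
qed

lemma ker_lipschitz:
  "\<exists>L\<ge>0. \<forall>z u v z'. norm (ker u z z' - ker v z z') \<le> L * pdist u v * om z'"
proof -
  obtain A where A: "A \<ge> 0" "\<forall>z v z'. norm (X.errk z z' - X.errk v z') \<le> A * pdist z v * br (fst z')"
    using X.errk_lipschitz by blast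
  obtain B where B: "B \<ge> 0" "\<forall>z v z'. norm (Y.errk z z' - Y.errk v z') \<le> B * pdist z v * br (fst z')"
    using Y.errk_lipschitz by blast
  have "norm (ker u z z' - ker v z z') \<le> (A + B) * pdist u v * om z'" for z u v z'
  proof (cases "cone z")
    case True
    then have "norm (ker u z z' - ker v z z') \<le> A * pdist u v * br (fst z')"
      using A(2)[rule_format, of u z' v] by (simp add: ker_def)
    also have "\<dots> \<le> (A + B) * pdist u v * om z'"
      using A(1) B(1) by (intro mult_mono mult_right_mono br_fst_le_om) auto
    finally show ?thesis .
  next
    case False
    have p: "pdist (rot u) (rot v) = pdist u v" by (simp add: pdist_def rot_def abs_minus_commute)
    have "ker u z z' - ker v z z' = cnj (ph z) * ((Y.errk (rot u) (rot z') - Y.errk (rot v) (rot z')) * ph z')"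
      using False by (simp add: ker_def algebra_simps)
    then have "norm (ker u z z' - ker v z z') = norm (Y.errk (rot u) (rot z') - Y.errk (rot v) (rot z'))"
      by (simp add: norm_mult)
    also have "\<dots> \<le> B * pdist u v * br (fst (rot z'))"
      using B(2)[rule_format, of "rot u" "rot z'" "rot v"] unfolding p .
    also have "\<dots> \<le> (A + B) * pdist u v * om z'"
      using A(1) B(1) br_fst_le_om[of "rot z'"] by (intro mult_mono mult_right_mono) auto
    finally show ?thesis .
  qed
  then show ?thesis using A(1) B(1) by (intro exI[of _ "A + B"]) auto
qed

text \<open>\<open>samp i\<close> vanishes unless the coordinate that is compared with the node
  dominates the other one. Where it does, it controls \<open>om z\<close>, and the Gaussian around
  the node moves the weight from that coordinate to the node.\<close>

lemma samp_bound:
  "\<exists>K\<ge>0. \<forall>i z. norm (samp i z) \<le> K * (wt i * br (node i) ^ s) * (1 / om z ^ s)"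
proof -
  obtain P where P: "P \<ge> 0" "\<And>u. phi u \<le> P / br u ^ s" using phi_decay by metis
  have key: "w * phi (b - a) \<le> P * 2 ^ s * (w * br b ^ s) * (1 / om z ^ s)" if "0 \<le> w" "om z \<le> 2 * br a" for w a b z
  proof -
    have "br a \<le> br b * br (b - a)" using br_diff[of b "b - a"] by simp
    then have "om z \<le> 2 * (br b * br (b - a))" using that(2) by linarith
    then have "om z ^ s \<le> (2 * (br b * br (b - a))) ^ s" by (intro power_mono) auto
    then have "P * om z ^ s \<le> P * (2 ^ s * br b ^ s * br (b - a) ^ s)"
      using P(1) by (intro mult_left_mono) (auto simp: power_mult_distrib mult.assoc)
    then have "P / br (b - a) ^ s \<le> P * 2 ^ s * br b ^ s * (1 / om z ^ s)"
      by (simp add: field_simps br_pos om_pos)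
    then have "phi (b - a) \<le> P * 2 ^ s * br b ^ s * (1 / om z ^ s)" using P(2)[of "b - a"] by linarith
    then have "w * phi (b - a) \<le> w * (P * 2 ^ s * br b ^ s * (1 / om z ^ s))" using that(1) by (intro mult_left_mono)
    then show ?thesis by (simp only: mult_ac)
  qed
  have "norm (samp i z) \<le> P * 2 ^ s * (wt i * br (node i) ^ s) * (1 / om z ^ s)" for i z
  proof -
    have nn: "0 \<le> P * 2 ^ s * (wt i * br (node i) ^ s) * (1 / om z ^ s)"
      using P(1) wt_nonneg[of i] by simp
    show ?thesis
    proof (cases i)
      case (Inl n)
      have "norm (samp i z) \<le> X.w n * phi (x n - fst z)" if "cone z"
        using that X.w_nonneg[of n] by (simp add: samp_def Inl norm_mult)
      moreover have "X.w n * phi (x n - fst z) \<le> P * 2 ^ s * (wt i * br (node i) ^ s) * (1 / om z ^ s)" if "cone z"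
        using key[OF X.w_nonneg[of n], of z "fst z" "x n"] that by (simp add: wt_def node_def Inl cone_def om_def br_def)
      moreover have "norm (samp i z) = 0" if "\<not> cone z" using that by (simp add: samp_def Inl)
      ultimately show ?thesis using nn by (cases "cone z") (auto intro: order_trans)
    next
      case (Inr n)
      have "norm (samp i z) \<le> Y.w n * phi (y n - snd z)" if "\<not> cone z"
        using that Y.w_nonneg[of n] by (simp add: samp_def Inr norm_mult rot_def)
      moreover have "Y.w n * phi (y n - snd z) \<le> P * 2 ^ s * (wt i * br (node i) ^ s) * (1 / om z ^ s)" if "\<not> cone z"
        using key[OF Y.w_nonneg[of n], of z "snd z" "y n"] that by (simp add: wt_def node_def Inr cone_def om_def br_def)
      moreover have "norm (samp i z) = 0" if "cone z" using that by (simp add: samp_def Inr)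
      ultimately show ?thesis using nn by (cases "cone z") (auto intro: order_trans)
    qed
  qed
  moreover have "0 \<le> P * 2 ^ s" using P(1) by simp
  ultimately show ?thesis by blast
qed

lemma sample_summable:
  assumes f: "f \<in> schwartz_space"
  shows "(\<lambda>i. norm (sample i f) * (wt i * br (node i) ^ M)) summable_on UNIV"
  using X.samples_summable[OF f, of M] Y.samples_summable[OF fourier_schwartz(1)[OF f], of M]
  by (intro summable_on_sum_type) (auto simp: sample_def wt_def node_def)

end

section \<open>Reconstruction up to finite rank\<close>

lemma rapidI:
  assumes "U \<in> borel_measurable borel" and "\<And>n. \<exists>M. \<forall>z. norm (U z) \<le> M * (1 / om z ^ (5 + n))"
  shows "rapid U"
  unfolding rapid_def
proof (intro conjI allI assms(1))
  fix s
  obtain M where M: "\<forall>z. norm (U z) \<le> M * (1 / om z ^ (5 + s))" using assms(2) by blast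
  have M0: "0 \<le> M" using order_trans[OF norm_ge_zero M[rule_format, of 0]] by (simp add: om_def)
  have "norm (U z) \<le> M / om z ^ s" for z
  proof (rule order_trans[OF M[rule_format]])
    have "M * (1 / om z ^ (5 + s)) \<le> M * (1 / om z ^ s)"
      by (intro mult_left_mono divide_left_mono power_increasing om_ge1 mult_pos_pos om_power_pos M0) auto
    then show "M * (1 / om z ^ (5 + s)) \<le> M / om z ^ s" by simp
  qed
  then show "\<exists>M. \<forall>z. norm (U z) \<le> M / om z ^ s" by blast
qed

lemma rapid_measurable: "rapid U \<Longrightarrow> U \<in> borel_measurable borel"
  by (simp add: rapid_def)

lemma rapid_bound_mult:
  assumes "rapid U" obtains M where "\<And>z. norm (U z) \<le> M * (1 / om z ^ s)"
  using rapid_bound[OF assms, of s] by (metis times_divide_eq_right mult_1_right)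

lemma rapid_diff_sum:
  assumes U: "rapid U" and V: "\<And>i. i \<in> I \<Longrightarrow> rapid (V i)" and I: "finite I"
  shows "rapid (\<lambda>z. U z - (\<Sum>i\<in>I. c i * V i z))"
  unfolding rapid_def
proof (intro conjI allI)
  note [measurable] = rapid_measurable[OF U] rapid_measurable[OF V]
  show "(\<lambda>z. U z - (\<Sum>i\<in>I. c i * V i z)) \<in> borel_measurable borel" by measurable
  fix s
  obtain A where A: "\<And>z. norm (U z) \<le> A / om z ^ s" using rapid_bound[OF U] by metis
  have "\<exists>B. \<forall>z. norm (V i z) \<le> B / om z ^ s" if "i \<in> I" for i
    using V[OF that] unfolding rapid_def by blast
  then obtain B where B: "\<And>i z. i \<in> I \<Longrightarrow> norm (V i z) \<le> B i / om z ^ s" by metis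
  have "norm (U z - (\<Sum>i\<in>I. c i * V i z)) \<le> (A + (\<Sum>i\<in>I. norm (c i) * B i)) / om z ^ s" for z
  proof -
    have "norm (\<Sum>i\<in>I. c i * V i z) \<le> (\<Sum>i\<in>I. norm (c i) * (B i / om z ^ s))"
      by (rule sum_norm_le) (unfold norm_mult, rule mult_left_mono[OF B norm_ge_zero])
    also have "\<dots> = (\<Sum>i\<in>I. norm (c i) * B i) / om z ^ s"
      by (simp add: sum_divide_distrib)
    finally have "norm (\<Sum>i\<in>I. c i * V i z) \<le> (\<Sum>i\<in>I. norm (c i) * B i) / om z ^ s" .
    then show ?thesis unfolding add_divide_distrib
      using A[of z] norm_triangle_ineq4[of "U z" "\<Sum>i\<in>I. c i * V i z"] by linarith
  qed
  then show "\<exists>M. \<forall>z. norm (U z - (\<Sum>i\<in>I. c i * V i z)) \<le> M / om z ^ s" by blast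
qed

context gaining_kernel begin

lemma op_diff_sum:
  assumes U: "rapid U" and V: "\<And>i. i \<in> I \<Longrightarrow> rapid (V i)"
  shows "op (\<lambda>z. U z - (\<Sum>i\<in>I. c i * V i z)) z = op U z - (\<Sum>i\<in>I. c i * op (V i) z)"
proof -
  have i: "integrable lborel (\<lambda>z'. G z z' * U z')" if U: "rapid U" for U
  proof -
    obtain M where "\<And>z. norm (U z) \<le> M * (1 / om z ^ 5)" using rapid_bound_mult[OF U] by metis
    then show ?thesis by (intro op_integrable[OF rapid_measurable[OF U]]) auto
  qed
  have "op (\<lambda>z. U z - (\<Sum>i\<in>I. c i * V i z)) z = (LINT z'|lborel. G z z' * U z' - (\<Sum>i\<in>I. c i * (G z z' * V i z')))"
    unfolding op_def by (intro Bochner_Integration.integral_cong refl) (simp add: right_diff_distrib sum_distrib_left mult_ac)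
  also have "\<dots> = op U z - (\<Sum>i\<in>I. c i * op (V i) z)"
    unfolding op_def using i U V
    by (subst Bochner_Integration.integral_diff) (auto intro!: Bochner_Integration.integrable_sum integrable_mult_right simp: Bochner_Integration.integral_sum)
  finally show ?thesis .
qed

text \<open>The condition \<open>M 0 \<le> M n\<close> turns the basic bound \<open>2 * M 0\<close>
  into \<open>2 * M n\<close>, the form in which the bootstrap takes it. One sequence
  \<open>K\<close> serves all right-hand sides.\<close>

lemma neumann_rapid:
  "\<exists>K. (\<forall>n. 0 \<le> K n) \<and> (\<forall>V M. V \<in> borel_measurable borel \<longrightarrow> (\<forall>n z. norm (V z) \<le> M n * (1 / om z ^ (5 + n)))
     \<longrightarrow> (\<forall>n. M 0 \<le> M n) \<longrightarrow> (\<exists>W. W \<in> borel_measurable borel \<and> (\<forall>z. W z = V z + op W z)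
       \<and> (\<forall>n z. norm (W z) \<le> K n * M n * (1 / om z ^ (5 + n)))))"
proof -
  have "\<forall>n. \<exists>K\<ge>0. \<forall>V W M. (\<forall>z. norm (V z) \<le> M * (1 / om z ^ (5 + n))) \<longrightarrow> (\<forall>z. W z = V z + op W z)
     \<longrightarrow> (\<forall>z. norm (W z) \<le> 2 * M * (1 / om z ^ 5)) \<longrightarrow> (\<forall>z. norm (W z) \<le> K * M * (1 / om z ^ (5 + n)))"
    using neumann_bootstrap by blast
  then obtain K where K: "\<And>n. 0 \<le> K n" "\<And>n. \<forall>V W M. (\<forall>z. norm (V z) \<le> M * (1 / om z ^ (5 + n))) \<longrightarrow> (\<forall>z. W z = V z + op W z)
     \<longrightarrow> (\<forall>z. norm (W z) \<le> 2 * M * (1 / om z ^ 5)) \<longrightarrow> (\<forall>z. norm (W z) \<le> K n * M * (1 / om z ^ (5 + n)))"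
    by metis
  have "\<exists>W. W \<in> borel_measurable borel \<and> (\<forall>z. W z = V z + op W z)
       \<and> (\<forall>n z. norm (W z) \<le> K n * M n * (1 / om z ^ (5 + n)))"
    if Vm: "V \<in> borel_measurable borel" and V: "\<forall>n z. norm (V z) \<le> M n * (1 / om z ^ (5 + n))" and M: "\<forall>n. M 0 \<le> M n" for V M
  proof -
    have "norm (V z) \<le> M 0 * (1 / om z ^ 5)" for z using V[rule_format, of z 0] by simp
    from neumann_exists[OF Vm this] obtain W where W: "W \<in> borel_measurable borel" "\<forall>z. W z = V z + op W z"
      "\<forall>z. norm (W z) \<le> 2 * M 0 * (1 / om z ^ 5)" by blast
    have "norm (W z) \<le> 2 * M n * (1 / om z ^ 5)" for n z
      using M by (intro order_trans[OF W(3)[rule_format]] mult_right_mono) auto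
    then have "\<forall>n z. norm (W z) \<le> K n * M n * (1 / om z ^ (5 + n))" using K(2) V W(2) by blast
    then show ?thesis using W by blast
  qed
  then show ?thesis using K(1) by (intro exI[of _ K]) blast
qed

end

context two_samplings begin

text \<open>The lower corner of the cell of \<open>z\<close> in a grid of mesh \<open>h\<close>.
  Together with \<open>box\<close>, which retains finitely many cells, it yields the part of the
  kernel that has finite rank.\<close>

definition corner :: "real \<Rightarrow> real \<times> real \<Rightarrow> real \<times> real" where
  "corner h z = (h * of_int \<lfloor>fst z / h\<rfloor>, h * of_int \<lfloor>snd z / h\<rfloor>)"

definition box :: "real \<Rightarrow> nat \<Rightarrow> real \<times> real \<Rightarrow> bool" where
  "box h N z \<longleftrightarrow> \<bar>\<lfloor>fst z / h\<rfloor>\<bar> \<le> int N \<and> \<bar>\<lfloor>snd z / h\<rfloor>\<bar> \<le> int N"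

definition near_ker where "near_ker h N z z' = (if box h N z then ker (corner h z) z z' else 0)"

definition far_ker where "far_ker h N z z' = ker z z z' - near_ker h N z z'"

lemma corner_dist: "h > 0 \<Longrightarrow> pdist z (corner h z) \<le> 2 * h"
proof -
  assume h: "h > 0"
  have "\<bar>u - h * of_int \<lfloor>u / h\<rfloor>\<bar> \<le> h" for u
  proof -
    have "of_int \<lfloor>u / h\<rfloor> * h \<le> u"
      by (rule pos_le_divide_eq[OF h, THEN iffD1, OF of_int_floor_le])
    moreover have "u < (of_int \<lfloor>u / h\<rfloor> + 1) * h"
      by (rule pos_divide_less_eq[OF h, THEN iffD1, OF real_of_int_floor_add_one_gt])
    ultimately show ?thesis by (simp add: algebra_simps)
  qed
  from this[of "fst z"] this[of "snd z"] show ?thesis by (simp add: pdist_def corner_def)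
qed

lemma box_om:
  assumes h: "h > 0"
  shows "box h N z \<Longrightarrow> om z \<le> 1 + 2 * (h * (real N + 1))" "\<not> box h N z \<Longrightarrow> h * real N \<le> om z"
proof -
  have 1: "\<bar>u\<bar> \<le> h * (real N + 1)" if "\<bar>\<lfloor>u / h\<rfloor>\<bar> \<le> int N" for u
  proof -
    have "\<bar>u / h\<bar> \<le> real N + 1" using that by linarith
    then have "\<bar>u\<bar> / h \<le> real N + 1" using h by simp
    then show ?thesis using h by (simp add: pos_divide_le_eq mult.commute)
  qed
  have 2: "h * real N \<le> \<bar>u\<bar>" if "\<not> \<bar>\<lfloor>u / h\<rfloor>\<bar> \<le> int N" for u
  proof -
    have "real N \<le> \<bar>u / h\<bar>" using that by linarith
    then have "real N \<le> \<bar>u\<bar> / h" using h by simp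
    then show ?thesis using h by (simp add: pos_le_divide_eq mult.commute)
  qed
  show "om z \<le> 1 + 2 * (h * (real N + 1))" if "box h N z"
    using 1[of "fst z"] 1[of "snd z"] that by (simp add: om_def box_def)
  show "h * real N \<le> om z" if "\<not> box h N z"
    using 2[of "fst z"] 2[of "snd z"] that unfolding box_def om_def by fastforce
qed

lemma corner_measurable [measurable]: "corner h \<in> borel_measurable borel"
  unfolding corner_def[abs_def] by (intro borel_measurable_Pair) measurable

lemma box_measurable [measurable]: "Measurable.pred borel (box h N)"
proof -
  have "box h N z \<longleftrightarrow> \<bar>real_of_int \<lfloor>fst z / h\<rfloor>\<bar> \<le> real N \<and> \<bar>real_of_int \<lfloor>snd z / h\<rfloor>\<bar> \<le> real N" for z
    unfolding box_def by linarith
  then have "box h N = (\<lambda>z. \<bar>real_of_int \<lfloor>fst z / h\<rfloor>\<bar> \<le> real N \<and> \<bar>real_of_int \<lfloor>snd z / h\<rfloor>\<bar> \<le> real N)" by blast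
  then show ?thesis by (simp only:) measurable
qed

lemma far_ker_measurable: "case_prod (far_ker h N) \<in> borel_measurable (borel \<Otimes>\<^sub>M borel)"
proof -
  have [measurable]: "Measurable.pred (borel \<Otimes>\<^sub>M borel) (\<lambda>v :: (real \<times> real) \<times> (real \<times> real). box h N (fst v))"
    by (rule measurable_compose[OF measurable_fst box_measurable])
  have [measurable]: "(\<lambda>v :: (real \<times> real) \<times> (real \<times> real). corner h (fst v)) \<in> borel_measurable (borel \<Otimes>\<^sub>M borel)"
    by (rule measurable_compose[OF measurable_fst corner_measurable])
  show ?thesis unfolding far_ker_def near_ker_def case_prod_beta' by measurable
qed

text \<open>Outside the box the kernel is unchanged, and since \<open>om z\<close> is large there,
  the gained power provides the factor 1/2. Inside, the kernel is a difference over a distance of at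
  most \<open>2 * h\<close>. The extent \<open>R\<close> of the box is fixed before the mesh,
  because it enters the inside bound through \<open>(3 + 2 * R) ^ 5\<close>.\<close>

lemma far_ker_gaining: "\<exists>h N. h > 0 \<and> gaining_kernel (far_ker h N)"
proof -
  obtain L where L: "L \<ge> 0" "\<forall>z u v z'. norm (ker u z z' - ker v z z') \<le> L * pdist u v * om z'"
    using ker_lipschitz by blast
  obtain C5 where C5: "C5 \<ge> 0" "\<forall>z. (LINT z'|lborel. norm (ker z z z') * (1 / om z' ^ 5)) \<le> C5 * (1 / om z ^ (5 + 1))"
    using ker_gain[of 5] by auto
  define I where "I s = (LINT z'|lborel. 1 / om z' ^ s)" for s
  have I0: "0 \<le> I s" for s unfolding I_def by (rule integral_nonneg_AE) simp
  define R where "R = 2 * C5 + 1"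
  have R: "R > 0" "R \<ge> 2 * C5" using C5 by (auto simp: R_def)
  \<comment> \<open>Chosen so that the inside integral is at most \<open>h * T / 2\<close> times the
    weight; the aim is then \<open>h * T \<le> 1\<close>.\<close>
  define T where "T = 4 * (L * I 4) * (3 + 2 * R) ^ 5"
  have T: "0 \<le> T" unfolding T_def using L I0[of 4] R by simp
  \<comment> \<open>With \<open>h = R / N\<close>, a large \<open>N\<close> refines the grid while
    \<open>h * N = R\<close> stays fixed. This one inequality yields both \<open>h \<le> 1\<close>
    and \<open>h * T \<le> 1\<close>.\<close>
  obtain N :: nat where N: "R * (1 + T) < real N" using reals_Archimedean2 by blast
  define h where "h = R / real N"
  have RT: "R * 1 \<le> R * (1 + T)" using R T by (intro mult_left_mono) auto
  have Npos: "real N > 0" using N RT R by linarith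
  have h0: "h > 0" and hN: "h * real N = R" using R Npos by (auto simp: h_def)
  have h1: "h \<le> 1" unfolding h_def using N RT Npos by (simp add: pos_divide_le_eq)
  have hT: "h * T \<le> 1"
  proof -
    have "R * T \<le> real N" using N R T by (simp add: distrib_left)
    then show ?thesis unfolding h_def using Npos by (simp add: pos_divide_le_eq)
  qed
  have far_out: "far_ker h N z z' = ker z z z'" if "\<not> box h N z" for z z'
    using that by (simp add: far_ker_def near_ker_def)
  have far_in: "norm (far_ker h N z z') \<le> (L * (2 * h)) * om z'" if "box h N z" for z z'
  proof -
    have "norm (far_ker h N z z') \<le> L * pdist z (corner h z) * om z'"
      using that unfolding far_ker_def near_ker_def by (simp only: if_True) (rule L(2)[rule_format])
    also have "\<dots> \<le> (L * (2 * h)) * om z'"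
      using L(1) corner_dist[OF h0, of z] by (intro mult_right_mono mult_left_mono) auto
    finally show ?thesis .
  qed
  have far_in': "norm (far_ker h N z z') * (1 / om z' ^ s) \<le> (L * (2 * h)) * (1 / om z' ^ (s - 1))" if "box h N z" "s \<ge> 5" for z z' s
  proof -
    have "om z' ^ s = om z' * om z' ^ (s - 1)" using that(2) by (metis power_eq_if not_numeral_le_zero)
    moreover have "norm (far_ker h N z z') * (1 / om z' ^ s) \<le> (L * (2 * h)) * om z' * (1 / om z' ^ s)"
      by (intro mult_right_mono far_in that) simp
    ultimately show ?thesis by simp
  qed
  have om_in: "om z \<le> 3 + 2 * R" if "box h N z" for z
    using box_om(1)[OF h0 that] h1 hN by (simp add: distrib_left)
  have fm: "(\<lambda>z'. far_ker h N z z') \<in> borel_measurable borel" for z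
    using measurable_compose[OF measurable_Pair1' far_ker_measurable, of z] by simp
  have int: "integrable lborel (\<lambda>z'. norm (far_ker h N z z') * (1 / om z' ^ s))" if s: "s \<ge> 5" for s z
  proof (cases "box h N z")
    case False
    then show ?thesis using ker_weight_integrable[OF s] by (simp add: far_out)
  next
    case True
    note [measurable] = fm
    show ?thesis
    proof (rule Bochner_Integration.integrable_bound[OF integrable_mult_right[OF integrable_om[of "s - 1"], of "L * (2 * h)"]])
      show "AE z' in lborel. norm (norm (far_ker h N z z') * (1 / om z' ^ s)) \<le> norm (L * (2 * h) * (1 / om z' ^ (s - 1)))"
      proof (intro AE_I2)
        fix z'
        have "0 \<le> norm (far_ker h N z z') * (1 / om z' ^ s)" by simp
        then show "norm (norm (far_ker h N z z') * (1 / om z' ^ s)) \<le> norm (L * (2 * h) * (1 / om z' ^ (s - 1)))"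
          using far_in'[OF True s, of z'] unfolding real_norm_def by linarith
      qed
    qed (use s in auto)
  qed
  have inb: "(LINT z'|lborel. norm (far_ker h N z z') * (1 / om z' ^ s)) \<le> L * (2 * h) * I (s - 1)"
    if "box h N z" "s \<ge> 5" for z s
  proof -
    have "(LINT z'|lborel. norm (far_ker h N z z') * (1 / om z' ^ s)) \<le> (LINT z'|lborel. (L * (2 * h)) * (1 / om z' ^ (s - 1)))"
      using that by (intro integral_mono int far_in' integrable_mult_right integrable_om) auto
    then show ?thesis unfolding I_def by (simp only: integral_mult_right_zero)
  qed
  have scale: "a \<le> (a * (3 + 2 * R) ^ m) * (1 / om z ^ m)" if "box h N z" "0 \<le> a" for a m z
  proof -
    have "a * om z ^ m \<le> a * (3 + 2 * R) ^ m" using that om_in[OF that(1)] by (intro mult_left_mono power_mono) auto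
    then show ?thesis by (simp add: pos_le_divide_eq)
  qed
  have "gaining_kernel (far_ker h N)"
  proof
    show "case_prod (far_ker h N) \<in> borel_measurable (borel \<Otimes>\<^sub>M borel)" by (rule far_ker_measurable)
    show "integrable lborel (\<lambda>z'. norm (far_ker h N z z') * (1 / om z' ^ s))" if "s \<ge> 5" for s z by (rule int[OF that])
    show "(LINT z'|lborel. norm (far_ker h N z z') * (1 / om z' ^ 5)) \<le> 1 / 2 * (1 / om z ^ 5)" for z
    proof (cases "box h N z")
      case True
      have "(LINT z'|lborel. norm (far_ker h N z z') * (1 / om z' ^ 5)) \<le> L * (2 * h) * I 4"
        using inb[OF True, of 5] by simp
      also have "\<dots> \<le> (L * (2 * h) * I 4 * (3 + 2 * R) ^ 5) * (1 / om z ^ 5)"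
        using L(1) h0 I0[of 4] by (intro scale[OF True]) auto
      also have "L * (2 * h) * I 4 * (3 + 2 * R) ^ 5 = (h * T) / 2" unfolding T_def by simp
      also have "(h * T) / 2 * (1 / om z ^ 5) \<le> 1 / 2 * (1 / om z ^ 5)"
        using hT by (intro mult_right_mono) auto
      finally show ?thesis .
    next
      case False
      have "2 * C5 \<le> om z" using box_om(2)[OF h0 False] hN R by linarith
      then have "C5 * (1 / om z ^ (5 + 1)) \<le> (om z / 2) * (1 / om z ^ (5 + 1))" by (intro mult_right_mono) auto
      also have "\<dots> = 1 / 2 * (1 / om z ^ 5)" unfolding power_add[of _ 5 1] power_one_right by simp
      finally show ?thesis using C5(2)[rule_format, of z] far_out[OF False] by simp
    qed
    show "\<exists>C\<ge>0. \<forall>z. (LINT z'|lborel. norm (far_ker h N z z') * (1 / om z' ^ s)) \<le> C * (1 / om z ^ (s + 1))" if s: "s \<ge> 5" for s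
    proof -
      obtain C where C: "C \<ge> 0" "\<forall>z. (LINT z'|lborel. norm (ker z z z') * (1 / om z' ^ s)) \<le> C * (1 / om z ^ (s + 1))"
        using ker_gain[OF s] by blast
      define B where "B = L * (2 * h) * I (s - 1) * (3 + 2 * R) ^ (s + 1)"
      have a0: "0 \<le> L * (2 * h) * I (s - 1)" using L(1) h0 I0[of "s - 1"] by simp
      have B: "0 \<le> B" unfolding B_def using a0 R by simp
      have "(LINT z'|lborel. norm (far_ker h N z z') * (1 / om z' ^ s)) \<le> (C + B) * (1 / om z ^ (s + 1))" for z
      proof (cases "box h N z")
        case True
        have "(LINT z'|lborel. norm (far_ker h N z z') * (1 / om z' ^ s)) \<le> B * (1 / om z ^ (s + 1))"
          using order_trans[OF inb[OF True s] scale[OF True a0, of "s + 1"]] by (simp add: B_def)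
        also have "\<dots> \<le> (C + B) * (1 / om z ^ (s + 1))" using C(1) by (intro mult_right_mono) auto
        finally show ?thesis .
      next
        case False
        have "(LINT z'|lborel. norm (far_ker h N z z') * (1 / om z' ^ s)) \<le> C * (1 / om z ^ (s + 1))"
          using C(2)[rule_format, of z] by (simp only: far_out[OF False])
        also have "\<dots> \<le> (C + B) * (1 / om z ^ (s + 1))" using B by (intro mult_right_mono) auto
        finally show ?thesis .
      qed
      then show ?thesis using C(1) B by (intro exI[of _ "C + B"]) auto
    qed
  qed
  then show ?thesis using h0 by blast
qed

definition cell where
  "cell h j z = (case j of (a, b, e) \<Rightarrow> if \<lfloor>fst z / h\<rfloor> = a \<and> \<lfloor>snd z / h\<rfloor> = b \<and> cone z = e
      then (if e then 1 else cnj (ph z)) else 0)"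

definition cell_fun where
  "cell_fun h j z' = (case j of (a, b, e) \<Rightarrow> let v = (h * of_int a, h * of_int b) in
      if e then X.errk v z' else Y.errk (rot v) (rot z') * ph z')"

definition cells :: "nat \<Rightarrow> (int \<times> int \<times> bool) set" where
  "cells N = {- int N..int N} \<times> {- int N..int N} \<times> UNIV"

lemma finite_cells: "finite (cells N)" by (simp add: cells_def)

text \<open>For given \<open>z\<close> only the index \<open>?j\<close> of its own cell and side can
  contribute to the sum, and it belongs to \<open>cells N\<close> exactly when \<open>z\<close> lies
  in the box.\<close>

lemma near_ker_finite_rank:
  "(LINT z'|lborel. near_ker h N z z' * U z') = (\<Sum>j\<in>cells N. (LINT z'|lborel. cell_fun h j z' * U z') * cell h j z)"
proof -
  let ?j = "(\<lfloor>fst z / h\<rfloor>, \<lfloor>snd z / h\<rfloor>, cone z)"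
  let ?t = "\<lambda>j. (LINT z'|lborel. cell_fun h j z' * U z') * cell h j z"
  have mem: "?j \<in> cells N \<longleftrightarrow> box h N z" by (auto simp: cells_def box_def abs_le_iff)
  have "cell h j z = 0" if "j \<noteq> ?j" for j
  proof -
    obtain a b e where j: "j = (a, b, e)" by (cases j)
    have "\<not> (\<lfloor>fst z / h\<rfloor> = a \<and> \<lfloor>snd z / h\<rfloor> = b \<and> cone z = e)" using that j by blast
    then show ?thesis by (simp only: j cell_def prod.case if_False)
  qed
  then have "(\<Sum>j\<in>cells N. ?t j) = (\<Sum>j\<in>cells N. if j = ?j then ?t ?j else 0)"
    by (intro sum.cong refl) auto
  also have "\<dots> = (if box h N z then ?t ?j else 0)" by (simp only: sum.delta[OF finite_cells] mem)
  also have "\<dots> = (LINT z'|lborel. near_ker h N z z' * U z')"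
  proof (cases "box h N z")
    case True
    have "(LINT z'|lborel. near_ker h N z z' * U z') = (LINT z'|lborel. cell_fun h ?j z' * U z' * cell h ?j z)"
      using True by (intro Bochner_Integration.integral_cong refl)
        (simp add: near_ker_def ker_def cell_fun_def cell_def corner_def Let_def mult_ac)
    then show ?thesis using True by simp
  qed (simp add: near_ker_def)
  finally show ?thesis ..
qed

lemma cell_measurable [measurable]: "cell h j \<in> borel_measurable borel"
proof -
  have "cell h j = (\<lambda>z. case j of (a, b, e) \<Rightarrow> if real_of_int \<lfloor>fst z / h\<rfloor> = real_of_int a \<and> real_of_int \<lfloor>snd z / h\<rfloor> = real_of_int b \<and> (cone z \<longleftrightarrow> e)
      then (if e then 1 else cnj (ph z)) else 0)"
    by (auto simp: cell_def fun_eq_iff split: prod.splits)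
  then show ?thesis by (cases j) simp
qed

lemma cell_bound:
  assumes h: "h > 0" and j: "j \<in> cells N"
  shows "norm (cell h j z) \<le> (1 + 2 * (h * (real N + 1))) ^ s * (1 / om z ^ s)"
proof (cases "cell h j z = 0")
  case True
  then show ?thesis using h by simp
next
  case False
  then have "box h N z" using j by (cases j) (auto simp: cell_def cells_def box_def abs_le_iff split: if_splits)
  from box_om(1)[OF h this] have "om z ^ s \<le> (1 + 2 * (h * (real N + 1))) ^ s" by (intro power_mono) auto
  then have "1 \<le> (1 + 2 * (h * (real N + 1))) ^ s * (1 / om z ^ s)" by (simp add: pos_le_divide_eq)
  moreover have "norm (cell h j z) \<le> 1" by (cases j) (auto simp: cell_def)
  ultimately show ?thesis by linarith
qed

lemma ker_U_integrable:
  assumes U: "rapid U" shows "integrable lborel (\<lambda>z'. ker v z z' * U z')"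
proof -
  note [measurable] = rapid_measurable[OF U]
  obtain M where M: "\<And>z. norm (U z) \<le> M * (1 / om z ^ 5)" using rapid_bound_mult[OF U] by metis
  show ?thesis
  proof (rule Bochner_Integration.integrable_bound[OF integrable_mult_right[OF ker_weight_integrable[of 5 v z], of M]])
    show "AE z' in lborel. norm (ker v z z' * U z') \<le> norm (M * (norm (ker v z z') * (1 / om z' ^ 5)))"
    proof (intro AE_I2)
      fix z'
      have "norm (ker v z z' * U z') \<le> norm (ker v z z') * (M * (1 / om z' ^ 5))"
        unfolding norm_mult by (intro mult_left_mono M) auto
      also have "\<dots> = M * (norm (ker v z z') * (1 / om z' ^ 5))" by (simp only: mult_ac)
      finally show "norm (ker v z z' * U z') \<le> norm (M * (norm (ker v z z') * (1 / om z' ^ 5)))"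
        unfolding real_norm_def by linarith
    qed
  qed auto
qed

text \<open>The transform \<open>U\<close> of \<open>f\<close> equals its sample series plus a
  combination of the \<open>cell h j\<close> plus \<open>G.op U\<close>. Solving the equation once
  for each \<open>samp i\<close> and each \<open>cell h j\<close> as right-hand side and
  synthesising gives \<open>H\<close> and \<open>v\<close>, which do not depend on \<open>f\<close>;
  only the coefficients \<open>\<mu>\<close> are integrals of \<open>U\<close>.\<close>

lemma approximate_reconstruction:
  "\<exists>H J v. (\<forall>i. H i \<in> schwartz_space) \<and> finite (J :: (int \<times> int \<times> bool) set) \<and> (\<forall>j\<in>J. v j \<in> schwartz_space) \<and>
     (\<forall>f\<in>schwartz_space. \<forall>k l. (\<lambda>i. norm (sample i f) * schwartz_seminorm k l (H i)) summable_on UNIV) \<and>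
     (\<forall>f\<in>schwartz_space. \<exists>\<mu>. \<forall>t. ((\<lambda>i. sample i f * H i t) has_sum (f t - (\<Sum>j\<in>J. \<mu> j * v j t))) UNIV)"
proof -
  obtain h N where h: "h > 0" and gk: "gaining_kernel (far_ker h N)" using far_ker_gaining by blast
  interpret G: gaining_kernel "far_ker h N" by (rule gk)
  obtain K where K: "\<And>n. 0 \<le> K n" and solve: "\<forall>V M. V \<in> borel_measurable borel \<longrightarrow> (\<forall>n z. norm (V z) \<le> M n * (1 / om z ^ (5 + n)))
     \<longrightarrow> (\<forall>n. M 0 \<le> M n) \<longrightarrow> (\<exists>W. W \<in> borel_measurable borel \<and> (\<forall>z. W z = V z + G.op W z)
       \<and> (\<forall>n z. norm (W z) \<le> K n * M n * (1 / om z ^ (5 + n))))"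
    using G.neumann_rapid by blast
  have "\<forall>n. \<exists>k\<ge>0. \<forall>i z. norm (samp i z) \<le> k * (wt i * br (node i) ^ (5 + n)) * (1 / om z ^ (5 + n))"
    using samp_bound by blast
  then obtain \<kappa> where \<kappa>: "\<And>n. 0 \<le> \<kappa> n" "\<And>n i z. norm (samp i z) \<le> \<kappa> n * (wt i * br (node i) ^ (5 + n)) * (1 / om z ^ (5 + n))"
    by metis
  \<comment> \<open>Partial sums of the constants dominate the constant of order 0, as
    \<open>neumann_rapid\<close> requires of the bounds.\<close>
  define \<kappa>s where "\<kappa>s n = (\<Sum>m\<le>n. \<kappa> m)" for n
  have \<kappa>s: "0 \<le> \<kappa>s n" "\<kappa> n \<le> \<kappa>s n" "\<kappa>s 0 \<le> \<kappa>s n" for n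
    unfolding \<kappa>s_def using \<kappa>(1) by (auto intro!: sum_nonneg member_le_sum sum_mono2)
  define Mi where "Mi i n = \<kappa>s n * (wt i * br (node i) ^ (5 + n))" for i n
  have wb: "0 \<le> wt i * br (node i) ^ n" for i n using wt_nonneg[of i] by simp
  have "\<exists>W. W \<in> borel_measurable borel \<and> (\<forall>z. W z = samp i z + G.op W z)
       \<and> (\<forall>n z. norm (W z) \<le> K n * Mi i n * (1 / om z ^ (5 + n)))" for i
  proof (rule solve[rule_format])
    show "norm (samp i z) \<le> Mi i n * (1 / om z ^ (5 + n))" for n z
      unfolding Mi_def by (rule order_trans[OF \<kappa>(2)[where n = n]]) (intro mult_right_mono \<kappa>s(2) wb, simp)
    show "Mi i 0 \<le> Mi i n" for n
      unfolding Mi_def by (intro mult_mono \<kappa>s mult_left_mono power_increasing br_ge1 wt_nonneg wb) auto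
  qed measurable
  then obtain A where A: "\<And>i. A i \<in> borel_measurable borel" "\<And>i z. A i z = samp i z + G.op (A i) z"
    "\<And>i n z. norm (A i z) \<le> K n * Mi i n * (1 / om z ^ (5 + n))" by metis
  have Ar: "rapid (A i)" for i using A(1,3) by (intro rapidI) blast+
  define Rn where "Rn n = (1 + 2 * (h * (real N + 1))) ^ (5 + n)" for n
  have "\<exists>W. W \<in> borel_measurable borel \<and> (\<forall>z. W z = cell h j z + G.op W z)
       \<and> (\<forall>n z. norm (W z) \<le> K n * Rn n * (1 / om z ^ (5 + n)))" if "j \<in> cells N" for j
  proof (rule solve[rule_format])
    show "norm (cell h j z) \<le> Rn n * (1 / om z ^ (5 + n))" for n z
      unfolding Rn_def by (rule cell_bound[OF h that])
    show "Rn 0 \<le> Rn n" for n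
      unfolding Rn_def using h by (intro power_increasing) auto
  qed measurable
  then obtain B where B: "\<And>j. j \<in> cells N \<Longrightarrow> B j \<in> borel_measurable borel" "\<And>j z. j \<in> cells N \<Longrightarrow> B j z = cell h j z + G.op (B j) z"
    "\<And>j n z. j \<in> cells N \<Longrightarrow> norm (B j z) \<le> K n * Rn n * (1 / om z ^ (5 + n))" by metis
  have Brp: "rapid (B j)" if "j \<in> cells N" for j
    using B(1,3)[OF that] by (intro rapidI) blast+
  define H where "H i = synth (A i)" for i
  define v where "v j = synth (B j)" for j
  have HS: "H i \<in> schwartz_space" for i unfolding H_def by (rule synth_schwartz[OF Ar])
  have summ: "(\<lambda>i. norm (sample i f) * schwartz_seminorm k l (H i)) summable_on UNIV" if f: "f \<in> schwartz_space" for f k l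
  proof -
    obtain C where C: "C \<ge> 0" "\<forall>U M. rapid U \<longrightarrow> (\<forall>z. norm (U z) \<le> M / om z ^ (k + l + 4))
     \<longrightarrow> schwartz_seminorm k l (synth U) \<le> C * M" using synth_seminorm by blast
    have sb: "schwartz_seminorm k l (H i) \<le> (C * K (k + l) * \<kappa>s (k + l)) * (wt i * br (node i) ^ (5 + (k + l)))" for i
    proof -
      let ?M = "K (k + l) * Mi i (k + l)"
      have M0: "0 \<le> ?M" unfolding Mi_def using K \<kappa>s(1) wb by simp
      have "norm (A i z) \<le> ?M / om z ^ (k + l + 4)" for z
      proof (rule order_trans[OF A(3)])
        have "?M * (1 / om z ^ (5 + (k + l))) \<le> ?M * (1 / om z ^ (k + l + 4))"
          by (intro mult_left_mono divide_left_mono power_increasing om_ge1 mult_pos_pos om_power_pos M0) auto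
        then show "?M * (1 / om z ^ (5 + (k + l))) \<le> ?M / om z ^ (k + l + 4)" by simp
      qed
      then have "schwartz_seminorm k l (H i) \<le> C * ?M" unfolding H_def using C(2) Ar by blast
      then show ?thesis unfolding Mi_def by (simp only: mult_ac)
    qed
    have "(\<lambda>i. (C * K (k + l) * \<kappa>s (k + l)) * (norm (sample i f) * (wt i * br (node i) ^ (5 + (k + l))))) summable_on UNIV"
      by (intro summable_on_cmult_right sample_summable f)
    then show ?thesis
    proof (rule summable_on_comparison_test)
      fix i
      have "norm (sample i f) * schwartz_seminorm k l (H i) \<le> norm (sample i f) * ((C * K (k + l) * \<kappa>s (k + l)) * (wt i * br (node i) ^ (5 + (k + l))))"
        by (intro mult_left_mono sb) simp
      then show "norm (sample i f) * schwartz_seminorm k l (H i) \<le> (C * K (k + l) * \<kappa>s (k + l)) * (norm (sample i f) * (wt i * br (node i) ^ (5 + (k + l))))"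
        by (simp only: mult_ac)
      show "0 \<le> norm (sample i f) * schwartz_seminorm k l (H i)"
        by (intro mult_nonneg_nonneg schwartz_seminorm_nonneg HS) simp
    qed
  qed
  have rep: "\<exists>\<mu>. \<forall>t. ((\<lambda>i. sample i f * H i t) has_sum (f t - (\<Sum>j\<in>cells N. \<mu> j * v j t))) UNIV" if f: "f \<in> schwartz_space" for f
  proof -
    define U where "U = stft f"
    have Ur: "rapid U" unfolding U_def by (rule rapid_stft[OF f])
    define \<mu> where "\<mu> j = (LINT z'|lborel. cell_fun h j z' * U z')" for j
    let ?c = "\<lambda>i. sample i f"
    define S where "S z = (\<Sum>\<^sub>\<infinity>i. ?c i * samp i z)" for z
    have Ueq: "U z = S z + (\<Sum>j\<in>cells N. \<mu> j * cell h j z) + G.op U z" for z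
    proof -
      have ni: "integrable lborel (\<lambda>z'. near_ker h N z z' * U z')"
        using ker_U_integrable[OF Ur] by (cases "box h N z") (auto simp: near_ker_def)
      have "G.op U z = (LINT z'|lborel. ker z z z' * U z' - near_ker h N z z' * U z')"
        unfolding G.op_def far_ker_def left_diff_distrib ..
      also have "\<dots> = (LINT z'|lborel. ker z z z' * U z') - (LINT z'|lborel. near_ker h N z z' * U z')"
        by (rule Bochner_Integration.integral_diff[OF ker_U_integrable[OF Ur] ni])
      finally show ?thesis
        using phase_identity[OF f, of z] unfolding near_ker_finite_rank \<mu>_def S_def U_def by simp
    qed
    define p where "p i = norm (?c i) * (\<kappa> 0 * (wt i * br (node i) ^ 5))" for i
    have psum: "p summable_on UNIV"
    proof -
      have "(\<lambda>i. \<kappa> 0 * (norm (?c i) * (wt i * br (node i) ^ 5))) summable_on UNIV"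
        by (intro summable_on_cmult_right sample_summable f)
      then show ?thesis unfolding p_def by (simp only: mult_ac)
    qed
    have ps: "p summable_on X" for X using psum by (rule summable_on_subset_banach) auto
    have cb: "norm (?c i * samp i z) \<le> p i * (1 / om z ^ 5)" for i z
    proof -
      have "norm (?c i) * norm (samp i z) \<le> norm (?c i) * (\<kappa> 0 * (wt i * br (node i) ^ (5 + 0)) * (1 / om z ^ (5 + 0)))"
        by (intro mult_left_mono \<kappa>(2)) simp
      then show ?thesis unfolding p_def norm_mult by (simp add: mult_ac)
    qed
    have cs: "(\<lambda>i. norm (?c i * samp i z)) summable_on X" for X z
      by (rule summable_on_comparison_test[OF summable_on_cmult_left[OF ps, of "1 / om z ^ 5"]]) (auto intro: cb[simplified times_divide_eq_right mult_1_right])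
    obtain C where C: "C \<ge> 0" "\<forall>U M. rapid U \<longrightarrow> (\<forall>z. norm (U z) \<le> M / om z ^ (0 + 0 + 4))
     \<longrightarrow> schwartz_seminorm 0 0 (synth U) \<le> C * M" using synth_seminorm by blast
    have main: "norm ((f t - (\<Sum>j\<in>cells N. \<mu> j * v j t)) - (\<Sum>i\<in>F. ?c i * H i t)) \<le> C * (2 * (infsum p UNIV - sum p F))"
      if F: "finite F" for F t
    proof -
      \<comment> \<open>\<open>D\<close> is what the partial sum over \<open>F\<close> leaves of
        \<open>U'\<close>. It solves the same equation with the tail \<open>r\<close> of the sample
        series as right-hand side, so \<open>neumann_estimate\<close> bounds it by the tail of
        \<open>p\<close>. Infinite sums are thus never interchanged with \<open>G.op\<close> or
        \<open>synth\<close>.\<close>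
      define U' where "U' z = U z - (\<Sum>j\<in>cells N. \<mu> j * B j z)" for z
      define D where "D z = U' z - (\<Sum>i\<in>F. ?c i * A i z)" for z
      define e where "e = infsum p UNIV - sum p F"
      have U'r: "rapid U'" unfolding U'_def by (intro rapid_diff_sum Ur Brp finite_cells)
      have Dr: "rapid D" unfolding D_def by (intro rapid_diff_sum U'r Ar F)
      define r where "r z = S z - (\<Sum>i\<in>F. ?c i * samp i z)" for z
      have "D z = r z + G.op D z" for z
      proof -
        have 1: "G.op D z = G.op U' z - (\<Sum>i\<in>F. ?c i * G.op (A i) z)"
          unfolding D_def by (rule G.op_diff_sum[OF U'r Ar])
        have 2: "G.op U' z = G.op U z - (\<Sum>j\<in>cells N. \<mu> j * G.op (B j) z)"
          unfolding U'_def by (rule G.op_diff_sum[OF Ur Brp])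
        have 3: "(\<Sum>j\<in>cells N. \<mu> j * B j z) = (\<Sum>j\<in>cells N. \<mu> j * cell h j z) + (\<Sum>j\<in>cells N. \<mu> j * G.op (B j) z)"
          unfolding sum.distrib[symmetric] by (intro sum.cong refl) (subst B(2), auto simp: distrib_left)
        have 4: "(\<Sum>i\<in>F. ?c i * A i z) = (\<Sum>i\<in>F. ?c i * samp i z) + (\<Sum>i\<in>F. ?c i * G.op (A i) z)"
          unfolding sum.distrib[symmetric] by (intro sum.cong refl) (subst A(2), auto simp: distrib_left)
        show ?thesis unfolding 1 2 D_def[of z] U'_def[of z] 3 4 r_def using Ueq[of z] by simp
      qed
      moreover obtain M where "\<And>z. norm (D z) \<le> M * (1 / om z ^ 5)" using rapid_bound_mult[OF Dr] by metis
      moreover have "norm (r z) \<le> e * (1 / om z ^ 5)" for z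
      proof -
        let ?s = "\<lambda>i. ?c i * samp i z"
        have "infsum ?s UNIV = infsum ?s F + infsum ?s (UNIV - F)"
          using infsum_Diff[of ?s UNIV F] abs_summable_summable[OF cs] by simp
        then have "norm (r z) = norm (infsum ?s (UNIV - F))" unfolding r_def S_def using F by simp
        also have "\<dots> \<le> infsum (\<lambda>i. norm (?s i)) (UNIV - F)" by (rule norm_infsum_bound[OF cs])
        also have "\<dots> \<le> infsum (\<lambda>i. p i * (1 / om z ^ 5)) (UNIV - F)"
          by (intro infsum_mono cs summable_on_cmult_left ps cb)
        also have "\<dots> = infsum p (UNIV - F) * (1 / om z ^ 5)" by (rule infsum_cmult_left) (rule ps)
        also have "infsum p (UNIV - F) = e" unfolding e_def using infsum_Diff[of p UNIV F] ps F by simp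
        finally show ?thesis .
      qed
      ultimately have Db: "norm (D z) \<le> 2 * e * (1 / om z ^ 5)" for z
        by (rule G.neumann_estimate)
      have e0: "0 \<le> 2 * e" by (rule G.bound_nonneg[OF Db])
      have "norm (D z) \<le> (2 * e) / om z ^ (0 + 0 + 4)" for z
      proof (rule order_trans[OF Db])
        have "2 * e * (1 / om z ^ 5) \<le> 2 * e * (1 / om z ^ (0 + 0 + 4))"
          by (intro mult_left_mono divide_left_mono power_increasing om_ge1 mult_pos_pos om_power_pos e0) auto
        then show "2 * e * (1 / om z ^ 5) \<le> (2 * e) / om z ^ (0 + 0 + 4)" by simp
      qed
      then have "schwartz_seminorm 0 0 (synth D) \<le> C * (2 * e)" using C(2) Dr by blast
      then have "norm (synth D t) \<le> C * (2 * e)"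
        using schwartz_seminorm_upper[OF synth_schwartz[OF Dr], of t 0 0] by simp
      moreover have "synth D t = (f t - (\<Sum>j\<in>cells N. \<mu> j * v j t)) - (\<Sum>i\<in>F. ?c i * H i t)"
      proof -
        have "synth D t = synth U' t - (\<Sum>i\<in>F. ?c i * H i t)" unfolding D_def H_def by (rule synth_linear[OF U'r Ar])
        also have "synth U' t = synth U t - (\<Sum>j\<in>cells N. \<mu> j * v j t)" unfolding U'_def v_def by (rule synth_linear[OF Ur Brp])
        also have "synth U t = f t" unfolding U_def by (rule synth_stft[OF f])
        finally show ?thesis .
      qed
      ultimately show ?thesis unfolding e_def by simp
    qed
    have lim: "((\<lambda>F. C * (2 * (infsum p UNIV - sum p F))) \<longlongrightarrow> C * (2 * (infsum p UNIV - infsum p UNIV))) (finite_subsets_at_top UNIV)"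
      by (intro tendsto_intros infsum_tendsto psum)
    have "((\<lambda>i. ?c i * H i t) has_sum (f t - (\<Sum>j\<in>cells N. \<mu> j * v j t))) UNIV" for t
      unfolding has_sum_def
    proof (rule LIM_zero_cancel, rule Lim_null_comparison)
      show "\<forall>\<^sub>F F in finite_subsets_at_top UNIV. norm ((\<Sum>i\<in>F. ?c i * H i t) - (f t - (\<Sum>j\<in>cells N. \<mu> j * v j t))) \<le> C * (2 * (infsum p UNIV - sum p F))"
        by (rule eventually_finite_subsets_at_top_weakI) (subst norm_minus_commute, rule main)
      show "((\<lambda>F. C * (2 * (infsum p UNIV - sum p F))) \<longlongrightarrow> 0) (finite_subsets_at_top UNIV)"
        using lim by simp
    qed
    then show ?thesis by blast
  qed
  have vS: "\<forall>j\<in>cells N. v j \<in> schwartz_space" unfolding v_def using synth_schwartz[OF Brp] by blast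
  show ?thesis
    using HS vS finite_cells summ rep by (intro exI[of _ H] exI[of _ "cells N"] exI[of _ v]) blast
qed

end

section \<open>The samples determine a Schwartz function\<close>

text \<open>The clause \<open>z < Max Z\<close> keeps the zeros from the induction apart from the
  one that the mean value theorem adds between the two largest zeros of \<open>f\<close>, so that
  none is counted twice.\<close>

lemma rolle_zeros:
  fixes f f' :: "real \<Rightarrow> real"
  assumes f: "\<And>t. (f has_real_derivative f' t) (at t)"
    and Z: "finite Z" "card Z = Suc n" "\<And>z. z \<in> Z \<Longrightarrow> f z = 0"
  shows "\<exists>Z'. finite Z' \<and> card Z' = n \<and> (\<forall>z\<in>Z'. f' z = 0 \<and> z < Max Z)"
  using Z
proof (induction n arbitrary: Z)
  case 0
  show ?case by (rule exI[of _ "{}"]) simp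
next
  case (Suc n)
  define m where "m = Max Z"
  have m: "m \<in> Z" unfolding m_def using Suc.prems by (intro Max_in) auto
  define Y where "Y = Z - {m}"
  have Y: "finite Y" "card Y = Suc n" using Suc.prems m by (auto simp: Y_def)
  have Yz: "\<And>z. z \<in> Y \<Longrightarrow> f z = 0" using Suc.prems by (auto simp: Y_def)
  obtain Z' where Z': "finite Z'" "card Z' = n" "\<forall>z\<in>Z'. f' z = 0 \<and> z < Max Y"
    using Suc.IH[OF Y Yz] by blast
  have MY: "Max Y \<in> Y" using Y by (intro Max_in) auto
  then have "Max Y \<le> m" "Max Y \<noteq> m" using Suc.prems(1) by (auto simp: Y_def m_def)
  then have lt: "Max Y < m" by simp
  obtain c where c: "Max Y < c" "c < m" "f m - f (Max Y) = (m - Max Y) * f' c"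
    using MVT2[OF lt, of f f'] f by blast
  have "f' c = 0" using c lt Yz[OF MY] Suc.prems(3)[OF m] by simp
  moreover have "c \<notin> Z'" using Z'(3) c by force
  ultimately show ?case
    using Z' c lt by (intro exI[of _ "insert c Z'"]) (auto simp: m_def[symmetric])
qed

lemma higher_rolle:
  fixes u :: "nat \<Rightarrow> real \<Rightarrow> real"
  assumes u: "\<And>i t. (u i has_real_derivative u (Suc i) t) (at t)"
    and Z: "finite Z" "card Z = Suc k" "\<And>z. z \<in> Z \<Longrightarrow> u 0 z = 0"
  shows "\<exists>\<xi>. u k \<xi> = 0"
  using u Z
proof (induction k arbitrary: u Z)
  case 0
  then obtain z where "z \<in> Z" by fastforce
  then show ?case using 0 by blast
next
  case (Suc k)
  obtain Z' where Z': "finite Z'" "card Z' = Suc k" "\<forall>z\<in>Z'. u 1 z = 0 \<and> z < Max Z"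
    using rolle_zeros[of "u 0" "u 1" Z "Suc k"] Suc.prems by auto
  from Suc.IH[of "\<lambda>i. u (Suc i)" Z'] show ?case using Z' Suc.prems(1) by auto
qed

lemma higher_pderiv_top:
  fixes q :: "real poly"
  assumes "degree q \<le> k" shows "poly ((pderiv ^^ k) q) s = fact k * coeff q k"
  using assms
proof (induction k arbitrary: q)
  case 0
  then obtain c where "q = [:c:]" using degree_eq_zeroE by auto
  then show ?case by simp
next
  case (Suc k)
  have "degree (pderiv q) \<le> k" using Suc.prems by (simp add: degree_pderiv)
  from Suc.IH[OF this] show ?case by (simp add: funpow_swap1 coeff_pderiv mult_ac)
qed

lemma root_poly:
  fixes Z :: "real set"
  assumes "finite Z"
  shows "degree (\<Prod>z\<in>Z. [:- z, 1:]) = card Z" "coeff (\<Prod>z\<in>Z. [:- z, 1:]) (card Z) = 1"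
    "poly (\<Prod>z\<in>Z. [:- z, 1:]) t = (\<Prod>z\<in>Z. t - z)"
proof -
  have d: "degree (\<Prod>z\<in>Z. [:- z, 1:]) = card Z"
    by (subst degree_prod_eq_sum_degree) auto
  then show "degree (\<Prod>z\<in>Z. [:- z, 1:]) = card Z" .
  show "coeff (\<Prod>z\<in>Z. [:- z, 1:]) (card Z) = 1"
    using lead_coeff_prod[of "\<lambda>z. [:- z, 1:]" Z] unfolding d by simp
  show "poly (\<Prod>z\<in>Z. [:- z, 1:]) t = (\<Prod>z\<in>Z. t - z)"
    by (simp add: poly_prod)
qed

text \<open>Subtracting the multiple of \<open>q\<close>, the monic polynomial with root set
  \<open>Z\<close>, that makes the difference vanish at \<open>t\<close> as well leaves
  \<open>card Z + 1\<close> zeros. By Rolle the derivative of order \<open>card Z\<close> of the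
  difference has a zero, and that derivative of \<open>q\<close> is
  \<open>fact (card Z)\<close>.\<close>

lemma lagrange_bound:
  fixes u :: "nat \<Rightarrow> real \<Rightarrow> real"
  assumes u: "\<And>i t. (u i has_real_derivative u (Suc i) t) (at t)"
    and Z: "finite Z" "\<And>z. z \<in> Z \<Longrightarrow> u 0 z = 0" and M: "\<And>s. \<bar>u (card Z) s\<bar> \<le> M"
  shows "\<bar>u 0 t\<bar> \<le> M * (\<Prod>z\<in>Z. \<bar>t - z\<bar>) / fact (card Z)"
proof (cases "t \<in> Z")
  case True
  have "0 \<le> M" using M[of 0] by linarith
  then show ?thesis using True Z(2) by (simp add: prod_nonneg)
next
  case False
  define k where "k = card Z"
  define q where "q = (\<Prod>z\<in>Z. [:- z, 1:])"
  note q = root_poly[OF Z(1), folded q_def k_def]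
  have qt: "poly q t \<noteq> 0" using False Z(1) by (auto simp: q(3))
  define c where "c = u 0 t / poly q t"
  define v where "v i s = u i s - c * poly ((pderiv ^^ i) q) s" for i s
  have "\<exists>\<xi>. v k \<xi> = 0"
  proof (rule higher_rolle)
    show "(v i has_real_derivative v (Suc i) s) (at s)" for i s
      unfolding v_def[abs_def] by (auto intro!: derivative_eq_intros u poly_DERIV)
    show "finite (insert t Z)" "card (insert t Z) = Suc k" using Z(1) False by (auto simp: k_def)
    show "v 0 z = 0" if "z \<in> insert t Z" for z
    proof (cases "z = t")
      case True
      then show ?thesis using qt by (simp add: v_def c_def)
    next
      case False
      then have "z \<in> Z" using that by simp
      then show ?thesis using Z q(3)[of z] by (auto simp: v_def)
    qed
  qed
  then obtain \<xi> where "v k \<xi> = 0" by blast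
  then have "u k \<xi> = c * fact k"
    using higher_pderiv_top[of q k \<xi>] q by (simp add: v_def)
  then have "u 0 t = u k \<xi> / fact k * poly q t" using qt by (simp add: c_def)
  then have "\<bar>u 0 t\<bar> = \<bar>u k \<xi>\<bar> * \<bar>poly q t\<bar> / fact k" by (simp add: abs_mult)
  also have "\<dots> \<le> M * \<bar>poly q t\<bar> / fact k"
    using M[of \<xi>] by (intro divide_right_mono mult_right_mono) (auto simp: k_def)
  finally show ?thesis by (simp add: q(3) abs_prod k_def)
qed

text \<open>Rolle needs real functions, so real and imaginary part are treated separately; hence the
  factor 2.\<close>

lemma schwartz_lagrange:
  assumes f: "f \<in> schwartz_space" and Z: "finite Z" "card Z = k" "\<And>z. z \<in> Z \<Longrightarrow> f z = 0"
    and M: "\<And>s. norm (iter_deriv k f s) \<le> M"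
  shows "norm (f t) \<le> 2 * (M * (\<Prod>z\<in>Z. \<bar>t - z\<bar>) / fact k)"
proof -
  have d: "(iter_deriv i f has_vector_derivative iter_deriv (Suc i) f s) (at s)" for i s
    by (rule iter_deriv_has_vector_derivative[OF f])
  have "((\<lambda>s. Re (iter_deriv i f s)) has_real_derivative Re (iter_deriv (Suc i) f s)) (at s)"
    "((\<lambda>s. Im (iter_deriv i f s)) has_real_derivative Im (iter_deriv (Suc i) f s)) (at s)" for i s
    using has_vector_derivative_complex_iff[of "iter_deriv i f" "iter_deriv (Suc i) f s" "at s"] d
    by (auto simp: has_real_derivative_iff_has_vector_derivative)
  note dd = this
  have "\<bar>Re (iter_deriv (card Z) f s)\<bar> \<le> M" "\<bar>Im (iter_deriv (card Z) f s)\<bar> \<le> M" for s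
    using M[of s] Z(2) order_trans[OF abs_Re_le_cmod] order_trans[OF abs_Im_le_cmod] by auto
  note MM = this
  have "\<bar>Re (f t)\<bar> \<le> M * (\<Prod>z\<in>Z. \<bar>t - z\<bar>) / fact k"
    using lagrange_bound[where u = "\<lambda>i s. Re (iter_deriv i f s)", OF dd(1) Z(1) _ MM(1), of t] Z by simp
  moreover have "\<bar>Im (f t)\<bar> \<le> M * (\<Prod>z\<in>Z. \<bar>t - z\<bar>) / fact k"
    using lagrange_bound[where u = "\<lambda>i s. Im (iter_deriv i f s)", OF dd(2) Z(1) _ MM(2), of t] Z by simp
  ultimately show ?thesis using cmod_le[of "f t"] by linarith
qed

context sampling begin

text \<open>Steps of length \<open>\<delta>\<close>, at least twice the bound on the gaps, lead from
  \<open>t\<close> away from the origin, where that bound only decreases; the nodes below the points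
  reached are distinct. The one of index \<open>j\<close> lies within
  \<open>2 * j * \<delta>\<close> of \<open>t\<close>, so the product of the distances contributes a
  \<open>fact k\<close> that cancels the one in the interpolation error.\<close>

lemma zero_samples_bound:
  assumes f: "f \<in> schwartz_space" and z: "\<And>n. f (x n) = 0"
    and M: "\<And>s. norm (iter_deriv k f s) \<le> M"
  shows "norm (f t) \<le> 2 * M * (4 * (C0 + 1) / br t ^ 3) ^ k"
proof -
  \<comment> \<open>\<open>C0 + 1\<close> in place of \<open>C0\<close> keeps
    \<open>\<delta>\<close> positive.\<close>
  define \<delta> where "\<delta> = 2 * (C0 + 1) / br t ^ 3"
  have \<delta>: "\<delta> > 0" unfolding \<delta>_def using C0 by (intro divide_pos_pos) (auto simp: br_pos)
  define \<sigma> :: real where "\<sigma> = (if t \<ge> 0 then 1 else - 1)"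
  define a where "a j = t + \<sigma> * real j * \<delta>" for j
  have ap: "a j - \<delta> / 2 \<le> p (a j)" "p (a j) \<le> a j" for j
  proof -
    have "0 \<le> real j * \<delta>" using \<delta> by simp
    then have "br t \<le> br (a j)" by (auto simp: br_def a_def \<sigma>_def)
    then have "C0 / br (a j) ^ 3 \<le> (C0 + 1) / br t ^ 3"
      using C0 by (intro frac_le power_mono) (auto simp: br_pos)
    moreover have "2 * c / d / 2 = c / d" for c d :: real by simp
    then have "\<delta> / 2 = (C0 + 1) / br t ^ 3" unfolding \<delta>_def .
    ultimately show "a j - \<delta> / 2 \<le> p (a j)" "p (a j) \<le> a j"
      using p_gap[of "a j"] p_le[of "a j"] by linarith+
  qed
  have inj: "inj_on (\<lambda>j. p (a j)) {1..k}"
  proof (rule inj_onI)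
    fix i j assume eq: "p (a i) = p (a j)"
    have "\<bar>a i - a j\<bar> \<le> \<delta> / 2" using ap[of i] ap[of j] eq by linarith
    moreover have "\<bar>a i - a j\<bar> = \<bar>real i - real j\<bar> * \<delta>"
    proof -
      have "a i - a j = \<sigma> * ((real i - real j) * \<delta>)" by (simp add: a_def algebra_simps)
      then show ?thesis using \<delta> by (simp add: abs_mult \<sigma>_def)
    qed
    ultimately have "\<bar>real i - real j\<bar> * \<delta> < 1 * \<delta>" using \<delta> by linarith
    then have "\<bar>real i - real j\<bar> < 1" using \<delta> by (simp only: mult_less_cancel_right_pos)
    then show "i = j" by linarith
  qed
  define Z where "Z = (\<lambda>j. p (a j)) ` {1..k}"
  have cZ: "finite Z" "card Z = k" using inj by (auto simp: Z_def card_image)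
  have M0: "0 \<le> M" using order_trans[OF norm_ge_zero M] .
  have "norm (f t) \<le> 2 * (M * (\<Prod>z\<in>Z. \<bar>t - z\<bar>) / fact k)"
    by (rule schwartz_lagrange[OF f cZ _ M]) (auto simp: Z_def p_def z)
  also have "(\<Prod>z\<in>Z. \<bar>t - z\<bar>) = (\<Prod>j\<in>{1..k}. \<bar>t - p (a j)\<bar>)"
    unfolding Z_def using inj by (simp add: prod.reindex o_def)
  also have "2 * (M * (\<Prod>j\<in>{1..k}. \<bar>t - p (a j)\<bar>) / fact k) \<le> 2 * (M * (\<Prod>j\<in>{1..k}. real j * (2 * \<delta>)) / fact k)"
  proof (intro mult_left_mono divide_right_mono prod_mono conjI M0)
    fix j assume j: "j \<in> {1..k}"
    have "\<bar>t - a j\<bar> = real j * \<delta>" using \<delta> by (simp add: a_def \<sigma>_def abs_mult)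
    moreover have "1 * \<delta> \<le> real j * \<delta>" using j \<delta> by (intro mult_right_mono) auto
    ultimately show "\<bar>t - p (a j)\<bar> \<le> real j * (2 * \<delta>)" using ap[of j] \<delta> by linarith
  qed auto
  also have "(\<Prod>j\<in>{1..k}. real j * (2 * \<delta>)) = fact k * (2 * \<delta>) ^ k"
    by (simp add: prod.distrib fact_prod)
  also have "2 * (M * (fact k * (2 * \<delta>) ^ k) / fact k) = 2 * M * (2 * \<delta>) ^ k" by simp
  also have "2 * \<delta> = 4 * (C0 + 1) / br t ^ 3" by (simp add: \<delta>_def)
  finally show ?thesis .
qed

end

section \<open>Moments of a function and of its Fourier transform\<close>

definition mom :: "nat \<Rightarrow> (real \<Rightarrow> complex) \<Rightarrow> real" where
  "mom k f = (LINT t|lborel. br t ^ k * norm (f t))"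

lemma integrable_mom:
  assumes f: "f \<in> schwartz_space" shows "integrable lborel (\<lambda>t. br t ^ k * norm (f t))"
proof -
  note [measurable] = sch_measurable[OF f]
  obtain A where A: "A \<ge> 0" "\<And>t. norm (f t) \<le> A / br t ^ (k + 2)" using sch_decay0[OF f] by metis
  show ?thesis
  proof (rule Bochner_Integration.integrable_bound[OF integrable_mult_right[OF integrable_br2, of A]])
    show "AE t in lborel. norm (br t ^ k * norm (f t)) \<le> norm (A * (1 / br t ^ 2))"
    proof (intro AE_I2)
      fix t
      have "br t ^ k * norm (f t) \<le> br t ^ k * (A / br t ^ (k + 2))" by (intro mult_left_mono A(2)) simp
      also have "\<dots> = A * (1 / br t ^ 2)" unfolding power_add by simp
      finally show "norm (br t ^ k * norm (f t)) \<le> norm (A * (1 / br t ^ 2))" using A(1) by simp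
    qed
  qed measurable
qed

lemma mom_nonneg: "0 \<le> mom k f"
  unfolding mom_def by (rule integral_nonneg_AE) simp

lemma iter_deriv_schwartz: "f \<in> schwartz_space \<Longrightarrow> iter_deriv k f \<in> schwartz_space"
proof (induction k)
  case (Suc k)
  have "iter_deriv (Suc k) f = iter_deriv 1 (iter_deriv k f)" by (simp add: iter_deriv_Suc)
  then show ?case using sch_deriv Suc by simp
qed simp

lemma fourier_iter_deriv:
  assumes f: "f \<in> schwartz_space"
  shows "fourier (iter_deriv k f) \<xi> = (2 * pi * \<i> * \<xi>) ^ k * fourier f \<xi>"
proof (induction k)
  case (Suc k)
  have "iter_deriv (Suc k) f = iter_deriv 1 (iter_deriv k f)" by (simp add: iter_deriv_Suc)
  then show ?case using fourier_deriv[OF iter_deriv_schwartz[OF f], of k \<xi>] Suc.IH by simp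
qed simp

lemma schwartz_inversion:
  assumes f: "f \<in> schwartz_space"
  shows "(LINT \<xi>|lborel. fourier f \<xi> * cis (2 * pi * s * \<xi>)) = f s"
proof -
  obtain A where A: "A \<ge> 0" "\<And>t. norm (f t) \<le> A / br t ^ 0" using sch_decay0[OF f] by metis
  show ?thesis
    by (rule fourier_inversion[where B = A, OF sch_integrable[OF f] sch_continuous[OF f] _ sch_integrable[OF fourier_schwartz(1)[OF f]]])
       (use A(2) in simp)
qed

lemma iter_deriv_le_mom:
  assumes f: "f \<in> schwartz_space"
  shows "norm (iter_deriv k f s) \<le> (2 * pi) ^ k * mom k (fourier f)"
proof -
  have "norm (iter_deriv k f s) = norm (LINT \<xi>|lborel. fourier (iter_deriv k f) \<xi> * cis (2 * pi * s * \<xi>))"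
    using schwartz_inversion[OF iter_deriv_schwartz[OF f]] by simp
  also have "\<dots> \<le> (LINT \<xi>|lborel. (2 * pi) ^ k * (br \<xi> ^ k * norm (fourier f \<xi>)))"
  proof (rule norm_integral_le)
    fix \<xi>
    have "norm (fourier (iter_deriv k f) \<xi> * cis (2 * pi * s * \<xi>)) = (2 * pi) ^ k * (\<bar>\<xi>\<bar> ^ k * norm (fourier f \<xi>))"
      unfolding fourier_iter_deriv[OF f] by (simp add: norm_mult norm_power power_mult_distrib mult_ac)
    also have "\<dots> \<le> (2 * pi) ^ k * (br \<xi> ^ k * norm (fourier f \<xi>))"
      by (intro mult_left_mono mult_right_mono power_mono) (auto simp: br_def)
    finally show "norm (fourier (iter_deriv k f) \<xi> * cis (2 * pi * s * \<xi>)) \<le> (2 * pi) ^ k * (br \<xi> ^ k * norm (fourier f \<xi>))" .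
  qed (intro integrable_mult_right integrable_mom fourier_schwartz f)
  finally show ?thesis by (simp add: mom_def)
qed

lemma mom_fourier_fourier:
  assumes f: "f \<in> schwartz_space"
  shows "mom k (fourier (fourier f)) = mom k f"
proof -
  have "fourier (fourier f) \<xi> = f (- \<xi>)" for \<xi>
    using schwartz_inversion[OF f, of "- \<xi>"] unfolding fourier_cis[of "fourier f"] by (simp add: mult_ac)
  then have "mom k (fourier (fourier f)) = (LINT t|lborel. br (- t) ^ k * norm (f (- t)))"
    by (simp add: mom_def)
  also have "\<dots> = mom k f"
    using lborel_integral_real_affine[of "- 1" "\<lambda>t. br t ^ k * norm (f t)" 0] by (simp add: mom_def)
  finally show ?thesis .
qed

text \<open>Decay of order \<open>3 * j\<close> is what \<open>zero_samples_bound\<close> delivers;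
  two powers beyond \<open>k\<close> pay for integrability.\<close>

lemma mom_le:
  assumes f: "f \<in> schwartz_space" and b: "\<And>t. norm (f t) \<le> A / br t ^ (3 * j)" and j: "k + 2 \<le> 3 * j"
  shows "mom k f \<le> A * brint"
proof -
  have A: "0 \<le> A" using order_trans[OF norm_ge_zero b[of 0]] by (simp add: br_def)
  have "mom k f \<le> (LINT t|lborel. A * (1 / br t ^ 2))"
    unfolding mom_def
  proof (intro integral_mono integrable_mom f integrable_mult_right integrable_br2)
    fix t
    have "br t ^ k * norm (f t) \<le> br t ^ k * (A / br t ^ (k + 2))"
    proof (intro mult_left_mono order_trans[OF b])
      show "A / br t ^ (3 * j) \<le> A / br t ^ (k + 2)"
        using j by (intro divide_left_mono power_increasing br_ge1 A mult_pos_pos br_power_pos)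
    qed simp
    also have "\<dots> = A * (1 / br t ^ 2)" unfolding power_add by simp
    finally show "br t ^ k * norm (f t) \<le> A * (1 / br t ^ 2)" .
  qed
  then show ?thesis by (simp only: integral_mult_right_zero brint_def)
qed

text \<open>\<open>(k + 4) div 3\<close> is the least \<open>j\<close> with \<open>k + 2 \<le> 3 * j\<close>, as needed in \<open>mom_le\<close>.\<close>

lemma moment_growth:
  fixes a :: "nat \<Rightarrow> real"
  assumes a0: "\<And>k. 0 \<le> a k" and L: "1 \<le> L" and step: "\<And>k. 3 \<le> k \<Longrightarrow> a k \<le> L ^ k * a ((k + 4) div 3)"
  shows "a k \<le> (a 0 + a 1 + a 2) * (L ^ 6) ^ k"
proof (induction k rule: less_induct)
  case (less k)
  let ?B = "a 0 + a 1 + a 2"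
  show ?case
  proof (cases "k < 3")
    case True
    then have "k = 0 \<or> k = 1 \<or> k = 2" by linarith
    then have "a k \<le> ?B * 1" using a0[of 0] a0[of 1] a0[of 2] by auto
    also have "\<dots> \<le> ?B * (L ^ 6) ^ k" using a0[of 0] a0[of 1] a0[of 2] L by (intro mult_left_mono one_le_power) auto
    finally show ?thesis .
  next
    case False
    let ?j = "(k + 4) div 3"
    \<comment> \<open>The exponent 6 is chosen for this: \<open>3 * ?j \<le> k + 4\<close> gives
      \<open>k + 6 * ?j \<le> 3 * k + 8\<close>, which is at most \<open>6 * k\<close> as soon as
      \<open>k \<ge> 3\<close>.\<close>
    have j: "?j < k" "k + 6 * ?j \<le> 6 * k" using False by linarith+
    have "a k \<le> L ^ k * (?B * (L ^ 6) ^ ?j)"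
      using False less.IH[OF j(1)] L by (intro order_trans[OF step[of k]] mult_left_mono) auto
    also have "\<dots> = ?B * L ^ (k + 6 * ?j)" by (simp add: power_add power_mult)
    also have "\<dots> \<le> ?B * L ^ (6 * k)" using j(2) L a0[of 0] a0[of 1] a0[of 2] by (intro mult_left_mono power_increasing) auto
    finally show ?thesis by (simp add: power_mult)
  qed
qed

context two_samplings begin

lemma samples_determine:
  assumes f: "f \<in> schwartz_space" and z: "\<And>i. sample i f = 0"
  shows "f t = 0"
proof -
  let ?g = "fourier f"
  have g: "?g \<in> schwartz_space" by (rule fourier_schwartz(1)[OF f])
  have fz: "f (x n) = 0" and gz: "?g (y n) = 0" for n
    using z[of "Inl n"] z[of "Inr n"] by (auto simp: sample_def)
  \<comment> \<open>Derivatives of one function are bounded by moments of the other, so the decay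
    bounds cross over between \<open>f\<close> and \<open>?g\<close>. Only the sum of the two
    moments satisfies a closed recursion.\<close>
  define a where "a k = mom k f + mom k ?g" for k
  have a0: "0 \<le> a k" for k by (simp add: a_def mom_nonneg)
  define K where "K = 4 * (max C C' + 1)"
  have K: "0 \<le> K" "4 * (C + 1) \<le> K" "4 * (C' + 1) \<le> K" "0 \<le> 4 * (C + 1)" "0 \<le> 4 * (C' + 1)"
    unfolding K_def using X.C0 Y.C0 by auto
  define \<Lambda> where "\<Lambda> = max 1 (2 * pi * K)"
  have \<Lambda>: "1 \<le> \<Lambda>" "0 \<le> \<Lambda>" "2 * pi * K \<le> \<Lambda>" by (auto simp: \<Lambda>_def)
  have bd: "2 * ((2 * pi) ^ k * m) * (c / br t ^ 3) ^ k \<le> (2 * \<Lambda> ^ k * a k) / br t ^ (3 * k)"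
    if "m \<le> a k" "0 \<le> m" "c \<le> K" "0 \<le> c" for m c k t
  proof -
    have "2 * ((2 * pi) ^ k * m) * (c / br t ^ 3) ^ k = 2 * ((2 * pi * c) ^ k * m) / br t ^ (3 * k)"
      by (simp add: power_mult_distrib power_divide power_mult)
    also have "\<dots> \<le> 2 * (\<Lambda> ^ k * a k) / br t ^ (3 * k)"
    proof (intro divide_right_mono mult_left_mono mult_mono power_mono that)
      have "2 * pi * c \<le> 2 * pi * K" using that by (intro mult_left_mono) auto
      then show "2 * pi * c \<le> \<Lambda>" using \<Lambda>(3) by linarith
    qed (use that \<Lambda> in auto)
    finally show ?thesis by simp
  qed
  have fb: "norm (f t) \<le> (2 * \<Lambda> ^ k * a k) / br t ^ (3 * k)" for k t
    by (rule order_trans[OF X.zero_samples_bound[OF f fz iter_deriv_le_mom[OF f, of k]] bd])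
       (use K mom_nonneg in \<open>auto simp: a_def\<close>)
  have gb: "norm (?g t) \<le> (2 * \<Lambda> ^ k * a k) / br t ^ (3 * k)" for k t
    by (rule order_trans[OF Y.zero_samples_bound[OF g gz iter_deriv_le_mom[OF g, of k, unfolded mom_fourier_fourier[OF f]]] bd])
       (use K mom_nonneg in \<open>auto simp: a_def\<close>)
  define L where "L = max 1 (4 * brint) * \<Lambda>"
  have L: "1 \<le> L" unfolding L_def using mult_mono[of 1 "max 1 (4 * brint)" 1 \<Lambda>] \<Lambda> by simp
  \<comment> \<open>Decay of order \<open>3 * ?j\<close> costs a moment of order \<open>?j\<close>
    only, about a third of \<open>k\<close>: here the exponent 3 of the gaps makes the recursion
    descend.\<close>
  have step: "a k \<le> L ^ k * a ((k + 4) div 3)" if k: "3 \<le> k" for k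
  proof -
    let ?j = "(k + 4) div 3"
    have j: "k + 2 \<le> 3 * ?j" "?j \<le> k" using k by linarith+
    have "a k \<le> (2 * \<Lambda> ^ ?j * a ?j) * brint + (2 * \<Lambda> ^ ?j * a ?j) * brint"
      unfolding a_def[of k] by (intro add_mono mom_le[OF f fb j(1)] mom_le[OF g gb j(1)])
    also have "\<dots> = (4 * brint * \<Lambda> ^ ?j) * a ?j" by simp
    also have "\<dots> \<le> L ^ k * a ?j"
    proof (intro mult_right_mono a0)
      have "max 1 (4 * brint) ^ 1 \<le> max 1 (4 * brint) ^ k" using k by (intro power_increasing) auto
      moreover have "\<Lambda> ^ ?j \<le> \<Lambda> ^ k" using j \<Lambda>(1) by (intro power_increasing) auto
      ultimately have "(4 * brint) * \<Lambda> ^ ?j \<le> max 1 (4 * brint) ^ k * \<Lambda> ^ k"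
        using \<Lambda> brint_nonneg by (intro mult_mono) auto
      then show "4 * brint * \<Lambda> ^ ?j \<le> L ^ k" by (simp add: L_def power_mult_distrib)
    qed
    finally show ?thesis .
  qed
  define B where "B = a 0 + a 1 + a 2"
  have growth: "a k \<le> B * (L ^ 6) ^ k" for k
    unfolding B_def by (rule moment_growth[OF a0 L step])
  have B: "0 \<le> B" using a0 by (simp add: B_def)
  define R where "R = 2 * (\<Lambda> * L ^ 6)"
  have R: "0 < R" unfolding R_def using \<Lambda> L by simp
  \<comment> \<open>Beyond \<open>R\<close> the decay bound is \<open>2 * B\<close> times the power
    \<open>k\<close> of a ratio at most 1/2, and \<open>k\<close> is arbitrary.\<close>
  have vanish: "f t = 0" if t: "R \<le> \<bar>t\<bar>" for t
  proof -
    have R3: "R \<le> br t ^ 3"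
    proof -
      have "R \<le> br t ^ 1" using t by (simp add: br_def)
      also have "\<dots> \<le> br t ^ 3" by (intro power_increasing br_ge1) auto
      finally show ?thesis .
    qed
    have "norm (f t) \<le> 2 * B * (1 / 2) ^ k" for k
    proof -
      have "norm (f t) \<le> (2 * \<Lambda> ^ k * (B * (L ^ 6) ^ k)) / br t ^ (3 * k)"
        using \<Lambda> growth by (intro order_trans[OF fb[of t k]] divide_right_mono mult_left_mono) auto
      also have "\<dots> = 2 * B * (\<Lambda> * L ^ 6 / br t ^ 3) ^ k"
        unfolding power_mult power_mult_distrib power_divide by (simp only: times_divide_eq_right mult_ac)
      also have "\<dots> \<le> 2 * B * (1 / 2) ^ k"
      proof (intro mult_left_mono power_mono)
        show "\<Lambda> * L ^ 6 / br t ^ 3 \<le> 1 / 2" using R3 by (simp add: pos_divide_le_eq br_pos R_def)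
      qed (use \<Lambda> L B in auto)
      finally show ?thesis .
    qed
    moreover have "(\<lambda>k. 2 * B * (1 / 2) ^ k) \<longlonglongrightarrow> 2 * B * 0"
      by (intro tendsto_mult_left LIMSEQ_realpow_zero) auto
    ultimately have "norm (f t) \<le> 2 * B * 0" by (intro LIMSEQ_le_const[of "\<lambda>k. 2 * B * (1 / 2) ^ k"]) blast+
    then show ?thesis by simp
  qed
  define q where "q = 2 * pi * L ^ 6 * (\<bar>t\<bar> + R + 1)"
  have bound: "norm (f t) \<le> 2 * B * (inverse (fact k) * q ^ k)" for k
  proof -
    \<comment> \<open>Any number of zeros is available between \<open>R\<close> and
      \<open>R + 1\<close>, at bounded distance from \<open>t\<close>. The interpolation error is
      then a geometric sequence divided by \<open>fact k\<close>, which tends to 0; this takes the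
      place of an appeal to analyticity.\<close>
    define Z where "Z = (\<lambda>j. R + 1 / real (Suc j)) ` {..<k}"
    have inj: "inj_on (\<lambda>j. R + 1 / real (Suc j)) {..<k}" by (rule inj_onI) simp
    have Z: "finite Z" "card Z = k" unfolding Z_def using inj by (auto simp: card_image)
    have Zf: "f z = 0" if "z \<in> Z" for z using that R by (intro vanish) (auto simp: Z_def)
    have "norm (iter_deriv k f s) \<le> (2 * pi) ^ k * (B * (L ^ 6) ^ k)" for s
    proof (rule order_trans[OF iter_deriv_le_mom[OF f]])
      have "mom k ?g \<le> B * (L ^ 6) ^ k" using growth[of k] mom_nonneg[of k f] by (simp add: a_def)
      then show "(2 * pi) ^ k * mom k ?g \<le> (2 * pi) ^ k * (B * (L ^ 6) ^ k)" by (intro mult_left_mono) auto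
    qed
    from schwartz_lagrange[OF f Z Zf this]
    have "norm (f t) \<le> 2 * ((2 * pi) ^ k * (B * (L ^ 6) ^ k) * (\<Prod>z\<in>Z. \<bar>t - z\<bar>) / fact k)" .
    also have "\<dots> \<le> 2 * ((2 * pi) ^ k * (B * (L ^ 6) ^ k) * (\<bar>t\<bar> + R + 1) ^ k / fact k)"
    proof (intro mult_left_mono divide_right_mono)
      have "(\<Prod>z\<in>Z. \<bar>t - z\<bar>) \<le> (\<Prod>z\<in>Z. \<bar>t\<bar> + R + 1)"
      proof (intro prod_mono conjI)
        fix z assume "z \<in> Z"
        then obtain j where "z = R + 1 / real (Suc j)" by (auto simp: Z_def)
        moreover have "0 \<le> 1 / real (Suc j)" "1 / real (Suc j) \<le> 1" by auto
        ultimately show "\<bar>t - z\<bar> \<le> \<bar>t\<bar> + R + 1" using R by linarith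
      qed simp
      then show "(\<Prod>z\<in>Z. \<bar>t - z\<bar>) \<le> (\<bar>t\<bar> + R + 1) ^ k" using Z by simp
    qed (use B L in auto)
    also have "\<dots> = 2 * B * (inverse (fact k) * q ^ k)"
      by (simp add: q_def power_mult_distrib divide_inverse mult_ac)
    finally show ?thesis .
  qed
  have "(\<lambda>k. 2 * B * (inverse (fact k) * q ^ k)) \<longlonglongrightarrow> 2 * B * 0"
    by (intro tendsto_mult_left summable_LIMSEQ_zero summable_exp)
  then have "norm (f t) \<le> 2 * B * 0" by (rule LIMSEQ_le_const) (use bound in blast)
  then show ?thesis by simp
qed

end

section \<open>The interpolation formula\<close>

lemma has_sum_finite_sum:
  fixes f :: "'a \<Rightarrow> 'b \<Rightarrow> 'c::{topological_comm_monoid_add}"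
  assumes "finite I" "\<And>i. i \<in> I \<Longrightarrow> (f i has_sum s i) A"
  shows "((\<lambda>x. \<Sum>i\<in>I. f i x) has_sum (\<Sum>i\<in>I. s i)) A"
  using assms by (induction I rule: finite_induct) (auto intro!: has_sum_add)

lemma summable_on_finite_sum:
  fixes f :: "'a \<Rightarrow> 'b \<Rightarrow> 'c::{topological_comm_monoid_add}"
  assumes "finite I" "\<And>i. i \<in> I \<Longrightarrow> f i summable_on A"
  shows "(\<lambda>x. \<Sum>i\<in>I. f i x) summable_on A"
  using assms by (induction I rule: finite_induct) (auto intro!: summable_on_add)

lemma schwartz_norm_integral:
  assumes u: "u \<in> schwartz_space"
  shows "(LINT t|lborel. norm (u t)) \<le> 2 * brint * (schwartz_seminorm 0 0 u + schwartz_seminorm 2 0 u)"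
proof -
  let ?s = "schwartz_seminorm 0 0 u + schwartz_seminorm 2 0 u"
  have "(LINT t|lborel. norm (u t)) \<le> (LINT t|lborel. (2 * ?s) * (1 / br t ^ 2))"
  proof (intro integral_mono integrable_norm sch_integrable u integrable_mult_right integrable_br2)
    fix t :: real
    have "0 \<le> (1 - \<bar>t\<bar>)\<^sup>2" by simp
    then have "br t ^ 2 \<le> 2 * (1 + \<bar>t\<bar> ^ 2)" by (simp add: br_def power2_eq_square algebra_simps)
    then have "norm (u t) * br t ^ 2 \<le> norm (u t) * (2 * (1 + \<bar>t\<bar> ^ 2))" by (intro mult_left_mono) auto
    also have "\<dots> = 2 * (\<bar>t\<bar> ^ 0 * norm (iter_deriv 0 u t) + \<bar>t\<bar> ^ 2 * norm (iter_deriv 0 u t))" by (simp add: algebra_simps)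
    also have "\<dots> \<le> 2 * ?s" by (intro mult_left_mono add_mono schwartz_seminorm_upper u) auto
    finally show "norm (u t) \<le> (2 * ?s) * (1 / br t ^ 2)" by (simp add: pos_le_divide_eq)
  qed
  then show ?thesis unfolding integral_mult_right_zero brint_def[symmetric] by (simp only: mult_ac)
qed

lemma fourier_sum:
  assumes "\<And>i. i \<in> I \<Longrightarrow> u i \<in> schwartz_space"
  shows "fourier (\<lambda>t. \<Sum>i\<in>I. c i * u i t) \<xi> = (\<Sum>i\<in>I. c i * fourier (u i) \<xi>)"
proof -
  have "fourier (\<lambda>t. \<Sum>i\<in>I. c i * u i t) \<xi> = (LINT t|lborel. (\<Sum>i\<in>I. c i * (u i t * cis (- 2 * pi * t * \<xi>))))"
    unfolding fourier_cis by (simp add: sum_distrib_right mult.assoc)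
  also have "\<dots> = (\<Sum>i\<in>I. c i * fourier (u i) \<xi>)"
    unfolding fourier_cis
    by (subst Bochner_Integration.integral_sum[OF integrable_mult_right[OF integrable_fourier_integrand[OF sch_integrable[OF assms]]]])
       auto
  finally show ?thesis .
qed

lemma fourier_diff:
  assumes "f \<in> schwartz_space" "g \<in> schwartz_space"
  shows "fourier (\<lambda>t. f t - g t) \<xi> = fourier f \<xi> - fourier g \<xi>"
  unfolding fourier_cis left_diff_distrib
  by (intro Bochner_Integration.integral_diff integrable_fourier_integrand sch_integrable assms)

context two_samplings begin

lemma sample_sum:
  assumes "\<And>i. i \<in> I \<Longrightarrow> u i \<in> schwartz_space"
  shows "sample k (\<lambda>t. \<Sum>i\<in>I. c i * u i t) = (\<Sum>i\<in>I. c i * sample k (u i))"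
  using fourier_sum[OF assms] by (auto simp: sample_def split: sum.splits)

lemma sample_diff:
  assumes "f \<in> schwartz_space" "g \<in> schwartz_space"
  shows "sample k (\<lambda>t. f t - g t) = sample k f - sample k g"
  using fourier_diff[OF assms] by (auto simp: sample_def split: sum.splits)

text \<open>Continuity of the sampling functionals on the Schwartz space, uniformly in
  \<open>k\<close>: values are bounded by the supremum, values of the transform by the integral of
  the modulus.\<close>

lemma sample_bound:
  assumes u: "u \<in> schwartz_space"
  shows "norm (sample k u) \<le> (1 + 2 * brint) * (schwartz_seminorm 0 0 u + schwartz_seminorm 2 0 u)"
proof -
  let ?s = "schwartz_seminorm 0 0 u + schwartz_seminorm 2 0 u"
  have s: "0 \<le> schwartz_seminorm 2 0 u" "0 \<le> ?s" using schwartz_seminorm_nonneg[OF u] by auto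
  have "norm (u t) \<le> ?s" for t using schwartz_seminorm_upper[OF u, of t 0 0] s by simp
  moreover have "norm (fourier u \<xi>) \<le> 2 * brint * ?s" for \<xi>
    by (rule order_trans[OF norm_fourier_le schwartz_norm_integral[OF u]])
  moreover have "0 \<le> 2 * brint * ?s" using s brint_nonneg by simp
  ultimately show ?thesis
    unfolding distrib_right mult_1 using s by (cases k) (auto simp: sample_def intro: add_increasing add_increasing2)
qed

text \<open>Gaussian elimination. The coefficient of \<open>u i\<close> is the sample
  \<open>i\<close> of the combination of the \<open>v j\<close>. For a new \<open>v j0\<close>, the
  prediction \<open>s\<close> of the system found so far is subtracted. If all samples of the
  remainder \<open>r\<close> vanish, then \<open>r\<close> is 0 by \<open>samples_determine\<close>;
  otherwise some nonzero sample of \<open>r\<close> serves as pivot.\<close>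

lemma finitely_many_samples:
  assumes "finite J" "\<And>j. j \<in> J \<Longrightarrow> v j \<in> schwartz_space"
  shows "\<exists>I u. finite I \<and> (\<forall>i\<in>I. u i \<in> schwartz_space) \<and>
     (\<forall>c t. (\<Sum>j\<in>J. c j * v j t) = (\<Sum>i\<in>I. (\<Sum>j\<in>J. c j * sample i (v j)) * u i t))"
  using assms
proof (induction J rule: finite_induct)
  case empty
  show ?case by (rule exI[of _ "{}"]) simp
next
  case (insert j0 J)
  then obtain I u where I: "finite I" "\<forall>i\<in>I. u i \<in> schwartz_space"
    and rep: "\<forall>c t. (\<Sum>j\<in>J. c j * v j t) = (\<Sum>i\<in>I. (\<Sum>j\<in>J. c j * sample i (v j)) * u i t)" by auto
  have v0: "v j0 \<in> schwartz_space" using insert.prems by auto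
  have uI: "\<And>i. i \<in> I \<Longrightarrow> u i \<in> schwartz_space" using I by blast
  define s where "s t = (\<Sum>i\<in>I. sample i (v j0) * u i t)" for t
  define r where "r t = v j0 t - s t" for t
  have sS: "s \<in> schwartz_space" unfolding s_def[abs_def] by (rule sch_sum[OF uI])
  have rS: "r \<in> schwartz_space" unfolding r_def[abs_def] by (rule schwartz_space_diff[OF v0 sS])
  have split: "(\<Sum>j\<in>insert j0 J. c j * v j t) = (\<Sum>i\<in>I. (\<Sum>j\<in>insert j0 J. c j * sample i (v j)) * u i t) + c j0 * r t" for c t
  proof -
    have "(\<Sum>i\<in>I. (\<Sum>j\<in>insert j0 J. c j * sample i (v j)) * u i t)
      = c j0 * s t + (\<Sum>i\<in>I. (\<Sum>j\<in>J. c j * sample i (v j)) * u i t)"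
      using insert.hyps by (simp add: s_def distrib_right sum.distrib sum_distrib_left mult.assoc)
    moreover have "(\<Sum>j\<in>insert j0 J. c j * v j t) = c j0 * v j0 t + (\<Sum>j\<in>J. c j * v j t)"
      using insert.hyps by simp
    ultimately show ?thesis using rep[rule_format, of c t] by (simp add: r_def algebra_simps)
  qed
  show ?case
  proof (cases "\<forall>k. sample k r = 0")
    case True
    then have "r t = 0" for t using samples_determine[OF rS] by blast
    then show ?thesis using I split by (intro exI[of _ I] exI[of _ u]) simp
  next
    case False
    then obtain k where k: "sample k r \<noteq> 0" by blast
    define \<rho> where "\<rho> t = (1 / sample k r) * r t" for t
    have \<rho>S: "\<rho> \<in> schwartz_space"
      using sch_sum[of "{()}" "\<lambda>_. r" "\<lambda>_. 1 / sample k r"] rS by (simp add: \<rho>_def[abs_def])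
    \<comment> \<open>The two contributions are added, since the pivot \<open>k\<close> may already
      belong to \<open>I\<close>.\<close>
    define u' where "u' i t = (if i \<in> I then u i t - sample k (u i) * \<rho> t else 0) + (if i = k then \<rho> t else 0)" for i t
    have u'S: "u' i \<in> schwartz_space" for i
    proof -
      \<comment> \<open>Presents \<open>u' i\<close> as a combination of two Schwartz functions. As
        \<open>u i\<close> is known to be Schwartz only for \<open>i \<in> I\<close>, the first slot
        otherwise holds \<open>\<rho>\<close> with coefficient 0.\<close>
      let ?w = "\<lambda>b :: bool. if b then (if i \<in> I then u i else \<rho>) else \<rho>"
      let ?d = "\<lambda>b :: bool. if b then (if i \<in> I then 1 else 0) else (if i \<in> I then - sample k (u i) else 0) + (if i = k then 1 else 0)"
      have "(\<lambda>t. \<Sum>b\<in>UNIV. ?d b * ?w b t) \<in> schwartz_space" by (rule sch_sum) (use uI \<rho>S in auto)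
      moreover have "(\<lambda>t. \<Sum>b\<in>UNIV. ?d b * ?w b t) = u' i"
        by (auto simp: UNIV_bool u'_def fun_eq_iff algebra_simps)
      ultimately show ?thesis by simp
    qed
    have "(\<Sum>j\<in>insert j0 J. c j * v j t) = (\<Sum>i\<in>insert k I. (\<Sum>j\<in>insert j0 J. c j * sample i (v j)) * u' i t)" for c t
    proof -
      let ?l = "\<lambda>i. \<Sum>j\<in>insert j0 J. c j * sample i (v j)"
      have "?l k = sample k (\<lambda>t. \<Sum>j\<in>insert j0 J. c j * v j t)"
        by (rule sample_sum[symmetric]) (use insert.prems in auto)
      \<comment> \<open>Indexing by \<open>option\<close> makes this a single sum to which
        \<open>sample_sum\<close> applies: \<open>None\<close> stands for the remainder
        \<open>r\<close>, \<open>Some i\<close> for \<open>u i\<close>.\<close>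
      also have "\<dots> = sample k (\<lambda>t. \<Sum>i\<in>insert None (Some ` I). (case i of None \<Rightarrow> c j0 | Some i \<Rightarrow> ?l i) * (case i of None \<Rightarrow> r | Some i \<Rightarrow> u i) t)"
        unfolding split using I(1) by (simp add: sum.reindex add.commute)
      also have "\<dots> = (\<Sum>i\<in>insert None (Some ` I). (case i of None \<Rightarrow> c j0 | Some i \<Rightarrow> ?l i) * sample k (case i of None \<Rightarrow> r | Some i \<Rightarrow> u i))"
        by (rule sample_sum) (use rS uI in auto)
      also have "\<dots> = c j0 * sample k r + (\<Sum>i\<in>I. ?l i * sample k (u i))"
        using I(1) by (simp add: sum.reindex)
      finally have "c j0 = (?l k - (\<Sum>i\<in>I. ?l i * sample k (u i))) / sample k r" using k by simp
      then have 1: "c j0 * r t = (?l k - (\<Sum>i\<in>I. ?l i * sample k (u i))) * \<rho> t" by (simp add: \<rho>_def)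
      have "(\<Sum>i\<in>insert k I. ?l i * u' i t) = (\<Sum>i\<in>insert k I. if i \<in> I then ?l i * (u i t - sample k (u i) * \<rho> t) else 0)
          + (\<Sum>i\<in>insert k I. if i = k then ?l k * \<rho> t else 0)"
        unfolding u'_def sum.distrib[symmetric] by (intro sum.cong refl) (auto simp: distrib_left)
      also have "(\<Sum>i\<in>insert k I. if i = k then ?l k * \<rho> t else 0) = ?l k * \<rho> t"
        using I(1) by (subst sum.delta) auto
      also have "(\<Sum>i\<in>insert k I. if i \<in> I then ?l i * (u i t - sample k (u i) * \<rho> t) else 0) = (\<Sum>i\<in>I. ?l i * (u i t - sample k (u i) * \<rho> t))"
        using I(1) by (intro sum.mono_neutral_cong_right) auto
      also have "\<dots> = (\<Sum>i\<in>I. ?l i * u i t) - (\<Sum>i\<in>I. ?l i * sample k (u i)) * \<rho> t"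
        by (simp only: right_diff_distrib sum_subtractf sum_distrib_right mult.assoc)
      finally show ?thesis unfolding split 1 by (simp only: left_diff_distrib) simp
    qed
    then show ?thesis using I(1) u'S by (intro exI[of _ "insert k I"] exI[of _ u']) blast
  qed
qed

text \<open>Let \<open>w\<close> be the finite-dimensional remainder, that is \<open>f\<close> minus
  the sum of \<open>sample m f * H m\<close>. It is recovered from its samples
  \<open>sample i w\<close>, and these are \<open>sample i f\<close> minus the sum of
  \<open>sample m f * sample i (H m)\<close>. Collecting everything that multiplies
  \<open>sample m f\<close> gives \<open>\<Phi> m\<close>.\<close>

lemma reconstruction:
  "\<exists>\<Phi>. (\<forall>m. \<Phi> m \<in> schwartz_space) \<and>
     (\<forall>f\<in>schwartz_space. (\<forall>k l. (\<lambda>m. norm (sample m f) * schwartz_seminorm k l (\<Phi> m)) summable_on UNIV) \<and>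
        (\<forall>t. ((\<lambda>m. sample m f * \<Phi> m t) has_sum f t) UNIV))"
proof -
  obtain H J v where H': "\<forall>i. H i \<in> schwartz_space" and J: "finite (J :: (int \<times> int \<times> bool) set)"
    and v': "\<forall>j\<in>J. v j \<in> schwartz_space"
    and Hsum: "\<forall>f\<in>schwartz_space. \<forall>k l. (\<lambda>i. norm (sample i f) * schwartz_seminorm k l (H i)) summable_on UNIV"
    and approx: "\<forall>f\<in>schwartz_space. \<exists>\<mu>. \<forall>t. ((\<lambda>i. sample i f * H i t) has_sum (f t - (\<Sum>j\<in>J. \<mu> j * v j t))) UNIV"
    by (use approximate_reconstruction in \<open>elim exE conjE\<close>) (rule that)
  have H: "\<And>i. H i \<in> schwartz_space" and v: "\<And>j. j \<in> J \<Longrightarrow> v j \<in> schwartz_space"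
    using H' v' by blast+
  obtain I u where I: "finite I" and u': "\<forall>i\<in>I. u i \<in> schwartz_space"
    and fin: "\<forall>c t. (\<Sum>j\<in>J. c j * v j t) = (\<Sum>i\<in>I. (\<Sum>j\<in>J. c j * sample i (v j)) * u i t)"
    using finitely_many_samples[of J v, OF J v] by blast
  have u: "\<And>i. i \<in> I \<Longrightarrow> u i \<in> schwartz_space" using u' by blast
  define O' where "O' = insert None (Some ` I)"
  \<comment> \<open>The entry at \<open>Some i\<close> is the coefficient of
    \<open>sample m f\<close> in \<open>sample i w\<close>.\<close>
  define a where "a m o' = (case o' of None \<Rightarrow> 1 | Some i \<Rightarrow> (if i = m then 1 else 0) - sample i (H m))" for m o'
  define W where "W m o' = (case o' of None \<Rightarrow> H m | Some i \<Rightarrow> u i)" for m o'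
  define \<Phi> where "\<Phi> m t = (\<Sum>o'\<in>O'. a m o' * W m o' t)" for m t
  have WS: "W m o' \<in> schwartz_space" if "o' \<in> O'" for m o'
    using that H u by (auto simp: W_def O'_def)
  have sumO: "(\<Sum>o'\<in>O'. g o') = g None + (\<Sum>i\<in>I. g (Some i))" for g :: "(int + int) option \<Rightarrow> 'z::comm_monoid_add"
    unfolding O'_def using I by (simp add: sum.reindex)
  have \<Phi>S: "\<Phi> m \<in> schwartz_space" for m
    unfolding \<Phi>_def[abs_def] by (rule sch_sum[OF WS])
  have summ: "(\<lambda>m. norm (sample m f) * schwartz_seminorm k l (\<Phi> m)) summable_on UNIV" if f: "f \<in> schwartz_space" for f k l
  proof -
    let ?D = "1 + 2 * brint"
    let ?h = "\<lambda>m. schwartz_seminorm 0 0 (H m) + schwartz_seminorm 2 0 (H m)"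
    let ?u = "\<lambda>i. schwartz_seminorm k l (u i)"
    let ?c = "\<lambda>m. norm (sample m f)"
    have u0: "0 \<le> ?u i" if "i \<in> I" for i by (rule schwartz_seminorm_nonneg[OF u[OF that]])
    have le: "schwartz_seminorm k l (\<Phi> m) \<le> schwartz_seminorm k l (H m) + (\<Sum>i\<in>I. ((if i = m then 1 else 0) + ?D * ?h m) * ?u i)" for m
    proof -
      have "schwartz_seminorm k l (\<Phi> m) \<le> (\<Sum>o'\<in>O'. norm (a m o') * schwartz_seminorm k l (W m o'))"
        unfolding \<Phi>_def[abs_def] by (rule seminorm_sum[OF WS])
      also have "\<dots> = schwartz_seminorm k l (H m) + (\<Sum>i\<in>I. norm ((if i = m then 1 else 0) - sample i (H m)) * ?u i)"
        unfolding sumO by (simp add: a_def W_def)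
      also have "\<dots> \<le> schwartz_seminorm k l (H m) + (\<Sum>i\<in>I. ((if i = m then 1 else 0) + ?D * ?h m) * ?u i)"
      proof (intro add_left_mono sum_mono mult_right_mono u0)
        fix i
        have "norm ((if i = m then 1 else 0) - sample i (H m)) \<le> norm (if i = m then 1 else (0 :: complex)) + norm (sample i (H m))"
          by (rule norm_triangle_ineq4)
        also have "\<dots> \<le> (if i = m then 1 else 0) + ?D * ?h m"
          by (intro add_mono sample_bound H) auto
        finally show "norm ((if i = m then 1 else 0) - sample i (H m)) \<le> (if i = m then 1 else 0) + ?D * ?h m" .
      qed
      finally show ?thesis .
    qed
    have 1: "(\<lambda>m. ?c m * (if i = m then 1 else 0) * ?u i) summable_on UNIV" for i
    proof -
      have "(\<lambda>m. ?c m * (if i = m then 1 else 0) * ?u i) summable_on {i}" by (rule summable_on_finite) simp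
      then show ?thesis by (rule summable_on_cong_neutral[THEN iffD1, rotated -1]) auto
    qed
    have 2: "(\<lambda>m. (?D * ?u i) * (?c m * schwartz_seminorm 0 0 (H m) + ?c m * schwartz_seminorm 2 0 (H m))) summable_on UNIV" for i
      by (intro summable_on_cmult_right summable_on_add Hsum[rule_format] f)
    have "(\<lambda>m. ?c m * schwartz_seminorm k l (H m) + (\<Sum>i\<in>I. ?c m * (if i = m then 1 else 0) * ?u i
        + (?D * ?u i) * (?c m * schwartz_seminorm 0 0 (H m) + ?c m * schwartz_seminorm 2 0 (H m)))) summable_on UNIV"
      by (intro summable_on_finite_sum[OF I] summable_on_add Hsum[rule_format] f 1 2)
    then show ?thesis
    proof (rule summable_on_comparison_test)
      fix m
      have "?c m * schwartz_seminorm k l (\<Phi> m) \<le> ?c m * (schwartz_seminorm k l (H m) + (\<Sum>i\<in>I. ((if i = m then 1 else 0) + ?D * ?h m) * ?u i))"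
        by (intro mult_left_mono le) simp
      also have "\<dots> = ?c m * schwartz_seminorm k l (H m) + (\<Sum>i\<in>I. ?c m * (if i = m then 1 else 0) * ?u i
        + (?D * ?u i) * (?c m * schwartz_seminorm 0 0 (H m) + ?c m * schwartz_seminorm 2 0 (H m)))"
        unfolding distrib_left sum_distrib_left distrib_right by (simp only: mult_ac distrib_left distrib_right)
      finally show "?c m * schwartz_seminorm k l (\<Phi> m) \<le> ?c m * schwartz_seminorm k l (H m) + (\<Sum>i\<in>I. ?c m * (if i = m then 1 else 0) * ?u i
        + (?D * ?u i) * (?c m * schwartz_seminorm 0 0 (H m) + ?c m * schwartz_seminorm 2 0 (H m)))" .
      show "0 \<le> ?c m * schwartz_seminorm k l (\<Phi> m)" by (intro mult_nonneg_nonneg schwartz_seminorm_nonneg \<Phi>S) simp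
    qed
  qed
  have rep: "((\<lambda>m. sample m f * \<Phi> m t) has_sum f t) UNIV" if f: "f \<in> schwartz_space" for f t
  proof -
    let ?c = "\<lambda>m. sample m f"
    obtain \<mu> where \<mu>: "\<And>t. ((\<lambda>m. ?c m * H m t) has_sum (f t - (\<Sum>j\<in>J. \<mu> j * v j t))) UNIV"
      using approx[rule_format, OF f] by blast
    define w where "w t = (\<Sum>j\<in>J. \<mu> j * v j t)" for t
    have wS: "w \<in> schwartz_space" unfolding w_def[abs_def] by (rule sch_sum[OF v])
    let ?u = "\<lambda>m t. ?c m * H m t"
    have uS: "?u m \<in> schwartz_space" for m
      using sch_sum[of "{()}" "\<lambda>_. H m" "\<lambda>_. ?c m"] H by simp
    have usm: "(\<lambda>m. schwartz_seminorm k l (?u m)) summable_on UNIV" for k l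
    proof (rule summable_on_comparison_test[OF Hsum[rule_format, OF f, of k l]])
      show "schwartz_seminorm k l (?u m) \<le> norm (?c m) * schwartz_seminorm k l (H m)" for m
        using seminorm_sum[of "{()}" "\<lambda>_. H m" k l "\<lambda>_. ?c m"] H by simp
    qed (rule schwartz_seminorm_nonneg[OF uS])
    have Tf: "(\<Sum>\<^sub>\<infinity>m. ?u m t) = f t - w t" for t using infsumI[OF \<mu>] by (simp add: w_def)
    have TS: "(\<lambda>t. f t - w t) \<in> schwartz_space" by (rule schwartz_space_diff[OF f wS])
    \<comment> \<open>By \<open>sample_bound\<close> sampling is continuous, so it may be applied
      termwise to the series of the \<open>H m\<close>, which converges in every seminorm.\<close>
    have samp_sum: "((\<lambda>m. ?c m * sample i (H m)) has_sum (sample i f - sample i w)) UNIV" for i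
      unfolding has_sum_def
    proof (rule LIM_zero_cancel, rule Lim_null_comparison)
      let ?d = "\<lambda>F t. (\<Sum>m\<in>F. ?u m t) - (\<Sum>\<^sub>\<infinity>m. ?u m t)"
      show "\<forall>\<^sub>F F in finite_subsets_at_top UNIV. norm ((\<Sum>m\<in>F. ?c m * sample i (H m)) - (sample i f - sample i w))
          \<le> (1 + 2 * brint) * (schwartz_seminorm 0 0 (?d F) + schwartz_seminorm 2 0 (?d F))"
      proof (intro always_eventually allI)
        fix F
        have PS: "(\<lambda>t. \<Sum>m\<in>F. ?u m t) \<in> schwartz_space" by (rule sch_sum) (rule H)
        have dS: "?d F \<in> schwartz_space" unfolding Tf by (rule schwartz_space_diff[OF PS TS])
        have "sample i (?d F) = (\<Sum>m\<in>F. ?c m * sample i (H m)) - (sample i f - sample i w)"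
          unfolding Tf sample_diff[OF PS TS] sample_diff[OF f wS] sample_sum[of F H i ?c, OF H] ..
        then show "norm ((\<Sum>m\<in>F. ?c m * sample i (H m)) - (sample i f - sample i w))
          \<le> (1 + 2 * brint) * (schwartz_seminorm 0 0 (?d F) + schwartz_seminorm 2 0 (?d F))"
          using sample_bound[OF dS, of i] by simp
      qed
      have "((\<lambda>F. (1 + 2 * brint) * (schwartz_seminorm 0 0 (?d F) + schwartz_seminorm 2 0 (?d F))) \<longlongrightarrow> (1 + 2 * brint) * (0 + 0)) (finite_subsets_at_top UNIV)"
        by (intro tendsto_mult_left tendsto_add sch_partial_sums_tendsto uS usm)
      then show "((\<lambda>F. (1 + 2 * brint) * (schwartz_seminorm 0 0 (?d F) + schwartz_seminorm 2 0 (?d F))) \<longlongrightarrow> 0) (finite_subsets_at_top UNIV)"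
        by simp
    qed
    have single: "((\<lambda>m. ?c m * (if i = m then 1 else 0)) has_sum ?c i) UNIV" for i
    proof -
      have "((\<lambda>m. ?c m * (if i = m then 1 else 0)) has_sum (\<Sum>m\<in>{i}. ?c m * (if i = m then 1 else 0))) {i}"
        by (rule has_sum_finite) simp
      then have "((\<lambda>m. ?c m * (if i = m then 1 else 0)) has_sum ?c i) {i}" by simp
      then show ?thesis by (rule has_sum_cong_neutral[THEN iffD1, rotated -1]) auto
    qed
    have diff: "((\<lambda>m. ?c m * (if i = m then 1 else 0) - ?c m * sample i (H m)) has_sum (?c i - (sample i f - sample i w))) UNIV" for i
      using has_sum_add[OF single[of i] has_sum_cmult_right[OF samp_sum[of i], of "- 1"]] by simp
    have step: "((\<lambda>m. (?c m * (if i = m then 1 else 0) - ?c m * sample i (H m)) * u i t) has_sum (sample i w * u i t)) UNIV" for i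
      using has_sum_cmult_left[OF diff[of i], of "u i t"] by simp
    have "((\<lambda>m. \<Sum>i\<in>I. (?c m * (if i = m then 1 else 0) - ?c m * sample i (H m)) * u i t) has_sum (\<Sum>i\<in>I. sample i w * u i t)) UNIV"
      by (rule has_sum_finite_sum[OF I step])
    then have "((\<lambda>m. ?c m * H m t + (\<Sum>i\<in>I. (?c m * (if i = m then 1 else 0) - ?c m * sample i (H m)) * u i t)) has_sum ((f t - w t) + (\<Sum>i\<in>I. sample i w * u i t))) UNIV"
      using \<mu>[of t] by (intro has_sum_add) (simp_all add: w_def)
    moreover have "(\<Sum>i\<in>I. sample i w * u i t) = w t"
    proof -
      have "sample i w = (\<Sum>j\<in>J. \<mu> j * sample i (v j))" for i unfolding w_def[abs_def] by (rule sample_sum[OF v])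
      then show ?thesis unfolding w_def using fin[rule_format, of \<mu> t] by simp
    qed
    moreover have "?c m * H m t + (\<Sum>i\<in>I. (?c m * (if i = m then 1 else 0) - ?c m * sample i (H m)) * u i t) = ?c m * \<Phi> m t" for m
    proof -
      have "\<Phi> m t = H m t + (\<Sum>i\<in>I. ((if i = m then 1 else 0) - sample i (H m)) * u i t)"
        unfolding \<Phi>_def sumO by (simp add: a_def W_def)
      then show ?thesis by (simp only: distrib_left sum_distrib_left right_diff_distrib[symmetric] mult.assoc)
    qed
    ultimately show ?thesis by simp
  qed
  show ?thesis using \<Phi>S summ rep by blast
qed

end

theorem theorem1p3:
  fixes D :: real
  assumes "D > 7 / 2"
  shows "\<exists>c::real. c > 0 \<and>
    (\<forall>x y :: int \<Rightarrow> real.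
       mono x \<longrightarrow> mono y \<longrightarrow>
       filterlim (\<lambda>n. \<bar>x n\<bar>) at_top (filtercomap abs at_top) \<longrightarrow>
       filterlim (\<lambda>n. \<bar>y n\<bar>) at_top (filtercomap abs at_top) \<longrightarrow>
       range x = range (\<lambda>n. - x n) \<longrightarrow>
       range y = range (\<lambda>n. - y n) \<longrightarrow>
       max (Limsup at_top (\<lambda>n. ereal (\<bar>x (n + 1)\<bar> powr D * \<bar>x (n + 1) - x n\<bar>)))
           (Limsup at_top (\<lambda>n. ereal (\<bar>y (n + 1)\<bar> powr D * \<bar>y (n + 1) - y n\<bar>))) \<le> ereal c \<longrightarrow>
       (\<exists>h g :: int \<Rightarrow> real \<Rightarrow> complex.
          (\<forall>n. h n \<in> schwartz_space) \<and> (\<forall>n. g n \<in> schwartz_space) \<and>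
          (\<forall>f \<in> schwartz_space.
             (\<forall>t. f t = (\<Sum>\<^sub>\<infinity>n. f (x n) * h n t) + (\<Sum>\<^sub>\<infinity>n. fourier f (y n) * g n t)) \<and>
             schwartz_has_sum (\<lambda>n t. f (x n) * h n t) (\<lambda>t. \<Sum>\<^sub>\<infinity>n. f (x n) * h n t) \<and>
             schwartz_has_sum (\<lambda>n t. fourier f (y n) * g n t)
               (\<lambda>t. \<Sum>\<^sub>\<infinity>n. fourier f (y n) * g n t))))"
proof (rule exI[of _ 1], intro conjI allI impI)
  fix x y :: "int \<Rightarrow> real"
  assume x: "mono x" "filterlim (\<lambda>n. \<bar>x n\<bar>) at_top (filtercomap abs at_top)" "range x = range (\<lambda>n. - x n)"
    and y: "mono y" "filterlim (\<lambda>n. \<bar>y n\<bar>) at_top (filtercomap abs at_top)" "range y = range (\<lambda>n. - y n)"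
    and gap: "max (Limsup at_top (\<lambda>n. ereal (\<bar>x (n + 1)\<bar> powr D * \<bar>x (n + 1) - x n\<bar>)))
           (Limsup at_top (\<lambda>n. ereal (\<bar>y (n + 1)\<bar> powr D * \<bar>y (n + 1) - y n\<bar>))) \<le> ereal 1"
  have D: "D \<ge> 3" using assms by simp
  obtain idx C where X: "sampling x idx C"
    using sampling_exists[OF x D] gap by (auto simp: one_ereal_def)
  obtain idy C' where Y: "sampling y idy C'"
    using sampling_exists[OF y D] gap by (auto simp: one_ereal_def)
  interpret two_samplings x idx C y idy C'
    unfolding two_samplings_def using X Y by simp
  obtain \<Phi> where \<Phi>: "\<And>m. \<Phi> m \<in> schwartz_space"
    and sm: "\<And>f k l. f \<in> schwartz_space \<Longrightarrow> (\<lambda>m. norm (sample m f) * schwartz_seminorm k l (\<Phi> m)) summable_on UNIV"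
    and rep: "\<And>f t. f \<in> schwartz_space \<Longrightarrow> ((\<lambda>m. sample m f * \<Phi> m t) has_sum f t) UNIV"
    using reconstruction by blast
  \<comment> \<open>Both series are subfamilies of the one over the disjoint union, along the
    injections \<open>Inl\<close> and \<open>Inr\<close>; absolute summability of the seminorms
    passes to subfamilies.\<close>
  have family: "schwartz_has_sum (\<lambda>n t. sample (e n) f * \<Phi> (e n) t) (\<lambda>t. \<Sum>\<^sub>\<infinity>n. sample (e n) f * \<Phi> (e n) t)"
    if f: "f \<in> schwartz_space" and e: "inj e" for f and e :: "int \<Rightarrow> int + int"
  proof (rule schwartz_has_sumI)
    show S: "(\<lambda>t. sample (e n) f * \<Phi> (e n) t) \<in> schwartz_space" for n
      using sch_sum[of "{()}" "\<lambda>_. \<Phi> (e n)" "\<lambda>_. sample (e n) f"] \<Phi> by simp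
    fix k l
    let ?q = "\<lambda>m. norm (sample m f) * schwartz_seminorm k l (\<Phi> m)"
    have "?q summable_on range e" using sm[OF f] by (rule summable_on_subset_banach) auto
    then have "(\<lambda>n. ?q (e n)) summable_on UNIV" using summable_on_reindex[OF e, of ?q] by (simp add: o_def)
    then show "(\<lambda>n. schwartz_seminorm k l (\<lambda>t. sample (e n) f * \<Phi> (e n) t)) summable_on UNIV"
    proof (rule summable_on_comparison_test)
      show "schwartz_seminorm k l (\<lambda>t. sample (e n) f * \<Phi> (e n) t) \<le> ?q (e n)" for n
        using seminorm_sum[of "{()}" "\<lambda>_. \<Phi> (e n)" k l "\<lambda>_. sample (e n) f"] \<Phi> by simp
    qed (rule schwartz_seminorm_nonneg[OF S])
  qed
  have total: "f t = (\<Sum>\<^sub>\<infinity>n. sample (Inl n) f * \<Phi> (Inl n) t) + (\<Sum>\<^sub>\<infinity>n. sample (Inr n) f * \<Phi> (Inr n) t)"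
    if f: "f \<in> schwartz_space" for f t
  proof -
    let ?q = "\<lambda>m. sample m f * \<Phi> m t"
    have s: "?q summable_on X" for X
      using has_sum_imp_summable[OF rep[OF f, of t]] by (rule summable_on_subset_banach) auto
    have "f t = infsum ?q UNIV" using infsumI[OF rep[OF f, of t]] by simp
    also have "\<dots> = infsum ?q (range Inl) + infsum ?q (range Inr)"
      unfolding UNIV_sum by (rule infsum_Un_disjoint[OF s s]) auto
    also have "infsum ?q (range Inl) = (\<Sum>\<^sub>\<infinity>n. ?q (Inl n))" by (subst infsum_reindex) (auto simp: o_def)
    also have "infsum ?q (range Inr) = (\<Sum>\<^sub>\<infinity>n. ?q (Inr n))" by (subst infsum_reindex) (auto simp: o_def)
    finally show ?thesis .
  qed
  show "\<exists>h g :: int \<Rightarrow> real \<Rightarrow> complex.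
          (\<forall>n. h n \<in> schwartz_space) \<and> (\<forall>n. g n \<in> schwartz_space) \<and>
          (\<forall>f \<in> schwartz_space.
             (\<forall>t. f t = (\<Sum>\<^sub>\<infinity>n. f (x n) * h n t) + (\<Sum>\<^sub>\<infinity>n. fourier f (y n) * g n t)) \<and>
             schwartz_has_sum (\<lambda>n t. f (x n) * h n t) (\<lambda>t. \<Sum>\<^sub>\<infinity>n. f (x n) * h n t) \<and>
             schwartz_has_sum (\<lambda>n t. fourier f (y n) * g n t)
               (\<lambda>t. \<Sum>\<^sub>\<infinity>n. fourier f (y n) * g n t))"
  proof (rule exI[of _ "\<lambda>n. \<Phi> (Inl n)"], rule exI[of _ "\<lambda>n. \<Phi> (Inr n)"], intro conjI allI ballI \<Phi>)
    fix f assume f: "f \<in> schwartz_space"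
    show "f t = (\<Sum>\<^sub>\<infinity>n. f (x n) * \<Phi> (Inl n) t) + (\<Sum>\<^sub>\<infinity>n. fourier f (y n) * \<Phi> (Inr n) t)" for t
      using total[OF f, of t] by (simp add: sample_def)
    show "schwartz_has_sum (\<lambda>n t. f (x n) * \<Phi> (Inl n) t) (\<lambda>t. \<Sum>\<^sub>\<infinity>n. f (x n) * \<Phi> (Inl n) t)"
      using family[OF f, of Inl] by (simp add: sample_def)
    show "schwartz_has_sum (\<lambda>n t. fourier f (y n) * \<Phi> (Inr n) t) (\<lambda>t. \<Sum>\<^sub>\<infinity>n. fourier f (y n) * \<Phi> (Inr n) t)"
      using family[OF f, of Inr] by (simp add: sample_def)
  qed
qed simp

end
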